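(* Let $p>3$ be a prime and $t\in\mathbb{F}_p^\times$. Then ${_2\widetilde{G}_2}(p,1)=\varphi(3)$, and if $t\neq 1$ then ${_2\widetilde{G}_2}(p,t)=\varphi(3t)\cdot(\#S(t)-1)$, where $S(t):=\{y\in\mathbb{F}_p: 27y^3-27y^2+\frac4t=0 \text{ in }\mathbb{F}_p\}$ and $\#S(t)$ is its cardinality.
   Context: $\varphi$ is the quadratic character of $\mathbb{F}_p$ (with $\varphi(0)=0$). $\omega$ denotes the Teichmüller character of $\mathbb{F}_p$ (values in $\mathbb{Z}_p$, $\omega(a)\equiv a\pmod p$, $\omega(0)=0$), $\overline{\omega}$ its inverse; $\Gamma_p$ is Morita's $p$-adic gamma function; $\lfloor x\rfloor$ is the floor and $\langle x\rangle=x-\lfloor x\rfloor$. McCarthy's function: for $t\in\mathbb{F}_p$, $m\ge 1$, $a_k,b_k\in\mathbb{Q}\cap\mathbb{Z}_p$, $$ {_m\mathbb{G}_m}\left[\begin{array}{ccc} a_1,&\ldots,&a_m\\ b_1,&\ldots,&b_m\end{array}\Big| t\right]_p:=\frac{-1}{p-1}\sum_{j=0}^{p-2}(-1)^{jm}\,\overline{\omega}^j(t)\prod_{k=1}^m(-p)^{-\lfloor\langle a_k\rangle-\frac{j}{p-1}\rfloor-\lfloor\langle -b_k\rangle+\frac{j}{p-1}\rfloor}\frac{\Gamma_p(\langle a_k-\frac{j}{p-1}\rangle)}{\Gamma_p(\langle a_k\rangle)}\frac{\Gamma_p(\langle -b_k+\frac{j}{p-1}\rangle)}{\Gamma_p(\langle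 -b_k\rangle)}.$$ ${_2\widetilde{G}_2}(p,t)$ denotes this function with $m=2$, upper parameters $\frac16,\frac56$ and lower parameters $0,\frac12$. *)

theory Defs
  imports
    "Berlekamp_Zassenhaus.Finite_Field"
    "HOL-Computational_Algebra.Fraction_Field"
    "HOL-Number_Theory.Number_Theory"
    Complex_Main
begin

text \<open>
  The prime \<open>p\<close> is carried by a type \<open>'p\<close> of class \<open>prime_card\<close>, as \<open>p = CARD('p)\<close>, and
  \<open>'p mod_ring\<close> is the field with \<open>p\<close> elements.
\<close>

section \<open>The \<open>p\<close>-adic integers and numbers\<close>

text \<open>
  The ring of \<open>p\<close>-adic integers is the inverse limit of the rings of integers modulo \<open>p ^ n\<close>;
  \<open>padic_residue z n\<close> is the representative of \<open>z\<close> modulo \<open>p ^ n\<close> in \<open>{0..<p ^ n}\<close>.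
\<close>

typedef (overloaded) ('p::prime_card) padic_int =
  "{x :: nat \<Rightarrow> int. (\<forall>n. x n \<in> {0..<int CARD('p) ^ n}) \<and>
      (\<forall>n. x (Suc n) mod int CARD('p) ^ n = x n)}"
  morphisms padic_residue Abs_padic_int
  by (rule exI[of _ "\<lambda>_. 0"]) (simp add: prime_gt_0_nat prime_card)

setup_lifting type_definition_padic_int

lemma card_pos_int [simp]: "int CARD('p::prime_card) > 0"
  using prime_card[where 'a='p] by (simp add: prime_gt_0_nat)

lemma card_gt_1_int [simp]: "int CARD('p::prime_card) > 1"
  using prime_gt_1_nat[OF prime_card[where 'a='p]] by simp

lemma padic_int_closed_aux:
  fixes f :: "nat \<Rightarrow> int"
  assumes "\<And>n. [f (Suc n) = f n] (mod (int CARD('p::prime_card) ^ n))"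
  shows "(\<forall>n. f n mod int CARD('p) ^ n \<in> {0..<int CARD('p) ^ n}) \<and>
      (\<forall>n. f (Suc n) mod int CARD('p) ^ Suc n mod int CARD('p) ^ n = f n mod int CARD('p) ^ n)"
  using assms
  by (auto simp: cong_def mod_mod_cancel le_imp_power_dvd simp del: power_Suc)

lemma padic_int_cong_aux:
  assumes "\<forall>n. x (Suc n) mod int CARD('p::prime_card) ^ n = x n"
  shows "[x (Suc n) = x n] (mod (int CARD('p) ^ n))"
  using assms by (metis cong_def mod_mod_trivial)

instantiation padic_int :: (prime_card) comm_ring_1
begin

lift_definition zero_padic_int :: "'a padic_int" is "\<lambda>_. 0"
  by simp

lift_definition one_padic_int :: "'a padic_int" is "\<lambda>n. 1 mod int CARD('a) ^ n"
  by (rule padic_int_closed_aux) simp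

lift_definition plus_padic_int :: "'a padic_int \<Rightarrow> 'a padic_int \<Rightarrow> 'a padic_int"
  is "\<lambda>x y n. (x n + y n) mod int CARD('a) ^ n"
  by (rule padic_int_closed_aux, rule cong_add; rule padic_int_cong_aux; blast)

lift_definition minus_padic_int :: "'a padic_int \<Rightarrow> 'a padic_int \<Rightarrow> 'a padic_int"
  is "\<lambda>x y n. (x n - y n) mod int CARD('a) ^ n"
  by (rule padic_int_closed_aux, rule cong_diff; rule padic_int_cong_aux; blast)

lift_definition uminus_padic_int :: "'a padic_int \<Rightarrow> 'a padic_int"
  is "\<lambda>x n. (- x n) mod int CARD('a) ^ n"
  by (rule padic_int_closed_aux, subst cong_minus_minus_iff, rule padic_int_cong_aux, blast)

lift_definition times_padic_int :: "'a padic_int \<Rightarrow> 'a padic_int \<Rightarrow> 'a padic_int"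
  is "\<lambda>x y n. (x n * y n) mod int CARD('a) ^ n"
  by (rule padic_int_closed_aux, rule cong_mult; rule padic_int_cong_aux; blast)

instance
proof
  fix a b c :: "'a padic_int"
  show "a + b + c = a + (b + c)" by transfer (simp add: mod_simps add.assoc)
  show "a + b = b + a" by transfer (simp add: add.commute)
  show "0 + a = a" by transfer simp
  show "- a + a = 0" by transfer (simp add: mod_simps)
  show "a - b = a + - b" by transfer (simp add: mod_simps)
  show "a * b * c = a * (b * c)" by transfer (simp add: mod_simps mult.assoc)
  show "a * b = b * a" by transfer (simp add: mult.commute)
  show "1 * a = a" by transfer (simp add: mod_simps)
  show "(a + b) * c = a * c + b * c" by transfer (simp add: mod_simps distrib_right)
  show "(0::'a padic_int) \<noteq> 1"
  proof (transfer, rule notI)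
    assume "(\<lambda>_. 0) = (\<lambda>n. 1 mod int CARD('a) ^ n)"
    from fun_cong[OF this, of 1] show False using card_gt_1_int[where 'p='a] by simp
  qed
qed

end

lemma padic_residue_range:
  "padic_residue (z :: 'p::prime_card padic_int) n \<in> {0..<int CARD('p) ^ n}"
  using padic_residue[of z] by auto

lemma padic_residue_Suc_mod:
  "padic_residue (z :: 'p::prime_card padic_int) (Suc n) mod int CARD('p) ^ n = padic_residue z n"
  using padic_residue[of z] by auto

lemma padic_residue_add_mod:
  "padic_residue (z :: 'p::prime_card padic_int) (n + k) mod int CARD('p) ^ n = padic_residue z n"
proof (induction k)
  case 0
  then show ?case using padic_residue_range[of z n] by simp
next
  case (Suc k)
  have "padic_residue z (n + Suc k) mod int CARD('p) ^ n
      = padic_residue z (Suc (n + k)) mod int CARD('p) ^ (n + k) mod int CARD('p) ^ n"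
    by (simp add: mod_mod_cancel le_imp_power_dvd)
  also have "\<dots> = padic_residue z n"
    by (simp only: padic_residue_Suc_mod Suc.IH)
  finally show ?case .
qed

lemma padic_residue_mod:
  assumes "n \<le> m"
  shows "padic_residue (z :: 'p::prime_card padic_int) m mod int CARD('p) ^ n = padic_residue z n"
  using padic_residue_add_mod[of z n "m - n"] assms by simp

lemma padic_residue_inj: "(\<And>n. padic_residue x n = padic_residue y n) \<Longrightarrow> x = y"
  using padic_residue_inject[of x y] by (auto simp: fun_eq_iff)

lemma padic_residue_neqE:
  assumes "x \<noteq> y"
  obtains n where "padic_residue x n \<noteq> padic_residue y n"
  using assms padic_residue_inj[of x y] by metis

instance padic_int :: (prime_card) idom
proof
  fix a b :: "'a padic_int"
  let ?p = "int CARD('a)"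
  have nz: "\<exists>n. padic_residue z n \<noteq> 0" if "z \<noteq> 0" for z :: "'a padic_int"
    using that by transfer auto
  assume "a \<noteq> 0" "b \<noteq> 0"
  then obtain m n where mn: "padic_residue a m \<noteq> 0" "padic_residue b n \<noteq> 0"
    using nz by blast
  define x y where "x = padic_residue a (m + n)" and "y = padic_residue b (m + n)"
  have "\<not> ?p ^ m dvd x" "\<not> ?p ^ n dvd y"
    using mn padic_residue_mod[of m "m + n" a] padic_residue_mod[of n "m + n" b]
    by (auto simp: x_def y_def dvd_eq_mod_eq_0)
  moreover from this have "x \<noteq> 0" "y \<noteq> 0"
    by auto
  moreover have P: "prime_elem ?p"
    using prime_card_int[where 'a='a] by auto
  moreover from P have "\<not> is_unit ?p"
    by (rule prime_elem_not_unit)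
  ultimately have "multiplicity ?p x < m" "multiplicity ?p y < n"
    by (metis not_le multiplicity_dvd')+
  with P \<open>x \<noteq> 0\<close> \<open>y \<noteq> 0\<close> have "multiplicity ?p (x * y) < m + n"
    by (simp add: prime_elem_multiplicity_mult_distrib add_strict_mono)
  with \<open>x \<noteq> 0\<close> \<open>y \<noteq> 0\<close> P have "\<not> ?p ^ (m + n) dvd x * y"
    by (subst power_dvd_iff_le_multiplicity) auto
  hence "padic_residue (a * b) (m + n) \<noteq> 0"
    by (simp add: times_padic_int.rep_eq x_def y_def dvd_eq_mod_eq_0)
  thus "a * b \<noteq> 0"
    by (auto simp: zero_padic_int.rep_eq)
qed

type_synonym 'p padic = "'p padic_int fract"

abbreviation padic_of_int :: "'p::prime_card padic_int \<Rightarrow> 'p padic" where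
  "padic_of_int z \<equiv> Fraction_Field.Fract z 1"

text \<open>
  The metric is \<open>dist x y = p powi (- v (x - y))\<close>: the least \<open>n\<close> for which \<open>x\<close> and \<open>y\<close> differ
  modulo \<open>p ^ Suc n\<close> is the valuation of \<open>x - y\<close>.
\<close>

instantiation padic_int :: (prime_card) metric_space
begin

definition dist_padic_int :: "'a padic_int \<Rightarrow> 'a padic_int \<Rightarrow> real" where
  "dist_padic_int x y = (if x = y then 0 else
     1 / real CARD('a) ^ (LEAST n. padic_residue x (Suc n) \<noteq> padic_residue y (Suc n)))"

definition uniformity_padic_int :: "('a padic_int \<times> 'a padic_int) filter" where
  "uniformity_padic_int = (INF e\<in>{0 <..}. principal {(x, y). dist x y < e})"

definition open_padic_int :: "'a padic_int set \<Rightarrow> bool" where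
  "open_padic_int U \<longleftrightarrow>
     (\<forall>x\<in>U. eventually (\<lambda>(x', y). x' = x \<longrightarrow> y \<in> U) uniformity)"

instance
proof
  fix x y z :: "'a padic_int"
  let ?p = "real CARD('a)"
  have p: "?p > 1"
    using prime_card[where 'a='a] prime_gt_1_nat by auto
  define v where "v = (\<lambda>(x :: 'a padic_int) (y :: 'a padic_int).
    LEAST n. padic_residue x (Suc n) \<noteq> padic_residue y (Suc n))"
  have dist_eq: "dist x y = (if x = y then 0 else 1 / ?p ^ v x y)" for x y :: "'a padic_int"
    by (simp add: dist_padic_int_def v_def)
  have ex: "\<exists>n. padic_residue x (Suc n) \<noteq> padic_residue y (Suc n)"
    if xy: "x \<noteq> y" for x y :: "'a padic_int"
  proof -
    obtain n where "padic_residue x n \<noteq> padic_residue y n"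
      using padic_residue_neqE[OF xy] .
    hence "padic_residue x (Suc n) \<noteq> padic_residue y (Suc n)"
      by (metis padic_residue_Suc_mod)
    thus ?thesis by blast
  qed
  have v: "padic_residue x (Suc (v x y)) \<noteq> padic_residue y (Suc (v x y))"
    if "x \<noteq> y" for x y :: "'a padic_int"
    unfolding v_def using LeastI_ex[OF ex[OF that]] .
  have v_le: "v x y \<le> n" if "padic_residue x (Suc n) \<noteq> padic_residue y (Suc n)"
    for x y :: "'a padic_int" and n
    unfolding v_def using that by (rule Least_le)
  show "dist x y = 0 \<longleftrightarrow> x = y"
    using p by (auto simp: dist_eq)
  show "dist x y \<le> dist x z + dist y z"
  proof (cases "x = y \<or> x = z \<or> y = z")
    case True
    moreover have "v x y = v y x" for x y :: "'a padic_int"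
      by (simp add: v_def eq_commute)
    ultimately show ?thesis using p by (auto simp: dist_eq)
  next
    case False
    have "v x z \<le> v x y \<or> v y z \<le> v x y"
      using False v[of x y] v_le by metis
    hence "1 / ?p ^ v x y \<le> 1 / ?p ^ v x z \<or> 1 / ?p ^ v x y \<le> 1 / ?p ^ v y z"
      using p by (auto intro!: divide_left_mono power_increasing)
    moreover have "1 / ?p ^ v x z \<ge> 0" "1 / ?p ^ v y z \<ge> 0"
      by auto
    ultimately have "1 / ?p ^ v x y \<le> 1 / ?p ^ v x z + 1 / ?p ^ v y z"
      by linarith
    with False show ?thesis by (simp add: dist_eq)
  qed
qed (simp_all add: uniformity_padic_int_def open_padic_int_def)

end

lemma dist_padic_int_le_iff:
  fixes x y :: "'p::prime_card padic_int"
  shows "dist x y \<le> 1 / real CARD('p) ^ n \<longleftrightarrow> padic_residue x n = padic_residue y n"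
proof (cases "x = y")
  case False
  define P where "P = (\<lambda>n. padic_residue x (Suc n) \<noteq> padic_residue y (Suc n))"
  define v where "v = (LEAST n. P n)"
  obtain m where "padic_residue x m \<noteq> padic_residue y m"
    using padic_residue_neqE[OF False] .
  hence "P m"
    unfolding P_def by (metis padic_residue_Suc_mod)
  hence v: "P v"
    unfolding v_def by (rule LeastI)
  have p: "real CARD('p) > 1"
    using prime_gt_1_nat[OF prime_card[where 'a='p]] by simp
  have "dist x y = 1 / real CARD('p) ^ v"
    using False by (simp add: dist_padic_int_def v_def P_def)
  moreover have "1 / real CARD('p) ^ v \<le> 1 / real CARD('p) ^ n \<longleftrightarrow>
      real CARD('p) ^ n \<le> real CARD('p) ^ v"
    using p by (simp only: inverse_eq_divide [symmetric])
      (rule inverse_le_iff_le; simp)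
  ultimately have "dist x y \<le> 1 / real CARD('p) ^ n \<longleftrightarrow> n \<le> v"
    using p by simp
  also have "\<dots> \<longleftrightarrow> padic_residue x n = padic_residue y n"
  proof
    assume "n \<le> v"
    show "padic_residue x n = padic_residue y n"
    proof (cases n)
      case 0
      then show ?thesis
        using padic_residue_range[of x 0] padic_residue_range[of y 0] by simp
    next
      case (Suc k)
      with \<open>n \<le> v\<close> have "\<not> P k"
        unfolding v_def by (intro not_less_Least) simp
      with Suc show ?thesis by (simp add: P_def)
    qed
  next
    assume eq: "padic_residue x n = padic_residue y n"
    show "n \<le> v"
    proof (rule ccontr)
      assume "\<not> n \<le> v"
      hence "Suc v \<le> n" by simp
      hence "padic_residue x (Suc v) = padic_residue y (Suc v)"
        using eq by (metis padic_residue_mod)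
      with v show False by (simp add: P_def)
    qed
  qed
  finally show ?thesis .
qed auto

lemma tendsto_padic_int_iff:
  fixes f :: "'b \<Rightarrow> 'p::prime_card padic_int"
  shows "(f \<longlongrightarrow> l) F \<longleftrightarrow> (\<forall>n. eventually (\<lambda>x. padic_residue (f x) n = padic_residue l n) F)"
proof
  have p: "real CARD('p) > 1"
    using prime_gt_1_nat[OF prime_card[where 'a='p]] by simp
  assume lim: "(f \<longlongrightarrow> l) F"
  show "\<forall>n. eventually (\<lambda>x. padic_residue (f x) n = padic_residue l n) F"
  proof
    fix n
    have "eventually (\<lambda>x. dist (f x) l < 1 / real CARD('p) ^ n) F"
      using p by (intro tendstoD[OF lim]) simp
    thus "eventually (\<lambda>x. padic_residue (f x) n = padic_residue l n) F"
      by eventually_elim (simp flip: dist_padic_int_le_iff)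
  qed
next
  have p: "real CARD('p) > 1"
    using prime_gt_1_nat[OF prime_card[where 'a='p]] by simp
  assume *: "\<forall>n. eventually (\<lambda>x. padic_residue (f x) n = padic_residue l n) F"
  show "(f \<longlongrightarrow> l) F"
  proof (rule tendstoI)
    fix e :: real assume "e > 0"
    then obtain n where n: "1 / real CARD('p) ^ n < e"
      using real_arch_pow_inv[of e "1 / real CARD('p)"] p by (auto simp: power_one_over)
    have "eventually (\<lambda>x. padic_residue (f x) n = padic_residue l n) F"
      using * by blast
    thus "eventually (\<lambda>x. dist (f x) l < e) F"
    proof eventually_elim
      case (elim x)
      hence "dist (f x) l \<le> 1 / real CARD('p) ^ n"
        by (simp only: dist_padic_int_le_iff)
      with n show ?case by linarith
    qed
  qed
qed

lemma padic_residue_of_int [simp]: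
  "padic_residue (of_int a :: 'p::prime_card padic_int) n = a mod int CARD('p) ^ n"
proof -
  have nat: "padic_residue (of_nat k :: 'p padic_int) n = int k mod int CARD('p) ^ n" for k
    by (induction k)
       (simp_all add: zero_padic_int.rep_eq one_padic_int.rep_eq plus_padic_int.rep_eq mod_simps)
  show ?thesis
  proof (cases "a \<ge> 0")
    case True
    then show ?thesis using nat[of "nat a"] by simp
  next
    case False
    then obtain k where "a = - int k"
      using zero_le_imp_eq_int[of "- a"] by (metis add.inverse_inverse linear neg_0_le_iff_le)
    then show ?thesis
      by (simp add: uminus_padic_int.rep_eq nat mod_minus_eq)
  qed
qed

lemma padic_residue_of_nat [simp]:
  "padic_residue (of_nat k :: 'p::prime_card padic_int) n = int k mod int CARD('p) ^ n"
  using padic_residue_of_int[of "int k" n, where 'p='p] by simp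

lemma padic_int_exists:
  assumes "\<And>n. [f (Suc n) = f n] (mod (int CARD('p::prime_card) ^ n))"
  obtains z :: "'p::prime_card padic_int" where "\<And>n. padic_residue z n = f n mod int CARD('p) ^ n"
proof
  show "padic_residue (Abs_padic_int (\<lambda>n. f n mod int CARD('p) ^ n) :: 'p padic_int) n
      = f n mod int CARD('p) ^ n" for n
    using padic_int_closed_aux[OF assms] by (subst Abs_padic_int_inverse) blast+
qed

lift_definition padic_reduce :: "'p::prime_card padic_int \<Rightarrow> 'p mod_ring" is "\<lambda>x. x 1"
  by (metis power_one_right)

text \<open>
  Only meaningful on rationals whose denominator is prime to \<open>p\<close>, where it is the inclusion of
  these rationals into the \<open>p\<close>-adic integers.
\<close>

definition padic_int_of_rat :: "rat \<Rightarrow> 'p::prime_card padic_int" where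
  "padic_int_of_rat q =
     (THE z. of_int (snd (quotient_of q)) * z = of_int (fst (quotient_of q)))"

lemma padic_int_of_rat:
  assumes "coprime (snd (quotient_of q)) (int CARD('p::prime_card))"
  shows "of_int (snd (quotient_of q)) * (padic_int_of_rat q :: 'p::prime_card padic_int)
    = of_int (fst (quotient_of q))"
proof -
  define a d where "a = fst (quotient_of q)" and "d = snd (quotient_of q)"
  have d: "coprime d (int CARD('p) ^ n)" for n
    using assms by (simp add: d_def)
  have "\<forall>n. \<exists>u. [d * u = 1] (mod int CARD('p) ^ n)"
    using d cong_solve_coprime_int by blast
  then obtain u where u: "[d * u n = 1] (mod int CARD('p) ^ n)" for n
    by metis
  have "[d * u (Suc n) = d * u n] (mod int CARD('p) ^ n)" for n
    using u[of n] u[of "Suc n"]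
    by (metis cong_dvd_modulus cong_sym cong_trans le_imp_power_dvd le_SucI le_refl)
  hence "[u (Suc n) = u n] (mod int CARD('p) ^ n)" for n
    using d by (simp add: cong_mult_lcancel)
  hence "[a * u (Suc n) = a * u n] (mod int CARD('p) ^ n)" for n
    by (rule cong_scalar_left)
  then obtain z :: "'p padic_int"
    where z: "\<And>n. padic_residue z n = a * u n mod int CARD('p) ^ n"
    using padic_int_exists[of "\<lambda>n. a * u n"] by blast
  have "of_int d * z = of_int a"
  proof (rule padic_residue_inj)
    fix n
    have "[a * (d * u n) = a * 1] (mod int CARD('p) ^ n)"
      using u by (rule cong_scalar_left)
    thus "padic_residue (of_int d * z) n = padic_residue (of_int a :: 'p padic_int) n"
      by (simp add: times_padic_int.rep_eq z mod_mult_eq cong_def mult_ac)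
  qed
  moreover have "(of_int d :: 'p padic_int) \<noteq> 0"
  proof
    assume "(of_int d :: 'p padic_int) = 0"
    hence "padic_residue (of_int d :: 'p padic_int) 1 = 0"
      by (simp only: zero_padic_int.rep_eq)
    hence "int CARD('p) dvd d"
      by (simp add: dvd_eq_mod_eq_0)
    with d[of 1] card_gt_1_int[where 'p='p] show False
      by (auto simp: coprime_absorb_right)
  qed
  ultimately have "\<exists>!z :: 'p padic_int. of_int d * z = of_int a"
    by (metis mult_left_cancel)
  from theI'[OF this] show ?thesis
    by (simp add: padic_int_of_rat_def a_def d_def)
qed


section \<open>The Gamma function of Morita\<close>

text \<open>
  The continuous extension to the \<open>p\<close>-adic integers of
  \<open>n \<mapsto> (-1) ^ n * (\<Prod>j | 0 < j \<and> j < n \<and> \<not> p dvd j. j)\<close>; the limit is over the natural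
  numbers \<open>n\<close> that tend \<open>p\<close>-adically to \<open>x\<close>.
\<close>

definition Gamma_p_nat :: "nat \<Rightarrow> 'p::prime_card padic_int" where
  "Gamma_p_nat n = (-1) ^ n * of_nat (\<Prod>j | 0 < j \<and> j < n \<and> \<not> CARD('p) dvd j. j)"

definition Gamma_p :: "'p::prime_card padic_int \<Rightarrow> 'p padic_int" where
  "Gamma_p x = Lim (filtercomap of_nat (nhds x)) Gamma_p_nat"

lemma prod_totatives_prime_power:
  assumes "prime p" "odd p"
  shows "[(\<Prod>j\<in>totatives (p ^ k). int j) = -1] (mod int (p ^ k))"
proof (cases "k = 0")
  case False
  define m where "m = p ^ k"
  obtain g where g: "residue_primroot m g"
    using residue_primroot_odd_prime_power_exists[OF assms] False unfolding m_def by blast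
  have p3: "p \<ge> 3"
    using prime_ge_2_nat[OF assms(1)] assms(2) by (cases "p = 2") auto
  have "p ^ 1 \<le> m"
    unfolding m_def using False p3 by (intro power_increasing) auto
  with p3 have m: "m > 2"
    by simp
  hence "even (totient m)"
    by (rule totient_even)
  then obtain h where h: "totient m = 2 * h"
    by blast
  have "totient m > 0"
    using m by simp
  with h have h0: "h > 0"
    by simp
  have ord: "ord m g = 2 * h"
    using g h by (simp add: residue_primroot_def)
  have "[g ^ (2 * h) = 1] (mod m)"
    using ord_divides[of g "2 * h" m] ord by simp
  hence "[int g ^ (2 * h) = 1] (mod int m)"
    by (metis cong_int_iff of_nat_1 of_nat_power)
  hence dvd: "int m dvd (int g ^ h - 1) * (int g ^ h + 1)"
    by (simp add: cong_iff_dvd_diff mult_2 power_add ring_distribs)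
  have not: "\<not> int m dvd int g ^ h - 1"
  proof
    assume "int m dvd int g ^ h - 1"
    hence "[g ^ h = 1] (mod m)"
      by (metis cong_iff_dvd_diff cong_int_iff of_nat_1 of_nat_power)
    thus False
      using h0 ord_divides[of g h m] ord by (auto dest: dvd_imp_le)
  qed
  have P: "prime (int p)"
    using assms by simp
  have "int m dvd int g ^ h + 1"
  proof (cases "int p dvd int g ^ h - 1")
    case True
    have "\<not> int p dvd int g ^ h + 1"
    proof
      assume "int p dvd int g ^ h + 1"
      with True have "int p dvd (int g ^ h + 1) - (int g ^ h - 1)"
        by (rule dvd_diff[rotated])
      hence "int p dvd 2"
        by simp
      thus False
        using p3 zdvd_imp_le[of "int p" 2] by simp
    qed
    hence "coprime (int m) (int g ^ h + 1)"
      using P unfolding m_def by (simp add: prime_imp_coprime)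
    with dvd not show ?thesis
      by (simp add: coprime_dvd_mult_left_iff)
  next
    case False
    hence "coprime (int m) (int g ^ h - 1)"
      using P unfolding m_def by (simp add: prime_imp_coprime)
    with dvd show ?thesis
      by (simp add: coprime_dvd_mult_right_iff)
  qed
  hence gh: "[int g ^ h = -1] (mod int m)"
    by (simp add: cong_iff_dvd_diff)
  have "(\<Prod>j\<in>totatives m. int j) = (\<Prod>i<2 * h. int (g ^ i mod m))"
    using residue_primroot_is_generator[OF _ g] m h
    by (intro prod.reindex_bij_betw[symmetric]) auto
  also have "[\<dots> = (\<Prod>i<2 * h. int g ^ i)] (mod int m)"
    by (intro cong_prod) (simp add: cong_def of_nat_mod)
  also have "(\<Prod>i<2 * h. int g ^ i) = int g ^ (\<Sum>i<2 * h. i)"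
    by (simp add: power_sum)
  also have "(\<Sum>i<2 * h. i) = h * (2 * h - 1)"
  proof -
    have "2 * (\<Sum>i<n. i) = n * (n - 1)" for n :: nat
      by (induction n) (auto simp: algebra_simps)
    from this[of "2 * h"] show ?thesis by simp
  qed
  also have "int g ^ (h * (2 * h - 1)) = (int g ^ h) ^ (2 * h - 1)"
    by (simp add: power_mult)
  also have "[\<dots> = (-1) ^ (2 * h - 1)] (mod int m)"
    by (intro cong_pow gh)
  also have "(-1) ^ (2 * h - 1) = (-1 :: int)"
    using h0 by (intro neg_one_odd_power) auto
  finally show ?thesis
    by (simp add: m_def)
qed auto

lemma Gamma_p_nat_cong:
  assumes "prime p" "odd p" "[n = n'] (mod p ^ k)"
  defines "G \<equiv> (\<lambda>n. (-1) ^ n * int (\<Prod>j | 0 < j \<and> j < n \<and> \<not> p dvd j. j))"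
  shows "[G n = G n'] (mod int p ^ k)"
proof -
  define m where "m = p ^ k"
  define h where "h = (\<lambda>j. if p dvd j then 1 else int j)"
  have m: "m > 0" "odd m"
    using assms by (auto simp: m_def prime_gt_0_nat)
  have G: "G n = (-1) ^ n * (\<Prod>j<n. h j)" for n
  proof -
    have "(\<Prod>j<n. h j) = (\<Prod>j | 0 < j \<and> j < n \<and> \<not> p dvd j. int j)"
      by (intro prod.mono_neutral_cong_right) (auto simp: h_def intro!: Nat.gr0I)
    thus ?thesis by (simp add: G_def)
  qed
  have window: "[(\<Prod>j=n..<n+m. h j) = -1] (mod int m)" for n
  proof (induction n)
    case 0
    have "(\<Prod>j=0..<m. h j) = (\<Prod>j\<in>totatives m. int j)" if "k > 0"
    proof (intro prod.mono_neutral_cong_right ballI)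
      have "coprime j m \<longleftrightarrow> \<not> p dvd j" for j
      proof -
        have "coprime p j \<longleftrightarrow> \<not> p dvd j"
          using prime_imp_coprime[OF assms(1)] coprime_absorb_left[of p j] not_prime_unit assms(1)
          by blast
        thus ?thesis
          using \<open>k > 0\<close> unfolding m_def coprime_commute[of j "p ^ k"] by simp
      qed
      hence iff: "j \<in> totatives m \<longleftrightarrow> 0 < j \<and> j \<le> m \<and> \<not> p dvd j" for j
        by (simp add: totatives_def)
      have "\<not> m \<in> totatives m"
        using that unfolding iff by (simp add: m_def)
      thus "totatives m \<subseteq> {0..<m}"
        by (auto simp: iff order_le_less)
      show "h j = 1" if "j \<in> {0..<m} - totatives m" for j
        using that by (cases "j = 0") (auto simp: iff h_def)
      show "h j = int j" if "j \<in> totatives m" for j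
        using that by (simp add: iff h_def)
    qed auto
    then show ?case
      using prod_totatives_prime_power[OF assms(1,2), of k] by (cases "k = 0") (auto simp: m_def)
  next
    case (Suc n)
    define W where "W = (\<Prod>j=Suc n..<n+m. h j)"
    have W: "(\<Prod>j=n..<n+m. h j) = h n * W" "(\<Prod>j=Suc n..<Suc n+m. h j) = W * h (n + m)"
      using m by (auto simp: W_def prod.atLeast_Suc_lessThan)
    have "[h (n + m) = h n] (mod int m)"
    proof (cases "k = 0")
      case False
      hence "p dvd m" by (simp add: m_def)
      thus ?thesis by (auto simp: h_def cong_def dvd_add_left_iff)
    qed (simp add: m_def)
    hence "[W * h (n + m) = W * h n] (mod int m)"
      by (rule cong_scalar_left)
    also have "W * h n = (\<Prod>j=n..<n+m. h j)"
      by (simp add: W)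
    also have "[\<dots> = -1] (mod int m)"
      by (rule Suc.IH)
    finally show ?case
      by (simp only: W)
  qed
  have step: "[G (n + m) = G n] (mod int m)" for n
  proof -
    have "(\<Prod>j<n+m. h j) = (\<Prod>j<n. h j) * (\<Prod>j=n..<n+m. h j)"
      using prod.atLeastLessThan_concat[of 0 n "n + m" h] by (simp add: atLeast0LessThan)
    hence "G (n + m) = - ((-1) ^ n * (\<Prod>j<n. h j) * (\<Prod>j=n..<n+m. h j))"
      using m by (simp add: G power_add)
    also have "[\<dots> = - ((-1) ^ n * (\<Prod>j<n. h j) * (-1))] (mod int m)"
      unfolding cong_minus_minus_iff by (intro cong_scalar_left window)
    finally show ?thesis by (simp add: G)
  qed
  have steps: "[G (n + i * m) = G n] (mod int m)" for n i
  proof (induction i)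
    case (Suc i)
    have "[G (n + i * m + m) = G n] (mod int m)"
      using step Suc.IH by (rule cong_trans)
    thus ?case by (simp add: algebra_simps)
  qed simp
  have "[G n = G (n mod m)] (mod int m)" for n
    using steps[of "n mod m" "n div m"] by simp
  from this[of n] this[of n'] show ?thesis
    using assms(3) by (auto simp: m_def cong_def)
qed

lemma tendsto_Gamma_p:
  assumes "CARD('p::prime_card) \<noteq> 2"
  shows "(Gamma_p_nat \<longlongrightarrow> Gamma_p (x :: 'p::prime_card padic_int)) (filtercomap of_nat (nhds x))"
proof -
  let ?p = "CARD('p)" and ?F = "filtercomap of_nat (nhds x)"
  define G where "G = (\<lambda>n. (-1) ^ n * int (\<Prod>j | 0 < j \<and> j < n \<and> \<not> ?p dvd j. j))"
  have p: "prime ?p" "odd ?p"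
    using prime_card[where 'a='p] assms primes_dvd_imp_eq[of 2 ?p] by auto
  have cong: "[G n = G n'] (mod int ?p ^ k)" if "[n = n'] (mod ?p ^ k)" for n n' k
    unfolding G_def by (rule Gamma_p_nat_cong[OF p that])
  have Gamma_p_nat: "Gamma_p_nat n = (of_int (G n) :: 'p padic_int)" for n
    by (simp add: Gamma_p_nat_def G_def)
  define s where "s = (\<lambda>k. nat (padic_residue x k))"
  have s: "int (s k) = padic_residue x k" for k
    using padic_residue_range[of x k] by (simp add: s_def)
  have "[s (Suc k) = s k] (mod ?p ^ k)" for k
    unfolding cong_int_iff[symmetric] s
    using padic_residue_Suc_mod[of x k] padic_residue_range[of x k] by (simp add: cong_def)
  hence "[G (s (Suc k)) = G (s k)] (mod int ?p ^ k)" for k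
    by (rule cong)
  then obtain z :: "'p padic_int" where z: "\<And>k. padic_residue z k = G (s k) mod int ?p ^ k"
    using padic_int_exists[of "\<lambda>k. G (s k)"] by blast
  have lim: "(Gamma_p_nat \<longlongrightarrow> z) ?F"
    unfolding tendsto_padic_int_iff
  proof
    fix k
    have "eventually (\<lambda>y. padic_residue y k = padic_residue x k) (nhds x)"
      using tendsto_padic_int_iff[of "\<lambda>y. y" x "nhds x"] by (simp add: filterlim_ident)
    hence "eventually (\<lambda>n. padic_residue (of_nat n :: 'p padic_int) k = padic_residue x k) ?F"
      by (rule eventually_filtercomapI)
    thus "eventually (\<lambda>n. padic_residue (Gamma_p_nat n :: 'p padic_int) k = padic_residue z k) ?F"
    proof eventually_elim
      case (elim n)
      hence "[int n = int (s k)] (mod int (?p ^ k))"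
        using padic_residue_range[of x k] by (simp add: cong_def s)
      hence "[G n = G (s k)] (mod int ?p ^ k)"
        unfolding cong_int_iff by (rule cong)
      thus ?case
        unfolding Gamma_p_nat z padic_residue_of_int by (simp add: cong_def)
    qed
  qed
  have s_lim: "(\<lambda>k. of_nat (s k)) \<longlonglongrightarrow> x"
    unfolding tendsto_padic_int_iff
  proof
    fix n
    show "eventually (\<lambda>k. padic_residue (of_nat (s k) :: 'p padic_int) n = padic_residue x n) sequentially"
      using eventually_ge_at_top[of n]
      by eventually_elim (simp add: s padic_residue_mod)
  qed
  have "?F \<noteq> bot"
  proof (rule filtercomap_neq_bot)
    fix P :: "'p padic_int \<Rightarrow> bool" assume "eventually P (nhds x)"
    hence "eventually (\<lambda>k. P (of_nat (s k))) sequentially"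
      using s_lim by (auto simp: filterlim_iff)
    thus "\<exists>n. P (of_nat n)"
      using eventually_happens' trivial_limit_sequentially by blast
  qed
  from tendsto_Lim[OF this lim] lim show ?thesis
    by (simp add: Gamma_p_def)
qed


section \<open>Characters\<close>

definition quadratic_char :: "'p::prime_card mod_ring \<Rightarrow> int" where
  "quadratic_char a = Legendre (to_int_mod_ring a) (int CARD('p))"

definition is_teichmuller :: "('p::prime_card mod_ring \<Rightarrow> 'p padic_int) \<Rightarrow> bool" where
  "is_teichmuller \<chi> \<longleftrightarrow>
     \<chi> 0 = 0 \<and> \<chi> 1 = 1 \<and> (\<forall>a b. \<chi> (a * b) = \<chi> a * \<chi> b) \<and> (\<forall>a. padic_reduce (\<chi> a) = a)"

definition teichmuller :: "'p::prime_card mod_ring \<Rightarrow> 'p padic_int" where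
  "teichmuller = (THE \<chi>. is_teichmuller \<chi>)"

lemma cong_pow_prime:
  assumes "[x = y] (mod int p ^ Suc k)"
  shows "[x ^ p = y ^ p] (mod int p ^ Suc (Suc k))"
proof -
  have "[x = y] (mod int p)"
    using assms by (rule cong_dvd_modulus) simp
  hence "[(\<Sum>i<p. y ^ (p - Suc i) * x ^ i) = (\<Sum>i<p. y ^ (p - Suc i) * y ^ i)] (mod int p)"
    by (intro cong_sum cong_mult cong_pow) auto
  also have "(\<Sum>i<p. y ^ (p - Suc i) * y ^ i) = (\<Sum>i<p. y ^ (p - 1))"
    by (intro sum.cong) (auto simp flip: power_add)
  also have "[\<dots> = 0] (mod int p)"
    by (simp add: cong_def)
  finally have "int p dvd (\<Sum>i<p. y ^ (p - Suc i) * x ^ i)"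
    by (simp add: cong_0_iff)
  moreover have "int p ^ Suc k dvd x - y"
    using assms by (simp only: cong_iff_dvd_diff)
  ultimately have "int p ^ Suc k * int p dvd (x - y) * (\<Sum>i<p. y ^ (p - Suc i) * x ^ i)"
    by (intro mult_dvd_mono)
  thus ?thesis
    by (simp only: power_diff_sumr2 cong_iff_dvd_diff power_Suc2)
qed

lemma cong_pow_prime_power:
  assumes "[x = y] (mod int p)"
  shows "[x ^ (p ^ n) = y ^ (p ^ n)] (mod int p ^ Suc n)"
proof (induction n)
  case (Suc n)
  from cong_pow_prime[OF Suc.IH] show ?case
    by (simp add: mult.commute[of p] power_mult)
qed (use assms in simp)

lemma to_int_mod_ring_of_int:
  "to_int_mod_ring (of_int a :: 'p::prime_card mod_ring) = a mod int CARD('p)"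
  by (simp add: of_int_of_int_mod_ring of_int_mod_ring.rep_eq to_int_mod_ring.rep_eq)

lemma to_int_mod_ring_mult:
  "to_int_mod_ring (a * b :: 'p::prime_card mod_ring)
    = to_int_mod_ring a * to_int_mod_ring b mod int CARD('p)"
  by (simp add: times_mod_ring.rep_eq to_int_mod_ring.rep_eq)

lemma fermat_int:
  fixes a :: int
  assumes "prime p" "a \<ge> 0"
  shows "[a ^ p = a] (mod int p)"
proof -
  define n where "n = nat a"
  have "[n ^ p = n] (mod p)"
  proof (cases "p dvd n")
    case True
    hence "p dvd n ^ p"
      using assms(1) by (metis dvd_mult2 gr0_conv_Suc power_Suc prime_gt_0_nat)
    with True show ?thesis by (simp add: cong_def)
  next
    case False
    have "[n * n ^ (p - 1) = n * 1] (mod p)"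
      using fermat_theorem[OF assms(1) False] by (rule cong_scalar_left)
    thus ?thesis
      using assms(1) by (simp add: prime_gt_0_nat flip: power_Suc)
  qed
  hence "[int (n ^ p) = int n] (mod int p)"
    by (simp only: cong_int_iff)
  thus ?thesis
    using assms(2) by (simp add: n_def)
qed

lemma mod_ring_power_card: "(a :: 'p::prime_card mod_ring) ^ CARD('p) = a"
proof -
  define A where "A = to_int_mod_ring a"
  have A: "A \<ge> 0" "a = of_int A"
    using range_to_int_mod_ring[where 'a='p] by (auto simp: A_def of_int_of_int_mod_ring)
  have "to_int_mod_ring (of_int (A ^ CARD('p)) :: 'p mod_ring) = to_int_mod_ring (of_int A :: 'p mod_ring)"
    using fermat_int[OF prime_card[where 'a='p] A(1)]
    unfolding to_int_mod_ring_of_int by (simp add: cong_def)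
  hence "(of_int (A ^ CARD('p)) :: 'p mod_ring) = of_int A"
    by (metis of_int_mod_ring_to_int_mod_ring)
  thus ?thesis by (simp add: A(2))
qed

lemma to_int_mod_ring_padic_reduce:
  "to_int_mod_ring (padic_reduce z :: 'p::prime_card mod_ring) = padic_residue z 1"
  by (simp add: padic_reduce.rep_eq to_int_mod_ring.rep_eq)

lemma padic_residue_power:
  "padic_residue (z ^ k :: 'p::prime_card padic_int) n = padic_residue z n ^ k mod int CARD('p) ^ n"
  by (induction k) (simp_all add: one_padic_int.rep_eq times_padic_int.rep_eq mod_simps)

lemma padic_residue_is_teichmuller:
  fixes \<chi> :: "'p::prime_card mod_ring \<Rightarrow> 'p padic_int"
  assumes "is_teichmuller \<chi>"
  shows "padic_residue (\<chi> a) n = to_int_mod_ring a ^ (CARD('p) ^ n) mod int CARD('p) ^ n"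
proof -
  let ?p = "CARD('p)"
  have pow: "\<chi> (b ^ k) = \<chi> b ^ k" for b k
    using assms by (induction k) (auto simp: is_teichmuller_def)
  have "a ^ (?p ^ n) = a"
    by (induction n) (simp_all add: power_mult mod_ring_power_card)
  hence "\<chi> a = \<chi> a ^ (?p ^ n)"
    by (metis pow)
  hence eq: "padic_residue (\<chi> a) n = padic_residue (\<chi> a) n ^ (?p ^ n) mod int ?p ^ n"
    by (metis padic_residue_power)
  show ?thesis
  proof (cases n)
    case (Suc m)
    have "padic_residue (\<chi> a) n mod int ?p = padic_residue (\<chi> a) 1"
      using padic_residue_mod[of 1 n "\<chi> a"] Suc by simp
    also have "\<dots> = to_int_mod_ring a"
      using assms by (metis is_teichmuller_def to_int_mod_ring_padic_reduce)
    finally have "[padic_residue (\<chi> a) n = to_int_mod_ring a] (mod int ?p)"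
      by (metis cong_def mod_mod_trivial)
    hence "[padic_residue (\<chi> a) n ^ (?p ^ n) = to_int_mod_ring a ^ (?p ^ n)] (mod int ?p ^ Suc n)"
      by (rule cong_pow_prime_power)
    hence "[padic_residue (\<chi> a) n ^ (?p ^ n) = to_int_mod_ring a ^ (?p ^ n)] (mod int ?p ^ n)"
      by (rule cong_dvd_modulus) (simp add: le_imp_power_dvd)
    with eq show ?thesis by (simp add: cong_def)
  qed (use eq in simp)
qed

lemma is_teichmuller_teichmuller: "is_teichmuller (teichmuller :: 'p::prime_card mod_ring \<Rightarrow> _)"
proof -
  let ?p = "CARD('p)"
  have range: "to_int_mod_ring a \<in> {0..<int ?p}" for a :: "'p mod_ring"
    using range_to_int_mod_ring[where 'a='p] by auto
  have "\<exists>z :: 'p padic_int. \<forall>n. padic_residue z n = to_int_mod_ring a ^ (?p ^ n) mod int ?p ^ n"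
    for a :: "'p mod_ring"
  proof -
    have "[to_int_mod_ring a ^ ?p = to_int_mod_ring a] (mod int ?p)"
      using fermat_int[OF prime_card[where 'a='p]] range by simp
    hence "[(to_int_mod_ring a ^ ?p) ^ (?p ^ n) = to_int_mod_ring a ^ (?p ^ n)] (mod int ?p ^ Suc n)" for n
      by (rule cong_pow_prime_power)
    hence "[to_int_mod_ring a ^ (?p ^ Suc n) = to_int_mod_ring a ^ (?p ^ n)] (mod int ?p ^ Suc n)" for n
      by (simp add: power_mult)
    hence "[to_int_mod_ring a ^ (?p ^ Suc n) = to_int_mod_ring a ^ (?p ^ n)] (mod int ?p ^ n)" for n
      by (rule cong_dvd_modulus) (simp add: le_imp_power_dvd)
    thus ?thesis
      using padic_int_exists[of "\<lambda>n. to_int_mod_ring a ^ (?p ^ n)"] by blast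
  qed
  then obtain \<chi> :: "'p mod_ring \<Rightarrow> 'p padic_int"
    where \<chi>: "\<And>a n. padic_residue (\<chi> a) n = to_int_mod_ring a ^ (?p ^ n) mod int ?p ^ n"
    by metis
  have "is_teichmuller \<chi>"
    unfolding is_teichmuller_def
  proof (intro conjI allI)
    show "\<chi> 0 = 0"
      by (rule padic_residue_inj) (simp add: \<chi> zero_padic_int.rep_eq prime_gt_0_nat prime_card zero_power)
    show "\<chi> 1 = 1"
      by (rule padic_residue_inj) (simp add: \<chi> one_padic_int.rep_eq)
  next
    fix a b :: "'p mod_ring"
    show "\<chi> (a * b) = \<chi> a * \<chi> b"
    proof (rule padic_residue_inj)
      fix n
      have "[to_int_mod_ring (a * b) = to_int_mod_ring a * to_int_mod_ring b] (mod int ?p)"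
        by (simp add: to_int_mod_ring_mult cong_def)
      hence "[to_int_mod_ring (a * b) ^ (?p ^ n) = (to_int_mod_ring a * to_int_mod_ring b) ^ (?p ^ n)]
          (mod int ?p ^ Suc n)"
        by (rule cong_pow_prime_power)
      hence "[to_int_mod_ring (a * b) ^ (?p ^ n) = (to_int_mod_ring a * to_int_mod_ring b) ^ (?p ^ n)]
          (mod int ?p ^ n)"
        by (rule cong_dvd_modulus) (simp add: le_imp_power_dvd)
      thus "padic_residue (\<chi> (a * b)) n = padic_residue (\<chi> a * \<chi> b) n"
        by (simp add: \<chi> times_padic_int.rep_eq cong_def power_mult_distrib mod_mult_eq)
    qed
  next
    fix a :: "'p mod_ring"
    have "to_int_mod_ring (padic_reduce (\<chi> a)) = to_int_mod_ring a"
      using fermat_int[OF prime_card[where 'a='p], of "to_int_mod_ring a"] range[of a]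
      by (simp add: to_int_mod_ring_padic_reduce \<chi> cong_def)
    thus "padic_reduce (\<chi> a) = a"
      by (metis of_int_mod_ring_to_int_mod_ring)
  qed
  moreover have "\<psi> = \<chi>" if "is_teichmuller \<psi>" for \<psi>
    using that by (intro ext padic_residue_inj) (simp add: \<chi> padic_residue_is_teichmuller)
  ultimately show ?thesis
    unfolding teichmuller_def by (rule theI)
qed

text \<open>
  The power \<open>j\<close> of the inverse of the Teichmuller character; as every multiplicative character,
  including the trivial one (\<open>j = 0\<close>), it vanishes at \<open>0\<close>.
\<close>

definition teichmuller_bar_pow :: "nat \<Rightarrow> 'p::prime_card mod_ring \<Rightarrow> 'p padic" where
  "teichmuller_bar_pow j t = (if t = 0 then 0 else inverse (padic_of_int (teichmuller t)) ^ j)"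


section \<open>McCarthy's function\<close>

abbreviation Gamma_p_rat :: "rat \<Rightarrow> 'p::prime_card padic" where
  "Gamma_p_rat q \<equiv> padic_of_int (Gamma_p (padic_int_of_rat q))"

text \<open>
  The parameters are the lists \<open>as\<close> and \<open>bs\<close> of equal length \<open>m\<close>, consisting of rationals whose
  denominators are prime to \<open>p\<close>.
\<close>

definition mccarthy_G :: "rat list \<Rightarrow> rat list \<Rightarrow> 'p::prime_card mod_ring \<Rightarrow> 'p padic" where
  "mccarthy_G as bs t =
     (let p = CARD('p); m = length as in
      - 1 / of_nat (p - 1) *
      (\<Sum>j = 0..p - 2. (- 1) ^ (j * m) * teichmuller_bar_pow j t *
        (\<Prod>k<m. let a = as ! k; b = bs ! k; x = of_nat j / of_nat (p - 1) in
          (- of_nat p) powi (- \<lfloor>frac a - x\<rfloor> - \<lfloor>frac (- b) + x\<rfloor>) *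
          (Gamma_p_rat (frac (a - x)) / Gamma_p_rat (frac a)) *
          (Gamma_p_rat (frac (- b + x)) / Gamma_p_rat (frac (- b))))))"

definition G2_tilde :: "'p::prime_card mod_ring \<Rightarrow> 'p padic" where
  "G2_tilde t = mccarthy_G [1/6, 5/6] [0, 1/2] t"

definition S_roots :: "'p::prime_card mod_ring \<Rightarrow> 'p mod_ring set" where
  "S_roots t = {y. 27 * y ^ 3 - 27 * y ^ 2 + 4 / t = 0}"

end

theory Submission
  imports Defs "HOL-Computational_Algebra.Formal_Power_Series"
begin

text \<open>
  By the multiplication and reflection formulas of \<open>Gamma_p\<close>, the substitution
  \<open>i = j + (p - 1) / 2\<close> turns the summand of index \<open>j\<close> into \<open>\<phi> (3 t) \<omega> (u) ^ i g(i) g(2 i) g(- 3 i)\<close>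
  with \<open>u = - 4 / (27 t)\<close> and \<open>g(i) = Gamma_p (i / (p - 1))\<close>, up to a power of \<open>- p\<close>.  By the formula
  of Gross and Koblitz these products are Jacobi sums, whose Fourier transform counts the roots
  of \<open>y ^ 3 + y ^ 2 + u\<close>.  Only a version of that formula for products of three Gauss sums
  is needed.  It is obtained from Dwork's series \<open>C = exp (x + x ^ p / p)\<close>: the coefficients of \<open>C\<close>
  are the Mahler coefficients of \<open>Gamma_p\<close>, a trace argument identifies the components of the
  value of \<open>C\<close> at \<open>\<pi>\<close>, \<open>\<pi> ^ (p - 1) = - p\<close>, with the numbers \<open>g(i) / (1 - p)\<close>, and for
  Teichmuller representatives \<open>a\<close>, \<open>b\<close> the product \<open>C(a x) C(b x) C(x)\<close> depends at \<open>\<pi>\<close> only on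
  \<open>a + b + 1\<close> modulo \<open>p\<close>.
\<close>

section \<open>Divisibility by powers of \<open>p\<close>\<close>

text \<open>As \<open>\<pi> ^ p / p = - \<pi>\<close>, the series \<open>C (\<pi> x)\<close> is
  formally \<open>exp (\<pi> (x - x ^ p))\<close>. Its values at Teichmuller representatives play
  the part of an additive character of the prime field, and its components along the powers of
  \<open>\<pi>\<close> are that character's Gauss sums up to the factor \<open>p - 1\<close>. The
  obstacle is that neither \<open>\<pi>\<close> nor a nontrivial p-th root of unity is a p-adic
  number. A product of three Gauss sums with exponents \<open>i\<close>, \<open>j\<close>,
  \<open>- i - j\<close> carries a power of \<open>\<pi>\<close> whose exponent is divisible by
  \<open>p - 1\<close>, hence a power of \<open>- p\<close>, so for such products everything can be
  stated over the p-adic numbers. A second obstacle is that \<open>C\<close> has unbounded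
  coefficients: the series may be rearranged at \<open>\<pi>\<close> only because the differences of
  \<open>Gamma_p\<close> are divisible by enough powers of \<open>p\<close>, and this has to be
  quantified before anything can be evaluated.\<close>

lemma prime_CARD [simp]: "prime CARD('p::prime_card)"
  by (rule prime_card)

lemma CARD_neq_Suc_0 [simp]: "CARD('p::prime_card) \<noteq> Suc 0"
  using prime_gt_1_nat[OF prime_card[where 'a='p]] by simp

lemma padic_residue_diff:
  "padic_residue (x - y :: 'p::prime_card padic_int) n =
    (padic_residue x n - padic_residue y n) mod int CARD('p) ^ n"
  by (simp add: minus_padic_int.rep_eq)

text \<open>If the residue modulo \<open>p ^ n\<close> vanishes, the residues modulo
  \<open>p ^ (n + k)\<close> divided by \<open>p ^ n\<close> form a compatible family in
  \<open>k\<close>, which is the quotient.\<close>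

lemma power_dvd_padic_int_iff:
  fixes z :: "'p::prime_card padic_int"
  shows "of_nat CARD('p) ^ n dvd z \<longleftrightarrow> padic_residue z n = 0"
proof
  assume "of_nat CARD('p) ^ n dvd z"
  then obtain w where w: "z = of_nat CARD('p) ^ n * w" by (elim dvdE)
  have "padic_residue (of_nat CARD('p) ^ n :: 'p padic_int) n = 0"
    by (simp flip: of_nat_power)
  thus "padic_residue z n = 0" by (simp add: w times_padic_int.rep_eq)
next
  let ?p = "int CARD('p)"
  assume z: "padic_residue z n = 0"
  have dvd: "?p ^ n dvd padic_residue z (n + k)" for k
    using padic_residue_mod[of n "n + k" z] z by (simp add: dvd_eq_mod_eq_0)
  define f where "f = (\<lambda>k. padic_residue z (n + k) div ?p ^ n)"
  have f: "padic_residue z (n + k) = ?p ^ n * f k" for k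
    using dvd[of k] by (simp add: f_def)
  have "[f (Suc k) = f k] (mod ?p ^ k)" for k
  proof -
    have "[padic_residue z (Suc (n + k)) = padic_residue z (n + k)] (mod ?p ^ (n + k))"
      using padic_residue_Suc_mod[of z "n + k"] by (metis cong_def mod_mod_trivial)
    hence "[?p ^ n * f (Suc k) = ?p ^ n * f k] (mod ?p ^ n * ?p ^ k)"
      using f[of "Suc k"] f[of k] by (simp add: power_add)
    thus ?thesis
      by (simp add: cong_iff_dvd_diff flip: right_diff_distrib)
  qed
  then obtain w :: "'p padic_int" where w: "\<And>k. padic_residue w k = f k mod ?p ^ k"
    using padic_int_exists[of f] by blast
  have "z = of_nat CARD('p) ^ n * w"
  proof (rule padic_residue_inj)
    fix k
    have "padic_residue (of_nat CARD('p) ^ n * w) k = ?p ^ n * f k mod ?p ^ k"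
      by (simp add: times_padic_int.rep_eq w mod_mult_eq mod_simps flip: of_nat_power)
    also have "\<dots> = padic_residue z (n + k) mod ?p ^ k" by (simp add: f)
    also have "\<dots> = padic_residue z k" by (rule padic_residue_mod) simp
    finally show "padic_residue z k = padic_residue (of_nat CARD('p) ^ n * w) k" ..
  qed
  thus "of_nat CARD('p) ^ n dvd z" by simp
qed

lemma padic_residue_eq_iff:
  fixes x y :: "'p::prime_card padic_int"
  shows "padic_residue x n = padic_residue y n \<longleftrightarrow> of_nat CARD('p) ^ n dvd x - y"
proof -
  let ?p = "int CARD('p)"
  have "padic_residue (x - y) n = 0 \<longleftrightarrow> [padic_residue x n = padic_residue y n] (mod ?p ^ n)"
    by (simp add: padic_residue_diff cong_iff_dvd_diff dvd_eq_mod_eq_0)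
  also have "\<dots> \<longleftrightarrow> padic_residue x n = padic_residue y n"
    using padic_residue_range[of x n] padic_residue_range[of y n] by (simp add: cong_def)
  finally show ?thesis by (simp add: power_dvd_padic_int_iff)
qed

lemma padic_int_eqI:
  fixes x y :: "'p::prime_card padic_int"
  assumes "\<And>n. of_nat CARD('p) ^ n dvd x - y"
  shows "x = y"
  using assms by (intro padic_residue_inj) (simp add: padic_residue_eq_iff)

lemma power_dvd_of_int_iff:
  "of_nat CARD('p) ^ n dvd (of_int a :: 'p::prime_card padic_int) \<longleftrightarrow> int CARD('p) ^ n dvd a"
  by (simp add: power_dvd_padic_int_iff dvd_eq_mod_eq_0)

lemma power_dvd_of_nat_iff:
  "of_nat CARD('p) ^ n dvd (of_nat a :: 'p::prime_card padic_int) \<longleftrightarrow> CARD('p) ^ n dvd a"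
  using power_dvd_of_int_iff[of n "int a", where 'p='p]
  by (simp flip: of_nat_power)

lemma exists_nat_approx:
  fixes x :: "'p::prime_card padic_int"
  obtains k where "of_nat CARD('p) ^ n dvd x - of_nat k"
proof
  have "padic_residue x n = padic_residue (of_nat (nat (padic_residue x n)) :: 'p padic_int) n"
    using padic_residue_range[of x n] by simp
  thus "of_nat CARD('p) ^ n dvd x - of_nat (nat (padic_residue x n))"
    by (simp only: padic_residue_eq_iff)
qed

instance padic_int :: (prime_card) ring_char_0
proof
  show "inj (of_nat :: nat \<Rightarrow> 'a padic_int)"
  proof (rule injI)
    fix m n :: nat
    assume eq: "(of_nat m :: 'a padic_int) = of_nat n"
    have "CARD('a) > 1" using prime_gt_1_nat[OF prime_card[where 'a='a]] .
    \<comment> \<open>Modulo a power of \<open>p\<close> exceeding both \<open>m\<close> and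
      \<open>n\<close>, each of them is its own residue.\<close>
    hence "CARD('a) ^ (m + n) > m + n" using power_gt_expt[of "CARD('a)" "m + n"] by simp
    hence b: "int m < int CARD('a) ^ (m + n)" "int n < int CARD('a) ^ (m + n)"
      by (simp_all flip: of_nat_power)
    have "padic_residue (of_nat m :: 'a padic_int) (m + n) = padic_residue (of_nat n :: 'a padic_int) (m + n)"
      by (simp only: eq)
    thus "m = n" using b by simp
  qed
qed

text \<open>Characteristic zero of the p-adic numbers is what admits factorials in denominators,
  hence \<open>fps_exp\<close> and generalized binomial coefficients.\<close>

instance fract :: ("{idom,ring_char_0}") field_char_0
proof
  show "inj (of_nat :: nat \<Rightarrow> 'a fract)"
    by (rule injI) (simp add: of_nat_fract eq_fract)
qed

section \<open>The p-adic integers inside their field of fractions\<close>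

lemma padic_of_int_simps:
  "padic_of_int (x + y) = padic_of_int x + padic_of_int y"
  "padic_of_int (x - y) = padic_of_int x - padic_of_int y"
  "padic_of_int (- x) = - padic_of_int x"
  "padic_of_int (x * y) = padic_of_int x * padic_of_int y"
  "padic_of_int 0 = 0" "padic_of_int 1 = 1"
  by (simp_all add: Zero_fract_def One_fract_def)

lemma padic_of_int_of_nat: "padic_of_int (of_nat n) = of_nat n"
  by (simp add: of_nat_fract)

lemma padic_of_int_of_int: "padic_of_int (of_int n) = of_int n"
  by (cases n) (simp_all add: padic_of_int_simps padic_of_int_of_nat del: of_nat_Suc)

lemma padic_of_int_power: "padic_of_int (x ^ n) = padic_of_int x ^ n"
  by (induction n) (simp_all add: padic_of_int_simps)

lemma padic_of_int_sum: "padic_of_int (sum f A) = (\<Sum>x\<in>A. padic_of_int (f x))"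
  by (induction A rule: infinite_finite_induct) (simp_all add: padic_of_int_simps)

lemma padic_of_int_prod: "padic_of_int (prod f A) = (\<Prod>x\<in>A. padic_of_int (f x))"
  by (induction A rule: infinite_finite_induct) (simp_all add: padic_of_int_simps)

lemma padic_of_int_eq_iff [simp]: "padic_of_int x = padic_of_int y \<longleftrightarrow> x = y"
  by (simp add: eq_fract)

lemmas padic_of_int_hom = padic_of_int_simps padic_of_int_of_nat padic_of_int_of_int
  padic_of_int_power padic_of_int_sum padic_of_int_prod

text \<open>An element prime to \<open>p\<close> is invertible modulo every \<open>p ^ n\<close>,
  and uniqueness of these inverses makes them a compatible family.\<close>

lemma padic_int_is_unit_iff:
  fixes z :: "'p::prime_card padic_int"
  shows "z dvd 1 \<longleftrightarrow> \<not> of_nat CARD('p) dvd z"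
proof
  assume "z dvd 1"
  show "\<not> of_nat CARD('p) dvd z"
  proof
    assume "of_nat CARD('p) dvd z"
    hence "of_nat CARD('p) ^ 1 dvd (of_nat 1 :: 'p padic_int)"
      using \<open>z dvd 1\<close> by (metis dvd_trans of_nat_1 power_one_right)
    thus False unfolding power_dvd_of_nat_iff by simp
  qed
next
  let ?p = "int CARD('p)"
  assume z: "\<not> of_nat CARD('p) dvd z"
  have "coprime (padic_residue z n) (?p ^ n)" for n
  proof (cases n)
    case (Suc m)
    have "\<not> ?p dvd padic_residue z n"
      using z power_dvd_padic_int_iff[of 1 z] padic_residue_mod[of 1 n z] Suc
      by (auto simp: dvd_eq_mod_eq_0)
    hence "coprime ?p (padic_residue z n)"
      using prime_card_int[where 'a='p] by (simp add: prime_imp_coprime)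
    thus ?thesis by (simp add: coprime_commute)
  qed simp
  hence "\<forall>n. \<exists>u. [padic_residue z n * u = 1] (mod ?p ^ n)"
    using cong_solve_coprime_int by blast
  then obtain u where u: "\<And>n. [padic_residue z n * u n = 1] (mod ?p ^ n)" by metis
  have "[u (Suc n) = u n] (mod ?p ^ n)" for n
  proof -
    have "[padic_residue z (Suc n) = padic_residue z n] (mod ?p ^ n)"
      using padic_residue_Suc_mod[of z n] by (metis cong_def mod_mod_trivial)
    hence 1: "[padic_residue z (Suc n) * u (Suc n) = padic_residue z n * u (Suc n)] (mod ?p ^ n)"
      by (rule cong_scalar_right)
    have "[padic_residue z (Suc n) * u (Suc n) = 1] (mod ?p ^ n)"
      using u[of "Suc n"] by (rule cong_dvd_modulus) simp
    hence "[padic_residue z n * u (Suc n) = padic_residue z n * u n] (mod ?p ^ n)"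
      using 1 u[of n] by (metis cong_sym cong_trans)
    thus ?thesis using \<open>\<And>n. coprime (padic_residue z n) (?p ^ n)\<close>
      by (simp add: cong_mult_lcancel)
  qed
  then obtain w :: "'p padic_int" where w: "\<And>n. padic_residue w n = u n mod ?p ^ n"
    using padic_int_exists[of u] by blast
  have "z * w = 1"
    using u by (intro padic_residue_inj)
      (simp add: times_padic_int.rep_eq one_padic_int.rep_eq w mod_mult_right_eq cong_def)
  thus "z dvd 1" by (metis dvd_triv_left)
qed

lemma prime_elem_p_padic: "prime_elem (of_nat CARD('p) :: 'p::prime_card padic_int)"
proof (rule prime_elemI)
  show "(of_nat CARD('p) :: 'p padic_int) \<noteq> 0" by simp
  show "\<not> (of_nat CARD('p) :: 'p padic_int) dvd 1"
    by (simp add: padic_int_is_unit_iff)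
  fix a b :: "'p padic_int"
  assume ab: "of_nat CARD('p) dvd a * b"
  show "of_nat CARD('p) dvd a \<or> of_nat CARD('p) dvd b"
  proof (rule ccontr)
    assume "\<not> ?thesis"
    hence "a * b dvd 1" by (simp flip: padic_int_is_unit_iff)
    with ab show False by (simp add: padic_int_is_unit_iff)
  qed
qed

text \<open>Membership stands for the valuation bound \<open>v x \<ge> n\<close>, with
  \<open>0\<close> in every ball; \<open>padic_ball 0\<close> is the ring of integers.\<close>

definition padic_ball :: "nat \<Rightarrow> 'p::prime_card padic set" where
  "padic_ball n = {of_nat CARD('p) ^ n * padic_of_int z | z. True}"

lemma padic_ballI: "x = of_nat CARD('p) ^ n * padic_of_int z \<Longrightarrow> (x :: 'p::prime_card padic) \<in> padic_ball n"
  by (auto simp: padic_ball_def)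

lemma padic_ballE:
  assumes "(x :: 'p::prime_card padic) \<in> padic_ball n"
  obtains z where "x = of_nat CARD('p) ^ n * padic_of_int z"
  using assms by (auto simp: padic_ball_def)

lemma padic_of_int_ball0 [simp]: "padic_of_int z \<in> padic_ball 0"
  by (rule padic_ballI[of _ _ z]) simp

lemma padic_ball_0 [simp]: "0 \<in> padic_ball n"
  by (rule padic_ballI[of _ _ 0]) (simp add: padic_of_int_hom)

lemma of_nat_padic_ball0 [simp]: "of_nat k \<in> padic_ball 0"
  using padic_of_int_ball0[of "of_nat k"] by (simp only: padic_of_int_hom)

lemma one_padic_ball0 [simp]: "1 \<in> padic_ball 0"
  using of_nat_padic_ball0[of 1] by simp

lemma padic_ball_add: "x \<in> padic_ball n \<Longrightarrow> y \<in> padic_ball n \<Longrightarrow> x + y \<in> padic_ball n"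
proof -
  assume "x \<in> padic_ball n" "y \<in> padic_ball n"
  then obtain a b where "x = of_nat CARD('a) ^ n * padic_of_int a" "y = of_nat CARD('a) ^ n * padic_of_int b"
    by (elim padic_ballE)
  hence "x + y = of_nat CARD('a) ^ n * padic_of_int (a + b)"
    by (simp only: padic_of_int_simps distrib_left)
  thus ?thesis by (rule padic_ballI)
qed

lemma padic_ball_uminus: "x \<in> padic_ball n \<Longrightarrow> - x \<in> padic_ball n"
proof -
  assume "x \<in> padic_ball n"
  then obtain a where "x = of_nat CARD('a) ^ n * padic_of_int a"
    by (elim padic_ballE)
  hence "- x = of_nat CARD('a) ^ n * padic_of_int (- a)"
    by (simp only: padic_of_int_simps mult_minus_right)
  thus ?thesis by (rule padic_ballI)
qed

lemma padic_ball_uminus_iff [simp]: "- x \<in> padic_ball n \<longleftrightarrow> x \<in> padic_ball n"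
  using padic_ball_uminus[of x n] padic_ball_uminus[of "- x" n] by auto

lemma padic_ball_diff: "x \<in> padic_ball n \<Longrightarrow> y \<in> padic_ball n \<Longrightarrow> x - y \<in> padic_ball n"
  using padic_ball_add[of x n "- y"] by simp

lemma padic_ball_sum: "(\<And>x. x \<in> A \<Longrightarrow> f x \<in> padic_ball n) \<Longrightarrow> sum f A \<in> padic_ball n"
  by (induction A rule: infinite_finite_induct) (auto intro: padic_ball_add)

lemma padic_ball_mult: "x \<in> padic_ball m \<Longrightarrow> y \<in> padic_ball n \<Longrightarrow> x * y \<in> padic_ball (m + n)"
proof -
  assume "x \<in> padic_ball m" "y \<in> padic_ball n"
  then obtain a b where "x = of_nat CARD('a) ^ m * padic_of_int a" "y = of_nat CARD('a) ^ n * padic_of_int b"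
    by (elim padic_ballE)
  hence "x * y = of_nat CARD('a) ^ (m + n) * padic_of_int (a * b)"
    by (simp only: padic_of_int_simps power_add mult_ac)
  thus ?thesis by (rule padic_ballI)
qed

lemma padic_ball_mult_left: "x \<in> padic_ball 0 \<Longrightarrow> y \<in> padic_ball n \<Longrightarrow> x * y \<in> padic_ball n"
  using padic_ball_mult[of x 0 y n] by simp

lemma padic_ball_mult_right: "x \<in> padic_ball n \<Longrightarrow> y \<in> padic_ball 0 \<Longrightarrow> x * y \<in> padic_ball n"
  using padic_ball_mult[of x n y 0] by simp

lemma padic_ball_power: "x \<in> padic_ball 0 \<Longrightarrow> x ^ k \<in> padic_ball 0"
  by (induction k) (auto intro: padic_ball_mult_left)

lemma padic_ball_prod: "(\<And>x. x \<in> A \<Longrightarrow> f x \<in> padic_ball 0) \<Longrightarrow> prod f A \<in> padic_ball 0"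
  by (induction A rule: infinite_finite_induct) (auto intro: padic_ball_mult_left)

lemma padic_ball_mono: 
  assumes "x \<in> padic_ball m" "n \<le> m"
  shows "(x :: 'p::prime_card padic) \<in> padic_ball n"
proof -
  obtain z where z: "x = of_nat CARD('p) ^ m * padic_of_int z"
    using assms(1) by (elim padic_ballE)
  have "x = of_nat CARD('p) ^ n * padic_of_int (of_nat CARD('p) ^ (m - n) * z)"
    using assms(2) by (simp add: z padic_of_int_hom mult_ac flip: power_add)
  thus ?thesis by (rule padic_ballI)
qed

lemma p_power_padic_ball [simp]: "(of_nat CARD('p) ^ n :: 'p::prime_card padic) \<in> padic_ball n"
  by (rule padic_ballI[of _ _ 1]) (simp add: padic_of_int_hom)

lemma padic_of_int_ball_iff:
  "(padic_of_int z :: 'p::prime_card padic) \<in> padic_ball n \<longleftrightarrow> of_nat CARD('p) ^ n dvd z"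
proof
  assume "padic_of_int z \<in> padic_ball n"
  then obtain w where "padic_of_int z = of_nat CARD('p) ^ n * padic_of_int w"
    by (elim padic_ballE)
  also have "\<dots> = padic_of_int (of_nat CARD('p) ^ n * w)" by (simp only: padic_of_int_hom)
  finally show "of_nat CARD('p) ^ n dvd z" unfolding padic_of_int_eq_iff by simp
qed (auto intro: padic_ballI simp: dvd_def padic_of_int_hom)

lemma padic_eqI:
  fixes x y :: "'p::prime_card padic"
  assumes "\<And>n. x - y \<in> padic_ball n"
  shows "x = y"
proof -
  obtain z where z: "x - y = padic_of_int z"
    using padic_ballE[OF assms[of 0]] by auto
  have "z = 0"
    using assms unfolding z padic_of_int_ball_iff by (intro padic_int_eqI) simp
  thus ?thesis using z by (simp add: padic_of_int_hom)
qed

lemma inverse_of_nat_padic_ball0: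
  assumes "\<not> CARD('p) dvd k"
  shows "inverse (of_nat k :: 'p::prime_card padic) \<in> padic_ball 0"
proof -
  have "(of_nat k :: 'p padic_int) dvd 1"
    using assms power_dvd_of_nat_iff[of 1 k, where 'p='p] by (simp add: padic_int_is_unit_iff)
  then obtain z where "(1 :: 'p padic_int) = of_nat k * z" by (elim dvdE)
  hence "padic_of_int (of_nat k * z) = (padic_of_int 1 :: 'p padic)" by simp
  hence "of_nat k * padic_of_int z = (1 :: 'p padic)" by (simp only: padic_of_int_hom)
  hence "inverse (of_nat k) = padic_of_int z" by (rule inverse_unique)
  thus ?thesis by simp
qed

text \<open>The bound \<open>v (k!) \<le> k div 4\<close> is where \<open>p \<ge> 5\<close> enters the convergence arguments.\<close>

lemma fact_padic_bound:
  assumes "CARD('p::prime_card) > 3"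
  shows "(of_nat CARD('p) ^ (k div 4) / fact k :: 'p padic) \<in> padic_ball 0"
proof -
  let ?p = "CARD('p)"
  have p5: "?p \<ge> 5"
  proof -
    have "?p \<noteq> 4" using prime_card[where 'a='p] by (auto simp: prime_nat_iff dest!: spec[of _ 2])
    thus ?thesis using assms by simp
  qed
  have "\<exists>e u. e \<le> k div 4 \<and> \<not> ?p dvd u \<and> fact k = ?p ^ e * u"
  proof (intro exI conjI)
    define e where "e = multiplicity ?p (fact k)"
    show "\<not> ?p dvd fact k div ?p ^ e"
      unfolding e_def by (rule multiplicity_decompose) (auto simp: prime_gt_1_nat)
    show "fact k = ?p ^ e * (fact k div ?p ^ e)"
      unfolding e_def by (simp add: multiplicity_dvd)
    show "e \<le> k div 4"
      unfolding e_def
    proof (induction k rule: less_induct)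
      case (less k)
      \<comment> \<open>Only the multiples \<open>p j\<close> with \<open>j \<le> q\<close>
        contribute, so \<open>v (k!) = q + v (q!)\<close>. Since
        \<open>q + q div 4 \<le> 5 q / 4\<close> and \<open>5 q \<le> p q \<le> k\<close>, the bound
        reproduces itself.\<close>
      define q where "q = k div ?p"
      have mult_prod: "multiplicity ?p (fact k) = (\<Sum>i=1..k. multiplicity ?p i)" for k :: nat
        unfolding fact_prod of_nat_id by (subst prime_elem_multiplicity_prod_distrib) auto
      have "multiplicity ?p (fact k) = (\<Sum>i=1..k. multiplicity ?p i)"
        by (rule mult_prod)
      also have "\<dots> = (\<Sum>i\<in>(\<lambda>j. ?p * j) ` {1..q}. multiplicity ?p i)"
      proof (intro sum.mono_neutral_right ballI)
        show "(\<lambda>j. ?p * j) ` {1..q} \<subseteq> {1..k}"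
        proof safe
          fix j assume j: "j \<in> {1..q}"
          hence "?p * j \<le> ?p * (k div ?p)" by (simp add: q_def)
          also have "\<dots> \<le> k" by simp
          finally have "?p * j \<le> k" .
          moreover have "?p * j > 0" using j by simp
          ultimately show "?p * j \<in> {1..k}" by (simp only: atLeastAtMost_iff Suc_le_eq One_nat_def)
        qed
        show "multiplicity ?p i = 0" if "i \<in> {1..k} - (\<lambda>j. ?p * j) ` {1..q}" for i
        proof (rule not_dvd_imp_multiplicity_0, rule notI)
          assume "?p dvd i"
          then obtain j where "i = ?p * j" by (elim dvdE)
          moreover from this that have "1 \<le> j" "j \<le> q"
            using p5 by (auto simp: q_def less_eq_div_iff_mult_less_eq mult.commute Suc_le_eq intro!: Nat.gr0I)
          ultimately show False using that by auto
        qed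
      qed auto
      also have "\<dots> = (\<Sum>j=1..q. multiplicity ?p (?p * j))"
        using p5 by (subst sum.reindex) (auto simp: inj_on_def)
      also have "\<dots> = (\<Sum>j=1..q. 1 + multiplicity ?p j)"
        by (intro sum.cong refl) (auto simp: prime_elem_multiplicity_mult_distrib)
      also have "\<dots> = q + multiplicity ?p (fact q)"
        by (simp only: mult_prod sum.distrib) simp
      finally have eq: "multiplicity ?p (fact k) = q + multiplicity ?p (fact q)" .
      show ?case
      proof (cases "q = 0")
        case False
        hence "k \<noteq> 0" by (intro notI) (simp add: q_def)
        hence "q < k" unfolding q_def using p5 by (intro div_less_dividend) auto
        from less[OF this] have "q + multiplicity ?p (fact q) \<le> q + q div 4" by simp
        also have "\<dots> \<le> k div 4"
        proof -
          have "5 * q \<le> ?p * q" using p5 by simp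
          also have "\<dots> \<le> k" by (simp add: q_def)
          finally have "5 * q \<le> k" .
          moreover have "q * 4 + (q div 4) * 4 \<le> q * 4 + q" by simp
          ultimately have "4 * (q + q div 4) \<le> k"
            unfolding distrib_left by (simp only: mult.commute[of _ 4] mult.commute[of _ 5])
          thus ?thesis by (simp add: less_eq_div_iff_mult_less_eq mult.commute)
        qed
        finally show ?thesis using eq by simp
      next
        case True
        thus ?thesis using eq by simp
      qed
    qed
  qed
  then obtain e u where eu: "e \<le> k div 4" "\<not> ?p dvd u" "fact k = ?p ^ e * u" by blast
  have "(fact k :: 'p padic) = of_nat (fact k)" by simp
  also have "\<dots> = of_nat ?p ^ e * of_nat u" unfolding eu(3) by simp
  finally have f: "(fact k :: 'p padic) = of_nat ?p ^ e * of_nat u" .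
  have "(of_nat ?p ^ (k div 4) :: 'p padic) = of_nat ?p ^ e * of_nat ?p ^ (k div 4 - e)"
    using eu(1) by (simp flip: power_add)
  hence "of_nat ?p ^ (k div 4) / fact k = (of_nat ?p ^ (k div 4 - e) * inverse (of_nat u) :: 'p padic)"
    using eu(2) by (simp add: f field_simps)
  also have "\<dots> \<in> padic_ball 0"
    using eu(2) by (intro padic_ball_mult_left padic_ball_power of_nat_padic_ball0 inverse_of_nat_padic_ball0)
  finally show ?thesis .
qed

section \<open>The Gamma function: functional equation, multiplication and reflection\<close>

lemma Gamma_p_nat_cong_padic:
  assumes "CARD('p::prime_card) \<noteq> 2" "[k = k'] (mod CARD('p) ^ n)"
  shows "of_nat CARD('p) ^ n dvd (Gamma_p_nat k - Gamma_p_nat k' :: 'p padic_int)"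
proof -
  have p: "prime CARD('p)" "odd CARD('p)"
    using assms primes_dvd_imp_eq[of 2 "CARD('p)"] by auto
  define G where "G = (\<lambda>n. (-1) ^ n * int (\<Prod>j | 0 < j \<and> j < n \<and> \<not> CARD('p) dvd j. j))"
  have "[G k = G k'] (mod int CARD('p) ^ n)"
    unfolding G_def by (rule Gamma_p_nat_cong[OF p assms(2)])
  moreover have "Gamma_p_nat k - Gamma_p_nat k' = (of_int (G k - G k') :: 'p padic_int)"
    by (simp add: Gamma_p_nat_def G_def)
  ultimately show ?thesis
    by (simp only: power_dvd_of_int_iff cong_iff_dvd_diff)
qed

text \<open>No precision is lost: a sequence of natural numbers tending to \<open>x\<close> is
  eventually congruent to \<open>k\<close> modulo \<open>p ^ n\<close>, and
  \<open>Gamma_p_nat\<close> respects this congruence. In this form continuity reduces identities of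
  \<open>Gamma_p\<close> to natural arguments.\<close>

lemma Gamma_p_approx:
  fixes x :: "'p::prime_card padic_int"
  assumes "CARD('p) \<noteq> 2" "of_nat CARD('p) ^ n dvd x - of_nat k"
  shows "of_nat CARD('p) ^ n dvd Gamma_p x - Gamma_p_nat k"
proof -
  have "\<forall>j. \<exists>s. of_nat CARD('p) ^ j dvd x - of_nat s"
    using exists_nat_approx by metis
  then obtain s where s: "\<And>j. of_nat CARD('p) ^ j dvd x - of_nat (s j)"
    by metis
  have res: "padic_residue (of_nat (s j) :: 'p padic_int) i = padic_residue x i" if "i \<le> j" for i j
  proof -
    have "of_nat CARD('p) ^ i dvd x - of_nat (s j)"
      using s[of j] le_imp_power_dvd[OF that] by (rule dvd_trans[rotated])
    thus ?thesis by (simp only: padic_residue_eq_iff[symmetric])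
  qed
  have "(\<lambda>j. of_nat (s j)) \<longlonglongrightarrow> x"
    unfolding tendsto_padic_int_iff
  proof
    fix i
    show "eventually (\<lambda>j. padic_residue (of_nat (s j) :: 'p padic_int) i = padic_residue x i) sequentially"
      using eventually_ge_at_top[of i] by eventually_elim (rule res)
  qed
  hence "filterlim s (filtercomap of_nat (nhds x)) sequentially"
    by (simp add: filterlim_filtercomap_iff o_def)
  hence "(\<lambda>j. Gamma_p_nat (s j)) \<longlonglongrightarrow> Gamma_p x"
    by (rule filterlim_compose[OF tendsto_Gamma_p[OF assms(1)]])
  hence "eventually (\<lambda>j. padic_residue (Gamma_p_nat (s j) :: 'p padic_int) n = padic_residue (Gamma_p x) n) sequentially"
    by (simp only: tendsto_padic_int_iff)
  with eventually_ge_at_top[of n]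
  have "eventually (\<lambda>j. j \<ge> n \<and> padic_residue (Gamma_p_nat (s j) :: 'p padic_int) n = padic_residue (Gamma_p x) n) sequentially"
    by (rule eventually_conj)
  then obtain j where j: "j \<ge> n" "padic_residue (Gamma_p_nat (s j) :: 'p padic_int) n = padic_residue (Gamma_p x) n"
    using eventually_happens'[OF trivial_limit_sequentially] by blast
  have "padic_residue (of_nat (s j) :: 'p padic_int) n = padic_residue (of_nat k :: 'p padic_int) n"
    using res[OF j(1)] assms(2) by (simp only: padic_residue_eq_iff[symmetric])
  hence "[int (s j) = int k] (mod int (CARD('p) ^ n))"
    by (simp add: cong_def)
  hence "[s j = k] (mod CARD('p) ^ n)"
    by (simp only: cong_int_iff)
  from Gamma_p_nat_cong_padic[OF assms(1) this] show ?thesis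
    using j(2) by (simp only: padic_residue_eq_iff[symmetric])
qed

lemma dvd_diff_flip: "d dvd x - y \<Longrightarrow> d dvd y - (x :: 'a :: comm_ring_1)"
  by (metis dvd_minus_iff minus_diff_eq)

lemma Gamma_p_cong:
  fixes x y :: "'p::prime_card padic_int"
  assumes "CARD('p) \<noteq> 2" "of_nat CARD('p) ^ n dvd x - y"
  shows "of_nat CARD('p) ^ n dvd Gamma_p x - Gamma_p y"
proof -
  obtain k where k: "of_nat CARD('p) ^ n dvd y - of_nat k"
    using exists_nat_approx .
  have "of_nat CARD('p) ^ n dvd (x - y) + (y - of_nat k)"
    using assms(2) k by (rule dvd_add)
  hence "of_nat CARD('p) ^ n dvd x - of_nat k" by simp
  from dvd_diff[OF Gamma_p_approx[OF assms(1) this] Gamma_p_approx[OF assms(1) k]]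
  have "of_nat CARD('p) ^ n dvd (Gamma_p x - Gamma_p_nat k) - (Gamma_p y - Gamma_p_nat k)" .
  thus ?thesis by simp
qed

lemma Gamma_p_of_nat:
  assumes "CARD('p) \<noteq> 2"
  shows "Gamma_p (of_nat k :: 'p::prime_card padic_int) = Gamma_p_nat k"
  by (intro padic_int_eqI Gamma_p_approx assms) simp

lemma Gamma_p_0: "CARD('p) \<noteq> 2 \<Longrightarrow> Gamma_p (0 :: 'p::prime_card padic_int) = 1"
  using Gamma_p_of_nat[of 0, where 'p='p] by (simp add: Gamma_p_nat_def)

definition Gamma_p_factor :: "'p::prime_card padic_int \<Rightarrow> 'p padic_int" where
  "Gamma_p_factor x = (if of_nat CARD('p) dvd x then -1 else - x)"

lemma Gamma_p_nat_Suc: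
  "Gamma_p_nat (Suc k) = Gamma_p_factor (of_nat k) * (Gamma_p_nat k :: 'p::prime_card padic_int)"
proof -
  let ?A = "\<lambda>k. {j. 0 < j \<and> j < k \<and> \<not> CARD('p) dvd j}"
  have dvd: "of_nat CARD('p) dvd (of_nat k :: 'p padic_int) \<longleftrightarrow> CARD('p) dvd k"
    using power_dvd_of_nat_iff[of 1 k, where 'p='p] by simp
  show ?thesis
  proof (cases "CARD('p) dvd k")
    case True
    hence "?A (Suc k) = ?A k" by (auto simp: less_Suc_eq)
    thus ?thesis using True by (simp add: Gamma_p_nat_def Gamma_p_factor_def dvd)
  next
    case False
    hence "k > 0" by (intro Nat.gr0I) auto
    hence "?A (Suc k) = insert k (?A k)" using False by (auto simp: less_Suc_eq)
    thus ?thesis using False by (simp add: Gamma_p_nat_def Gamma_p_factor_def dvd)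
  qed
qed

lemma Gamma_p_plus1:
  fixes x :: "'p::prime_card padic_int"
  assumes "CARD('p) \<noteq> 2"
  shows "Gamma_p (x + 1) = Gamma_p_factor x * Gamma_p x"
proof (rule padic_int_eqI)
  fix n
  \<comment> \<open>Precision \<open>Suc n\<close> ensures, even for \<open>n = 0\<close>, that
    \<open>x\<close> and \<open>k\<close> agree about divisibility by \<open>p\<close>, so that
    \<open>Gamma_p_factor\<close> takes the same branch at both.\<close>
  obtain k where k: "of_nat CARD('p) ^ Suc n dvd x - of_nat k"
    using exists_nat_approx .
  have kn: "of_nat CARD('p) ^ n dvd x - of_nat k"
    using k le_imp_power_dvd[of n "Suc n"] by (meson dvd_trans le_Suc_eq order_refl)
  have "of_nat CARD('p) dvd x - of_nat k"
    using k by (metis dvd_trans dvd_triv_left power_Suc)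
  hence "of_nat CARD('p) dvd x \<longleftrightarrow> of_nat CARD('p) dvd (of_nat k :: 'p padic_int)"
    by (metis dvd_diff_left_iff dvd_diff_right_iff)
  hence fac: "of_nat CARD('p) ^ n dvd Gamma_p_factor x - Gamma_p_factor (of_nat k)"
    using dvd_diff_flip[OF kn] by (auto simp: Gamma_p_factor_def)
  have "of_nat CARD('p) ^ n dvd (x + 1) - of_nat (Suc k)"
    using kn by simp
  hence 1: "of_nat CARD('p) ^ n dvd Gamma_p (x + 1) - Gamma_p_factor (of_nat k) * Gamma_p_nat k"
    using Gamma_p_approx[OF assms] by (metis Gamma_p_nat_Suc)
  have 2: "of_nat CARD('p) ^ n dvd (Gamma_p_factor x - Gamma_p_factor (of_nat k)) * Gamma_p x
      + Gamma_p_factor (of_nat k) * (Gamma_p x - Gamma_p_nat k)"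
    using fac Gamma_p_approx[OF assms kn] by (intro dvd_add dvd_mult dvd_mult2)
  from dvd_diff[OF 1 2] show "of_nat CARD('p) ^ n dvd Gamma_p (x + 1) - Gamma_p_factor x * Gamma_p x"
    by (simp add: algebra_simps)
qed

lemma Gamma_p_factor_unit: "\<not> of_nat CARD('p) dvd Gamma_p_factor (x :: 'p::prime_card padic_int)"
  by (auto simp: Gamma_p_factor_def padic_int_is_unit_iff[symmetric])

lemma Gamma_p_unit:
  fixes x :: "'p::prime_card padic_int"
  assumes "CARD('p) \<noteq> 2"
  shows "\<not> of_nat CARD('p) dvd Gamma_p x"
proof -
  have nat: "\<not> of_nat CARD('p) dvd (Gamma_p_nat k :: 'p padic_int)" for k
  proof (induction k)
    case 0
    show ?case by (simp add: Gamma_p_nat_def padic_int_is_unit_iff[symmetric])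
  next
    case (Suc k)
    thus ?case
      by (simp add: Gamma_p_nat_Suc prime_elem_dvd_mult_iff prime_elem_p_padic Gamma_p_factor_unit)
  qed
  obtain k where "of_nat CARD('p) ^ 1 dvd x - of_nat k"
    using exists_nat_approx .
  from Gamma_p_approx[OF assms this] have "of_nat CARD('p) dvd Gamma_p x - Gamma_p_nat k"
    by simp
  thus ?thesis using nat[of k] by (metis dvd_diff_right_iff)
qed

lemma Gamma_p_nonzero: "CARD('p) \<noteq> 2 \<Longrightarrow> Gamma_p (x :: 'p::prime_card padic_int) \<noteq> 0"
  using Gamma_p_unit[of x] by auto

definition p_free_count :: "nat \<Rightarrow> nat \<Rightarrow> nat" where
  "p_free_count p k = (\<Sum>l<k. if p dvd l then 0 else 1)"

lemma p_free_count_Suc: "p_free_count p (Suc q) = q - q div p"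
proof (induction q)
  case (Suc q)
  have "q div p \<le> q" by (rule div_le_dividend)
  thus ?case using Suc by (auto simp: p_free_count_def div_Suc dvd_eq_mod_eq_0 Suc_diff_le)
qed (simp add: p_free_count_def)

text \<open>Passing from \<open>k\<close> to \<open>k + 1\<close> replaces the factor at
  \<open>k i\<close> by the one at \<open>k i + 1\<close>, that is, multiplies the product by
  \<open>Gamma_p_factor (k i)\<close>. This is \<open>Gamma_p_factor k\<close> divided by
  \<open>m\<close> if \<open>p\<close> does not divide \<open>k\<close>, and equal to it otherwise;
  \<open>p_free_count\<close> collects these powers of \<open>m\<close>.\<close>

lemma Gamma_p_multiplication_nat:
  fixes i :: "'p::prime_card padic_int"
  assumes p: "CARD('p) \<noteq> 2" and i: "of_nat m * i = 1"
  shows "(\<Prod>h<m. Gamma_p (of_nat (k + h) * i)) * of_nat m ^ p_free_count CARD('p) k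
    = Gamma_p (of_nat k) * (\<Prod>h<m. Gamma_p (of_nat h * i))"
proof (induction k)
  case 0
  show ?case using Gamma_p_0[OF p] by (simp add: p_free_count_def)
next
  case (Suc k)
  let ?g = "\<lambda>h. Gamma_p (of_nat (k + h) * i)"
  let ?c = "p_free_count CARD('p)"
  have im: "i dvd 1" using i by (metis dvd_triv_right)
  have dvd: "of_nat CARD('p) dvd of_nat k * i \<longleftrightarrow> of_nat CARD('p) dvd (of_nat k :: 'p padic_int)"
    using im by (simp add: dvd_mult_unit_iff)
  have "of_nat (k + m) * i = of_nat k * i + 1"
    using i by (simp add: distrib_right)
  hence gm: "?g m = Gamma_p_factor (of_nat k * i) * ?g 0"
    using Gamma_p_plus1[OF p, of "of_nat k * i"] by (simp add: distrib_right)
  have "(\<Prod>h<m. ?g (Suc h)) * ?g 0 = (\<Prod>h<Suc m. ?g h)"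
    by (subst prod.lessThan_Suc_shift) (simp add: mult.commute)
  also have "\<dots> = (\<Prod>h<m. ?g h) * ?g m" by simp
  also have "\<dots> = ((\<Prod>h<m. ?g h) * Gamma_p_factor (of_nat k * i)) * ?g 0"
    by (simp only: gm mult.assoc)
  finally have step: "(\<Prod>h<m. ?g (Suc h)) = (\<Prod>h<m. ?g h) * Gamma_p_factor (of_nat k * i)"
    using Gamma_p_nonzero[OF p] by simp
  have fac: "Gamma_p_factor (of_nat k * i) * of_nat m ^ ?c (Suc k)
    = Gamma_p_factor (of_nat k) * of_nat m ^ ?c k"
  proof (cases "CARD('p) dvd k")
    case True
    hence "of_nat CARD('p) dvd (of_nat k :: 'p padic_int)" by auto
    with True show ?thesis by (simp add: Gamma_p_factor_def p_free_count_def)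
  next
    case False
    hence "\<not> of_nat CARD('p) dvd (of_nat k :: 'p padic_int)"
      using power_dvd_of_nat_iff[of 1 k, where 'p='p] by simp
    moreover have "of_nat k * i * (of_nat m ^ c * of_nat m) = of_nat k * of_nat m ^ c" for c
    proof -
      have "of_nat k * i * (of_nat m ^ c * of_nat m) = of_nat k * of_nat m ^ c * (of_nat m * i)"
        by (simp only: mult_ac)
      thus ?thesis by (simp only: i mult_1_right)
    qed
    moreover have "?c (Suc k) = Suc (?c k)" using False by (simp add: p_free_count_def)
    ultimately show ?thesis using False by (simp add: Gamma_p_factor_def dvd power_Suc2 del: power_Suc)
  qed
  have "(\<Prod>h<m. Gamma_p (of_nat (Suc k + h) * i)) = (\<Prod>h<m. ?g (Suc h))" by simp
  also have "\<dots> * of_nat m ^ ?c (Suc k) = (\<Prod>h<m. ?g h) * (Gamma_p_factor (of_nat k * i) * of_nat m ^ ?c (Suc k))"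
    by (simp only: step mult.assoc)
  also have "\<dots> = (\<Prod>h<m. ?g h) * (Gamma_p_factor (of_nat k) * of_nat m ^ ?c k)"
    by (simp only: fac)
  also have "\<dots> = Gamma_p_factor (of_nat k) * ((\<Prod>h<m. ?g h) * of_nat m ^ ?c k)"
    by (simp only: mult_ac)
  also have "\<dots> = Gamma_p_factor (of_nat k) * Gamma_p (of_nat k) * (\<Prod>h<m. Gamma_p (of_nat h * i))"
    using Suc by (simp only: mult.assoc)
  also have "Gamma_p_factor (of_nat k) * Gamma_p (of_nat k) = Gamma_p (of_nat (Suc k) :: 'p padic_int)"
    using Gamma_p_plus1[OF p, of "of_nat k"] by (simp add: add.commute)
  finally show ?case .
qed

text \<open>The functional equations at \<open>k\<close> and at \<open>- k\<close> have factors
  \<open>- k\<close> and \<open>k\<close> if \<open>p\<close> does not divide \<open>k\<close>, and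
  both \<open>- 1\<close> otherwise. Hence the sign changes exactly at the \<open>k\<close> prime to
  \<open>p\<close>.\<close>

lemma Gamma_p_reflection_nat:
  assumes p: "CARD('p::prime_card) \<noteq> 2"
  shows "Gamma_p (of_nat k) * Gamma_p (1 - of_nat k :: 'p padic_int) = - ((-1) ^ p_free_count CARD('p) k)"
proof (induction k)
  case 0
  have "Gamma_p_nat 1 = (-1 :: 'p padic_int)"
    using Gamma_p_nat_Suc[of 0, where 'p='p] by (simp add: Gamma_p_factor_def Gamma_p_nat_def)
  thus ?case using Gamma_p_0[OF p] Gamma_p_of_nat[OF p, of 1] by (simp add: p_free_count_def)
next
  case (Suc k)
  have dvd: "of_nat CARD('p) dvd (of_nat k :: 'p padic_int) \<longleftrightarrow> CARD('p) dvd k"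
    using power_dvd_of_nat_iff[of 1 k, where 'p='p] by simp
  have 1: "Gamma_p (of_nat (Suc k) :: 'p padic_int) = Gamma_p_factor (of_nat k) * Gamma_p (of_nat k)"
    using Gamma_p_plus1[OF p, of "of_nat k"] by (simp add: add.commute)
  have 2: "Gamma_p (1 - of_nat k :: 'p padic_int)
      = Gamma_p_factor (- of_nat k) * Gamma_p (1 - of_nat (Suc k))"
    using Gamma_p_plus1[OF p, of "- of_nat k"] by simp
  show ?case
  proof (cases "CARD('p) dvd k")
    case True
    thus ?thesis using Suc 1 2 by (simp add: Gamma_p_factor_def p_free_count_def dvd)
  next
    case False
    thus ?thesis using Suc 1 2 by (simp add: Gamma_p_factor_def p_free_count_def dvd mult_ac)
  qed
qed

text \<open>A rational number \<open>r / (p - 1)\<close> is approximated by the natural numbers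
  \<open>1 + (p - 1 - r) (1 + p + \<dots> + p ^ n)\<close>, below which the number of integers prime to \<open>p\<close> is
  \<open>(p - 1 - r) p ^ n\<close>.\<close>

lemma p_minus_1_approx:
  fixes z :: "'p::prime_card padic_int"
  assumes z: "of_nat (CARD('p) - 1) * z = of_nat r" and r: "r \<le> CARD('p) - 1"
  obtains k where "of_nat CARD('p) ^ Suc n dvd z - of_nat k"
    "p_free_count CARD('p) k = (CARD('p) - 1 - r) * CARD('p) ^ n"
proof
  let ?p = "CARD('p)"
  define R where "R = (\<lambda>n. \<Sum>i<n. ?p ^ i)"
  have p: "?p > 1" by (rule prime_gt_1_nat) simp
  obtain q where q: "?p = Suc q" using p by (cases ?p) auto
  have R: "(?p - 1) * R n + 1 = ?p ^ n" for n
    by (induction n) (simp_all add: R_def q distrib_left)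
  have RSuc: "R (Suc n) = 1 + ?p * R n" for n
    by (simp only: R_def sum.lessThan_Suc_shift) (simp add: sum_distrib_left)
  define d where "d = ?p - 1 - r"
  define k where "k = Suc (d * R (Suc n))"
  have Rge: "R (Suc n) = R n + ?p ^ n" by (simp add: R_def)
  have "d * R (Suc n) div ?p = d * R n"
  proof -
    have "d * R (Suc n) = d + (d * R n) * ?p" by (simp add: RSuc algebra_simps)
    moreover have "d < ?p" using p by (simp add: d_def)
    ultimately show ?thesis by simp
  qed
  thus "p_free_count ?p k = (?p - 1 - r) * ?p ^ n"
    unfolding k_def p_free_count_Suc d_def[symmetric] by (simp add: Rge distrib_left)
  have "\<not> ?p dvd ?p - 1"
    using p by (intro nat_dvd_not_less) auto
  hence unit: "(of_nat (?p - 1) :: 'p padic_int) dvd 1"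
    using power_dvd_of_nat_iff[of 1 "?p - 1", where 'p='p] by (simp add: padic_int_is_unit_iff)
  have "of_nat (?p - 1) * (z - of_nat k) = - (of_nat d * of_nat ?p ^ Suc n)"
  proof -
    have "(?p - 1) * k + d = (?p - 1) + d * ((?p - 1) * R (Suc n) + 1)"
      by (simp add: k_def q algebra_simps)
    also have "(?p - 1) * R (Suc n) + 1 = ?p ^ Suc n"
      by (rule R)
    finally have "of_nat (?p - 1) * of_nat k + of_nat d = (of_nat (?p - 1) + of_nat d * of_nat ?p ^ Suc n :: 'p padic_int)"
      by (metis of_nat_add of_nat_mult of_nat_power)
    moreover have "of_nat r = (of_nat (?p - 1) - of_nat d :: 'p padic_int)"
      unfolding d_def of_nat_diff[OF r] by simp
    ultimately show ?thesis using z by (simp only: right_diff_distrib) (simp add: algebra_simps)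
  qed
  hence "of_nat ?p ^ Suc n dvd of_nat (?p - 1) * (z - of_nat k)"
    by (metis dvd_minus_iff dvd_triv_right)
  thus "of_nat ?p ^ Suc n dvd z - of_nat k"
    using unit by (simp add: dvd_mult_unit_iff')
qed

section \<open>Teichmuller representatives as limits, and congruences of products\<close>

lemma teichmuller_simps [simp]:
  "teichmuller 0 = 0" "teichmuller 1 = 1" "teichmuller (a * b) = teichmuller a * teichmuller b"
  "padic_reduce (teichmuller a) = a"
  using is_teichmuller_teichmuller by (auto simp: is_teichmuller_def)

lemma teichmuller_power: "teichmuller (a ^ n) = teichmuller a ^ n"
  by (induction n) auto

lemma teichmuller_power_card: "teichmuller a ^ CARD('p) = teichmuller (a :: 'p::prime_card mod_ring)"
  by (simp add: mod_ring_power_card flip: teichmuller_power)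

lemma padic_reduce_eq_iff:
  "padic_reduce x = padic_reduce y \<longleftrightarrow> of_nat CARD('p) dvd x - (y :: 'p::prime_card padic_int)"
proof -
  have "padic_reduce x = padic_reduce y \<longleftrightarrow> padic_residue x 1 = padic_residue y 1"
    by (metis to_int_mod_ring_padic_reduce of_int_mod_ring_to_int_mod_ring)
  thus ?thesis by (simp add: padic_residue_eq_iff)
qed

lemma padic_reduce_hom:
  fixes x y :: "'p::prime_card padic_int"
  shows "padic_reduce (x + y) = padic_reduce x + padic_reduce y"
    "padic_reduce (x - y) = padic_reduce x - padic_reduce y"
    "padic_reduce (x * y) = padic_reduce x * padic_reduce y"
    "padic_reduce (0 :: 'p padic_int) = 0" "padic_reduce (1 :: 'p padic_int) = 1"
proof -
  show "padic_reduce (x + y) = padic_reduce x + padic_reduce y"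
    by transfer simp
  show "padic_reduce (x - y) = padic_reduce x - padic_reduce y"
    by transfer simp
  show "padic_reduce (x * y) = padic_reduce x * padic_reduce y"
    by transfer simp
  show "padic_reduce (0 :: 'p padic_int) = 0" by transfer simp
  show "padic_reduce (1 :: 'p padic_int) = 1" by transfer simp
qed

lemma padic_reduce_of_nat: "padic_reduce (of_nat n) = of_nat n"
  by (induction n) (simp_all add: padic_reduce_hom)

lemma padic_int_cong_pow_prime_power:
  fixes x y :: "'p::prime_card padic_int"
  assumes "of_nat CARD('p) dvd x - y"
  shows "of_nat CARD('p) ^ Suc n dvd x ^ (CARD('p) ^ n) - y ^ (CARD('p) ^ n)"
proof -
  let ?p = "int CARD('p)"
  have "padic_residue x 1 = padic_residue y 1"
    using assms by (simp add: padic_residue_eq_iff)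
  hence "padic_residue x (Suc n) mod ?p = padic_residue y (Suc n) mod ?p"
    using padic_residue_mod[of 1 "Suc n" x] padic_residue_mod[of 1 "Suc n" y] by simp
  hence "[padic_residue x (Suc n) = padic_residue y (Suc n)] (mod ?p)" by (simp only: cong_def)
  hence "[padic_residue x (Suc n) ^ (CARD('p) ^ n) = padic_residue y (Suc n) ^ (CARD('p) ^ n)] (mod ?p ^ Suc n)"
    by (rule cong_pow_prime_power)
  hence "padic_residue (x ^ (CARD('p) ^ n)) (Suc n) = padic_residue (y ^ (CARD('p) ^ n)) (Suc n)"
    unfolding padic_residue_power cong_def .
  thus ?thesis by (simp only: padic_residue_eq_iff)
qed

text \<open>A Teichmuller representative is fixed by the p-th power, and raising a congruence modulo
  \<open>p\<close> to the power \<open>p ^ n\<close> turns it into one modulo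
  \<open>p ^ (n + 1)\<close>.\<close>

lemma teichmuller_of_nat_approx:
  "of_nat CARD('p) ^ Suc n dvd teichmuller (of_nat m :: 'p::prime_card mod_ring) - of_nat m ^ (CARD('p) ^ n)"
proof -
  let ?t = "teichmuller (of_nat m :: 'p mod_ring)"
  have "?t ^ (CARD('p) ^ n) = ?t"
    by (induction n) (simp_all add: power_mult teichmuller_power_card mult.commute[of "CARD('p)"])
  moreover have "of_nat CARD('p) dvd ?t - of_nat m"
    by (simp add: padic_reduce_of_nat flip: padic_reduce_eq_iff)
  ultimately show ?thesis
    using padic_int_cong_pow_prime_power[of ?t "of_nat m" n] by simp
qed

lemma dvd_mult_diff:
  assumes "d dvd a - b" "d dvd a' - (b' :: 'a :: comm_ring_1)"
  shows "d dvd a * a' - b * b'"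
proof -
  have "d dvd (a - b) * a' + b * (a' - b')"
    using assms by (intro dvd_add dvd_mult dvd_mult2)
  thus ?thesis by (simp add: algebra_simps)
qed

lemma dvd_prod_diff:
  assumes "\<And>x. x \<in> A \<Longrightarrow> d dvd f x - (g x :: 'a :: comm_ring_1)"
  shows "d dvd prod f A - prod g A"
  using assms by (induction A rule: infinite_finite_induct) (auto intro: dvd_mult_diff)

lemma dvd_power_diff: "d dvd a - (b :: 'a :: comm_ring_1) \<Longrightarrow> d dvd a ^ n - b ^ n"
  by (induction n) (auto intro: dvd_mult_diff)

text \<open>At the natural numbers that approximate \<open>r / (p - 1)\<close> the exponent of
  \<open>m\<close> is \<open>(p - 1 - r) p ^ n\<close>. As \<open>m ^ (p ^ n)\<close> tends to the
  Teichmuller representative of \<open>m\<close>, the limit is a value of a character.\<close>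

lemma Gamma_p_multiplication:
  fixes z i :: "'p::prime_card padic_int"
  assumes p: "CARD('p) \<noteq> 2" and i: "of_nat m * i = 1"
    and z: "of_nat (CARD('p) - 1) * z = of_nat r" and r: "r \<le> CARD('p) - 1"
  shows "(\<Prod>h<m. Gamma_p ((z + of_nat h) * i)) * teichmuller (of_nat m) ^ (CARD('p) - 1 - r)
    = Gamma_p z * (\<Prod>h<m. Gamma_p (of_nat h * i))"
proof (rule padic_int_eqI)
  fix n
  obtain k where k: "of_nat CARD('p) ^ Suc n dvd z - of_nat k"
    "p_free_count CARD('p) k = (CARD('p) - 1 - r) * CARD('p) ^ n"
    using p_minus_1_approx[OF z r] .
  let ?q = "of_nat CARD('p) ^ Suc n :: 'p padic_int"
  let ?L = "(\<Prod>h<m. Gamma_p ((z + of_nat h) * i)) * teichmuller (of_nat m) ^ (CARD('p) - 1 - r)"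
  let ?R = "Gamma_p z * (\<Prod>h<m. Gamma_p (of_nat h * i))"
  have "?q dvd ?L - (\<Prod>h<m. Gamma_p (of_nat (k + h) * i)) * (of_nat m ^ (CARD('p) ^ n)) ^ (CARD('p) - 1 - r)"
  proof (rule dvd_mult_diff[OF dvd_prod_diff dvd_power_diff[OF teichmuller_of_nat_approx]])
    fix h
    have "?q dvd (z - of_nat k) * i" using k(1) by (rule dvd_mult2)
    hence "?q dvd (z + of_nat h) * i - of_nat (k + h) * i" by (simp add: algebra_simps)
    thus "?q dvd Gamma_p ((z + of_nat h) * i) - Gamma_p (of_nat (k + h) * i)"
      by (rule Gamma_p_cong[OF p])
  qed
  also have "(of_nat m ^ (CARD('p) ^ n)) ^ (CARD('p) - 1 - r) = (of_nat m :: 'p padic_int) ^ p_free_count CARD('p) k"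
    by (simp add: k(2) mult.commute flip: power_mult)
  also have "(\<Prod>h<m. Gamma_p (of_nat (k + h) * i)) * \<dots> = Gamma_p (of_nat k) * (\<Prod>h<m. Gamma_p (of_nat h * i))"
    by (rule Gamma_p_multiplication_nat[OF p i])
  finally have 1: "?q dvd ?L - Gamma_p (of_nat k) * (\<Prod>h<m. Gamma_p (of_nat h * i))" .
  have 2: "?q dvd ?R - Gamma_p (of_nat k) * (\<Prod>h<m. Gamma_p (of_nat h * i))"
    using k(1) by (intro dvd_mult_diff Gamma_p_cong[OF p]) auto
  from dvd_diff[OF 1 2] have "?q dvd ?L - ?R" by simp
  thus "of_nat CARD('p) ^ n dvd ?L - ?R" by (rule dvd_trans[rotated]) (simp add: le_imp_power_dvd)
qed

text \<open>For odd \<open>p\<close> the exponent \<open>(p - 1 - r) p ^ n\<close> of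
  \<open>- 1\<close> has the parity of \<open>r\<close>, whatever \<open>n\<close> is, so the sign
  passes to the limit.\<close>

lemma Gamma_p_reflection:
  fixes z :: "'p::prime_card padic_int"
  assumes p: "CARD('p) \<noteq> 2"
    and z: "of_nat (CARD('p) - 1) * z = of_nat r" and r: "r \<le> CARD('p) - 1"
  shows "Gamma_p z * Gamma_p (1 - z) = - ((-1) ^ r)"
proof (rule padic_int_eqI)
  fix n
  have odd: "odd CARD('p)" using p primes_dvd_imp_eq[of 2 "CARD('p)"] by auto
  obtain k where k: "of_nat CARD('p) ^ Suc n dvd z - of_nat k"
    "p_free_count CARD('p) k = (CARD('p) - 1 - r) * CARD('p) ^ n"
    using p_minus_1_approx[OF z r] .
  let ?q = "of_nat CARD('p) ^ Suc n :: 'p padic_int"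
  have "?q dvd (1 - z) - (1 - of_nat k)"
    using dvd_diff_flip[OF k(1)] by simp
  hence "?q dvd Gamma_p z * Gamma_p (1 - z) - Gamma_p (of_nat k) * Gamma_p (1 - of_nat k)"
    using k(1) by (intro dvd_mult_diff Gamma_p_cong[OF p])
  also have "Gamma_p (of_nat k) * Gamma_p (1 - of_nat k) = (- ((-1) ^ p_free_count CARD('p) k) :: 'p padic_int)"
    by (rule Gamma_p_reflection_nat[OF p])
  also have "even (p_free_count CARD('p) k) \<longleftrightarrow> even r"
  proof -
    have "even (CARD('p) - 1)" using odd by simp
    hence "even (CARD('p) - 1 - r) \<longleftrightarrow> even r" using r by (simp only: even_diff_nat) auto
    thus ?thesis using odd by (simp add: k(2))
  qed
  hence "(-1 :: 'p padic_int) ^ p_free_count CARD('p) k = (-1) ^ r"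
    by (simp add: minus_one_power_iff)
  finally show "of_nat CARD('p) ^ n dvd Gamma_p z * Gamma_p (1 - z) - - ((-1) ^ r)"
    by (rule dvd_trans[rotated]) (simp add: le_imp_power_dvd)
qed

declare add_fract [simp del] diff_fract [simp del] mult_fract [simp del] minus_fract [simp del]
  divide_fract [simp del] inverse_fract [simp del]

section \<open>Finite differences\<close>

definition fwd_diff :: "(nat \<Rightarrow> 'a :: comm_ring_1) \<Rightarrow> nat \<Rightarrow> 'a" where
  "fwd_diff f = (\<lambda>x. f (Suc x) - f x)"

lemma fwd_diff_Suc: "(fwd_diff ^^ Suc k) f x = (fwd_diff ^^ k) f (Suc x) - (fwd_diff ^^ k) f x"
  by (simp add: fwd_diff_def)

lemma fwd_diff_Suc': "(fwd_diff ^^ Suc k) f x = (fwd_diff ^^ k) (fwd_diff f) x"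
  by (simp only: funpow_Suc_right o_apply)

lemma fwd_diff_add:
  "(fwd_diff ^^ k) (\<lambda>x. f x + g x) x = (fwd_diff ^^ k) f x + (fwd_diff ^^ k) g x"
  by (induction k arbitrary: x) (simp_all only: fwd_diff_Suc funpow_0, simp)

lemma fwd_diff_scale: "(fwd_diff ^^ k) (\<lambda>x. c * f x) x = c * (fwd_diff ^^ k) f x"
  by (induction k arbitrary: x) (simp_all only: fwd_diff_Suc funpow_0 right_diff_distrib)

lemma fwd_diff_uminus: "(fwd_diff ^^ k) (\<lambda>x. - f x) x = - (fwd_diff ^^ k) f x"
  using fwd_diff_scale[of k "-1" f] by simp

lemma fwd_diff_shift: "(fwd_diff ^^ k) (\<lambda>x. f (Suc x)) x = (fwd_diff ^^ k) f (Suc x)"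
  by (induction k arbitrary: x) (simp_all only: fwd_diff_Suc funpow_0)

lemma fwd_diff_times_id:
  "(fwd_diff ^^ k) (\<lambda>x. of_nat x * f x) x
    = of_nat x * (fwd_diff ^^ k) f x + of_nat k * (fwd_diff ^^ (k - 1)) f (Suc x)"
proof (induction k arbitrary: x)
  case (Suc k)
  show ?case
  proof (cases k)
    case 0
    thus ?thesis by (simp add: fwd_diff_def algebra_simps)
  next
    case (Suc j)
    have k: "(fwd_diff ^^ (k - 1)) f (Suc (Suc x)) = (fwd_diff ^^ k) f (Suc x) + (fwd_diff ^^ (k - 1)) f (Suc x)"
      unfolding Suc diff_Suc_1 fwd_diff_Suc by simp
    show ?thesis
      unfolding fwd_diff_Suc[of k] Suc.IH k by (simp add: algebra_simps)
  qed
qed simp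

lemma newton_forward:
  "f (x + n) = (\<Sum>k\<le>n. of_nat (n choose k) * (fwd_diff ^^ k) f x)"
proof (induction n arbitrary: f)
  case (Suc n)
  have "f (x + Suc n) = f (x + n) + fwd_diff f (x + n)"
    by (simp add: fwd_diff_def)
  also have "\<dots> = (\<Sum>k\<le>n. of_nat (n choose k) * (fwd_diff ^^ k) f x)
      + (\<Sum>k\<le>n. of_nat (n choose k) * (fwd_diff ^^ Suc k) f x)"
    by (simp only: Suc[of f] Suc[of "fwd_diff f"] fwd_diff_Suc')
  also have "(\<Sum>k\<le>n. of_nat (n choose k) * (fwd_diff ^^ k) f x)
      = (\<Sum>k\<le>Suc n. of_nat (n choose k) * (fwd_diff ^^ k) f x)"
    by (simp add: binomial_eq_0)
  also have "\<dots> = f x + (\<Sum>k\<le>n. of_nat (n choose Suc k) * (fwd_diff ^^ Suc k) f x)"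
    by (subst sum.atMost_Suc_shift) simp
  also have "\<dots> + (\<Sum>k\<le>n. of_nat (n choose k) * (fwd_diff ^^ Suc k) f x)
      = f x + (\<Sum>k\<le>n. of_nat (Suc n choose Suc k) * (fwd_diff ^^ Suc k) f x)"
    by (simp add: sum.distrib algebra_simps del: funpow.simps)
  also have "\<dots> = (\<Sum>k\<le>Suc n. of_nat (Suc n choose k) * (fwd_diff ^^ k) f x)"
    by (subst sum.atMost_Suc_shift) simp
  finally show ?case .
qed simp

text \<open>The j-th difference is to gain one factor \<open>P\<close> per two steps;
  \<open>s\<close> is a head start counted in half factors. The bound \<open>k\<close> on the order
  is there for the induction in \<open>diffs_divisible_functional_eq\<close>.\<close>

definition diffs_divisible :: "'a :: comm_ring_1 \<Rightarrow> nat \<Rightarrow> nat \<Rightarrow> (nat \<Rightarrow> 'a) \<Rightarrow> bool" where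
  "diffs_divisible P s k f \<longleftrightarrow> (\<forall>j\<le>k. \<forall>x. P ^ ((j + s) div 2) dvd (fwd_diff ^^ j) f x)"

lemma diffs_divisible_add:
  "diffs_divisible P s k f \<Longrightarrow> diffs_divisible P s k g \<Longrightarrow> diffs_divisible P s k (\<lambda>x. f x + g x)"
  by (simp add: diffs_divisible_def fwd_diff_add)

lemma diffs_divisible_scale:
  "diffs_divisible P s k f \<Longrightarrow> diffs_divisible P s k (\<lambda>x. c * f x)"
  by (simp add: diffs_divisible_def fwd_diff_scale)

lemma diffs_divisible_weaken:
  assumes "diffs_divisible P (Suc s) k f"
  shows "diffs_divisible P s k f"
  unfolding diffs_divisible_def
proof (intro allI impI)
  fix j x assume "j \<le> k"
  hence "P ^ ((j + Suc s) div 2) dvd (fwd_diff ^^ j) f x"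
    using assms by (simp add: diffs_divisible_def)
  thus "P ^ ((j + s) div 2) dvd (fwd_diff ^^ j) f x"
    by (rule dvd_trans[rotated]) (simp add: le_imp_power_dvd div_le_mono)
qed

lemma diffs_divisible_scale_p:
  assumes "diffs_divisible P s k f"
  shows "diffs_divisible P (Suc (Suc s)) k (\<lambda>x. P * c * f x)"
proof -
  have "P * P ^ ((j + s) div 2) dvd P * c * (fwd_diff ^^ j) f x" if "j \<le> k" for j x
    unfolding mult.assoc using assms that by (intro mult_dvd_mono dvd_mult) (auto simp: diffs_divisible_def)
  thus ?thesis by (simp add: diffs_divisible_def fwd_diff_scale[of _ "P * c"])
qed

text \<open>In the Leibniz rule one term has a difference of order lower by one, which costs half a
  factor. So \<open>P x\<close> gains one half factor, whereas a constant multiple of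
  \<open>P\<close> gains two.\<close>

lemma diffs_divisible_times_id:
  assumes "diffs_divisible P 1 k f"
  shows "diffs_divisible P 2 k (\<lambda>x. P * of_nat x * f x)"
  unfolding diffs_divisible_def
proof (intro allI impI)
  fix j x assume j: "j \<le> k"
  have 1: "P ^ (j div 2) dvd (fwd_diff ^^ j) f x"
  proof -
    have "P ^ ((j + 1) div 2) dvd (fwd_diff ^^ j) f x"
      using assms j by (simp only: diffs_divisible_def)
    thus ?thesis by (rule dvd_trans[rotated]) (simp add: le_imp_power_dvd div_le_mono)
  qed
  have 2: "P ^ (j div 2) dvd of_nat j * (fwd_diff ^^ (j - 1)) f (Suc x)"
  proof (cases j)
    case (Suc i)
    hence "P ^ ((i + 1) div 2) dvd (fwd_diff ^^ i) f (Suc x)"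
      using assms j by (simp only: diffs_divisible_def)
    thus ?thesis using Suc by simp
  qed simp
  have "(fwd_diff ^^ j) (\<lambda>x. P * of_nat x * f x) x
      = P * (of_nat x * (fwd_diff ^^ j) f x + of_nat j * (fwd_diff ^^ (j - 1)) f (Suc x))"
    by (simp only: mult.assoc fwd_diff_scale fwd_diff_times_id)
  moreover have "P * P ^ (j div 2) dvd \<dots>"
    using 1 2 by (intro mult_dvd_mono dvd_refl dvd_add[OF dvd_mult])
  moreover have "P * P ^ (j div 2) = P ^ ((j + 2) div 2)" by simp
  ultimately show "P ^ ((j + 2) div 2) dvd (fwd_diff ^^ j) (\<lambda>x. P * of_nat x * f x) x"
    by metis
qed

lemma fwd_diff_zero: "(fwd_diff ^^ k) (\<lambda>x. 0) x = 0"
  using fwd_diff_scale[of k 0 "\<lambda>x. 0"] by simp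

lemma diffs_divisible_prod:
  assumes "finite A" "diffs_divisible P 1 k f"
  shows "diffs_divisible P 2 k (\<lambda>x. (\<Prod>i\<in>A. c i + P * of_nat x) * f x - (\<Prod>i\<in>A. c i) * f x)"
  using assms(1)
proof (induction A rule: finite_induct)
  case empty
  show ?case by (simp add: diffs_divisible_def fwd_diff_zero)
next
  case (insert a A)
  let ?F = "\<lambda>x. (\<Prod>i\<in>A. c i + P * of_nat x) * f x" and ?C = "\<Prod>i\<in>A. c i"
  have "diffs_divisible P (Suc 1) k (\<lambda>x. ?F x - ?C * f x)"
    using insert.IH by (simp only: Suc_1)
  from diffs_divisible_add[OF diffs_divisible_weaken[OF this] diffs_divisible_scale[OF assms(2)]]
  have "diffs_divisible P 1 k (\<lambda>x. (?F x - ?C * f x) + ?C * f x)" .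
  hence "diffs_divisible P 1 k ?F" by simp
  hence "diffs_divisible P 2 k (\<lambda>x. P * of_nat x * ?F x)"
    by (rule diffs_divisible_times_id)
  with diffs_divisible_scale[OF insert.IH, of "c a"]
  have "diffs_divisible P 2 k (\<lambda>x. c a * (?F x - ?C * f x) + P * of_nat x * ?F x)"
    by (rule diffs_divisible_add)
  thus ?case using insert.hyps by (simp add: algebra_simps)
qed

text \<open>If \<open>f (x + 1)\<close> and \<open>f x\<close> differ by a factor \<open>P\<close>-adically close to 1 which is polynomial
  in \<open>P x\<close>, then each two applications of the difference operator gain a factor \<open>P\<close>.\<close>

lemma diffs_divisible_functional_eq:
  assumes "finite A" and eq: "\<And>x. f x = - ((\<Prod>i\<in>A. c i + P * of_nat x) * f (Suc x))"
    and C: "P dvd - (\<Prod>i\<in>A. c i) - 1"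
  shows "diffs_divisible P 1 k f"
proof (induction k)
  case 0
  show ?case by (simp add: diffs_divisible_def)
next
  case (Suc k)
  let ?g = "\<lambda>x. f (Suc x)" and ?C = "\<Prod>i\<in>A. c i"
  have g: "diffs_divisible P 1 k ?g"
    using Suc unfolding diffs_divisible_def fwd_diff_shift by blast
  \<comment> \<open>As \<open>f = - (product) g\<close>, the difference \<open>g - f\<close> is
    \<open>(1 + ?C) g\<close> plus the deviation of the product from its constant term times
    \<open>g\<close>, where \<open>1 + ?C = - P e\<close>. Both parts gain over
    \<open>g\<close>.\<close>
  obtain e where e: "- ?C - 1 = P * e" using C by (elim dvdE)
  have "diffs_divisible P 2 k (\<lambda>x. P * e * - 1 * ?g x + ((\<Prod>i\<in>A. c i + P * of_nat x) * ?g x - ?C * ?g x))"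
    using diffs_divisible_weaken[OF diffs_divisible_scale_p[OF g, of "e * - 1"]]
      diffs_divisible_prod[OF assms(1) g, of c]
    by (intro diffs_divisible_add) (simp_all add: numeral_2_eq_2)
  also have "(\<lambda>x. P * e * - 1 * ?g x + ((\<Prod>i\<in>A. c i + P * of_nat x) * ?g x - ?C * ?g x)) = fwd_diff f"
  proof
    fix x
    have "P * e * - 1 * ?g x = ?C * ?g x + ?g x"
      unfolding e[symmetric] by (simp add: algebra_simps)
    thus "P * e * - 1 * ?g x + ((\<Prod>i\<in>A. c i + P * of_nat x) * ?g x - ?C * ?g x) = fwd_diff f x"
      using eq[of x] by (simp add: fwd_diff_def)
  qed
  finally have d: "diffs_divisible P 2 k (fwd_diff f)" .
  show ?case
    unfolding diffs_divisible_def
  proof (intro allI impI)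
    fix j x assume "j \<le> Suc k"
    show "P ^ ((j + 1) div 2) dvd (fwd_diff ^^ j) f x"
    proof (cases j)
      case (Suc i)
      hence "P ^ ((i + 2) div 2) dvd (fwd_diff ^^ i) (fwd_diff f) x"
        using d \<open>j \<le> Suc k\<close> by (simp only: diffs_divisible_def)
      thus ?thesis by (simp only: Suc fwd_diff_Suc') simp
    qed simp
  qed
qed

section \<open>Difference coefficients of the Gamma function\<close>

text \<open>Restricting to one residue class modulo \<open>p\<close> makes \<open>p\<close>
  consecutive functional equations multiply to a polynomial in \<open>p x\<close>: just one of the
  arguments is divisible by \<open>p\<close>, and it always contributes \<open>- 1\<close>. With
  negated arguments the differences at \<open>0\<close> satisfy the recursion of Dwork's
  coefficients.\<close>

definition gamma_ap :: "nat \<Rightarrow> nat \<Rightarrow> 'p::prime_card padic_int" where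
  "gamma_ap a x = Gamma_p (- of_nat (a + CARD('p) * x))"

definition gamma_diff :: "nat \<Rightarrow> nat \<Rightarrow> 'p::prime_card padic_int" where
  "gamma_diff a k = (fwd_diff ^^ k) (gamma_ap a) 0"

lemma Gamma_p_add_nat:
  assumes "CARD('p::prime_card) \<noteq> 2"
  shows "Gamma_p (y + of_nat n) = (\<Prod>i<n. Gamma_p_factor (y + of_nat i)) * Gamma_p (y :: 'p padic_int)"
proof (induction n)
  case (Suc n)
  have "Gamma_p (y + of_nat (Suc n)) = Gamma_p_factor (y + of_nat n) * Gamma_p (y + of_nat n)"
    using Gamma_p_plus1[OF assms, of "y + of_nat n"] by (simp add: add_ac)
  thus ?case using Suc by (simp add: mult_ac)
qed simp

lemma p_dvd_of_nat_iff: "of_nat CARD('p) dvd (of_nat k :: 'p::prime_card padic_int) \<longleftrightarrow> CARD('p) dvd k"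
  using power_dvd_of_nat_iff[of 1 k, where 'p='p] by simp

lemma p_dvd_of_int_iff: "of_nat CARD('p) dvd (of_int k :: 'p::prime_card padic_int) \<longleftrightarrow> int CARD('p) dvd k"
  using power_dvd_of_int_iff[of 1 k, where 'p='p] by simp

lemma gamma_ap_functional_eq:
  assumes p: "CARD('p::prime_card) \<noteq> 2" and a: "a < CARD('p)"
  shows "gamma_ap a x = - ((\<Prod>i\<in>{..<CARD('p)} - {a}. (of_nat (a + CARD('p)) - of_nat i) + of_nat CARD('p) * of_nat x)
    * (gamma_ap a (Suc x) :: 'p padic_int))"
proof -
  let ?p = "CARD('p)"
  define y where "y = (- of_nat (a + ?p * Suc x) :: 'p padic_int)"
  have y: "y + of_nat i = of_int (int i - int (a + ?p * Suc x))" for i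
    by (simp add: y_def)
  have dvd: "of_nat ?p dvd y + of_nat i \<longleftrightarrow> i = a" if "i < ?p" for i
  proof -
    have "int ?p dvd int i - int (a + ?p * Suc x) \<longleftrightarrow> int ?p dvd (int i - int a) - int ?p * (1 + int x)"
      by (simp add: algebra_simps)
    also have "\<dots> \<longleftrightarrow> int ?p dvd int i - int a" by (simp add: dvd_diff_right_iff dvd_diff_left_iff)
    also have "\<dots> \<longleftrightarrow> [int i = int a] (mod int ?p)" by (simp add: cong_iff_dvd_diff)
    also have "\<dots> \<longleftrightarrow> i = a" using that a by (auto simp: cong_def)
    finally show ?thesis unfolding y p_dvd_of_int_iff .
  qed
  have "gamma_ap a x = Gamma_p (y + of_nat ?p)"
    by (simp add: gamma_ap_def y_def algebra_simps)
  also have "\<dots> = (\<Prod>i<?p. Gamma_p_factor (y + of_nat i)) * Gamma_p y"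
    by (rule Gamma_p_add_nat[OF p])
  also have "(\<Prod>i<?p. Gamma_p_factor (y + of_nat i))
      = Gamma_p_factor (y + of_nat a) * (\<Prod>i\<in>{..<?p} - {a}. Gamma_p_factor (y + of_nat i))"
    using a by (intro prod.remove) auto
  also have "Gamma_p_factor (y + of_nat a) = -1"
    using dvd[OF a] by (simp add: Gamma_p_factor_def)
  also have "(\<Prod>i\<in>{..<?p} - {a}. Gamma_p_factor (y + of_nat i))
      = (\<Prod>i\<in>{..<?p} - {a}. (of_nat (a + ?p) - of_nat i) + of_nat ?p * of_nat x)"
    using dvd by (intro prod.cong refl) (auto simp: Gamma_p_factor_def y_def algebra_simps)
  also have "Gamma_p y = gamma_ap a (Suc x)"
    by (simp add: gamma_ap_def y_def)
  finally show ?thesis by simp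
qed

lemma gamma_diff_divisible:
  assumes p: "CARD('p::prime_card) \<noteq> 2" and a: "a < CARD('p)"
  shows "of_nat CARD('p) ^ ((k + 1) div 2) dvd (gamma_diff a k :: 'p padic_int)"
proof -
  let ?P = "of_nat CARD('p) :: 'p padic_int"
  let ?C = "\<Prod>i\<in>{..<CARD('p)} - {a}. of_nat (a + CARD('p)) - of_nat i :: 'p padic_int"
  \<comment> \<open>The hypothesis on the constant term is Wilson's congruence. It is read off from
    \<open>Gamma_p\<close> itself: \<open>- ?C\<close> is the quotient of two of its values, which
    are units congruent modulo \<open>p\<close>.\<close>
  have "?P ^ 1 dvd Gamma_p (- of_nat (a + CARD('p) * 0)) - Gamma_p (- of_nat (a + CARD('p) * Suc 0))"
    by (intro Gamma_p_cong[OF p]) simp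
  hence "?P dvd gamma_ap a 0 - gamma_ap a (Suc 0)"
    by (simp add: gamma_ap_def)
  also have "gamma_ap a 0 = - (?C * gamma_ap a (Suc 0))"
    using gamma_ap_functional_eq[OF p a, of 0] by simp
  also have "- (?C * gamma_ap a (Suc 0)) - gamma_ap a (Suc 0) = (- ?C - 1) * gamma_ap a (Suc 0)"
    by (simp add: algebra_simps)
  finally have "?P dvd - ?C - 1"
    using Gamma_p_unit[OF p] by (simp add: prime_elem_dvd_mult_iff[OF prime_elem_p_padic] gamma_ap_def)
  with finite_Diff[OF finite_lessThan] gamma_ap_functional_eq[OF p a]
  have "diffs_divisible ?P 1 k (gamma_ap a)"
    by (rule diffs_divisible_functional_eq)
  thus ?thesis by (simp add: diffs_divisible_def gamma_diff_def)
qed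

text \<open>The functional equation from the class of \<open>- (a + 1)\<close> to that of
  \<open>- a\<close> multiplies by \<open>a + 1 + p x\<close>, to which the Leibniz rule applies.
  Together with \<open>gamma_diff_0_Suc\<close>, where the argument is divisible by
  \<open>p\<close>, this matches \<open>dwork_coeff_rec\<close> after scaling by
  \<open>(- p) ^ k k!\<close>.\<close>

lemma gamma_diff_Suc_Suc:
  assumes p: "CARD('p::prime_card) \<noteq> 2" and a: "Suc a < CARD('p)"
  shows "(gamma_diff a k :: 'p padic_int) = of_nat (Suc a + CARD('p) * k) * gamma_diff (Suc a) k
    + of_nat (CARD('p) * k) * gamma_diff (Suc a) (k - 1)"
proof -
  let ?p = "CARD('p)" and ?h = "gamma_ap (Suc a) :: nat \<Rightarrow> 'p padic_int"
  have h: "(gamma_ap a x :: 'p padic_int) = of_nat (Suc a) * ?h x + of_nat ?p * (of_nat x * ?h x)" for x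
  proof -
    have "\<not> ?p dvd Suc a + ?p * x"
    proof
      assume "?p dvd Suc a + ?p * x"
      hence "?p dvd Suc a" by (simp only: dvd_add_left_iff dvd_triv_left)
      with a show False by (auto dest: dvd_imp_le)
    qed
    hence "\<not> of_nat ?p dvd (- of_nat (Suc a + ?p * x) :: 'p padic_int)"
      by (simp only: dvd_minus_iff p_dvd_of_nat_iff) simp
    hence "Gamma_p (- of_nat (Suc a + ?p * x) + 1 :: 'p padic_int)
        = of_nat (Suc a + ?p * x) * Gamma_p (- of_nat (Suc a + ?p * x))"
      using Gamma_p_plus1[OF p] by (simp only: Gamma_p_factor_def if_False minus_minus)
    moreover have "- of_nat (Suc a + ?p * x) + 1 = (- of_nat (a + ?p * x) :: 'p padic_int)" by simp
    ultimately show ?thesis by (simp only: gamma_ap_def of_nat_add of_nat_mult distrib_right mult.assoc)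
  qed
  have "(gamma_diff a k :: 'p padic_int) = (fwd_diff ^^ k) (\<lambda>x. of_nat (Suc a) * ?h x + of_nat ?p * (of_nat x * ?h x)) 0"
    unfolding gamma_diff_def by (simp only: h[symmetric])
  also have "\<dots> = of_nat (Suc a) * gamma_diff (Suc a) k + of_nat ?p * (of_nat k * (fwd_diff ^^ (k - 1)) ?h (Suc 0))"
    by (simp add: fwd_diff_add fwd_diff_scale fwd_diff_times_id gamma_diff_def del: of_nat_Suc)
  also have "of_nat k * (fwd_diff ^^ (k - 1)) ?h (Suc 0) = of_nat k * (gamma_diff (Suc a) k + gamma_diff (Suc a) (k - 1))"
  proof (cases k)
    case (Suc j)
    thus ?thesis using fwd_diff_Suc[of j ?h 0] by (simp add: gamma_diff_def del: funpow.simps)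
  qed simp
  finally show ?thesis by (simp add: algebra_simps)
qed

lemma gamma_diff_0_Suc:
  assumes p: "CARD('p::prime_card) \<noteq> 2"
  shows "(gamma_diff 0 (Suc k) :: 'p padic_int) = - gamma_diff (CARD('p) - 1) k - gamma_diff 0 k"
proof -
  let ?p = "CARD('p)"
  have p0: "?p > 0" by simp
  have h: "(gamma_ap 0 (Suc x) :: 'p padic_int) = - gamma_ap (?p - 1) x" for x
  proof -
    have "of_nat ?p dvd (- of_nat (?p * Suc x) :: 'p padic_int)"
      by (simp only: dvd_minus_iff p_dvd_of_nat_iff) simp
    hence "Gamma_p (- of_nat (?p * Suc x) + 1 :: 'p padic_int) = - Gamma_p (- of_nat (?p * Suc x))"
      using Gamma_p_plus1[OF p] by (simp only: Gamma_p_factor_def if_True) simp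
    moreover have "- of_nat (?p * Suc x) + 1 = (- of_nat ((?p - 1) + ?p * x) :: 'p padic_int)"
      using p0 by (simp only: of_nat_add of_nat_diff[of 1 ?p] Suc_le_eq One_nat_def) (simp add: algebra_simps)
    ultimately show ?thesis by (simp add: gamma_ap_def)
  qed
  have "(fwd_diff ^^ k) (gamma_ap 0) (Suc 0) = (fwd_diff ^^ k) (\<lambda>x. gamma_ap 0 (Suc x) :: 'p padic_int) 0"
    by (simp only: fwd_diff_shift)
  also have "\<dots> = - gamma_diff (?p - 1) k"
    by (simp only: h fwd_diff_uminus gamma_diff_def)
  finally show ?thesis by (simp only: gamma_diff_def fwd_diff_Suc)
qed

lemma gamma_diff_0_0: "CARD('p::prime_card) \<noteq> 2 \<Longrightarrow> (gamma_diff 0 0 :: 'p padic_int) = 1"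
  by (simp add: gamma_diff_def gamma_ap_def Gamma_p_0)

section \<open>Dwork's series\<close>

definition dwork_arg :: "'p::prime_card padic fps" where
  "dwork_arg = fps_X + fps_const (1 / of_nat CARD('p)) * fps_X ^ CARD('p)"

text \<open>The power \<open>C ^ s\<close> of Dwork's series, so that adding parameters multiplies
  series. If \<open>x ^ p = x\<close>, then \<open>dwork x\<close> is also \<open>C\<close> with its
  variable scaled by \<open>x\<close>; the interplay of both readings carries the evaluation of
  Jacobi sums.\<close>

definition dwork :: "'p::prime_card padic \<Rightarrow> 'p padic fps" where
  "dwork s = fps_exp s oo dwork_arg"

lemma dwork_arg_0 [simp]: "fps_nth dwork_arg 0 = 0"
  by (simp add: dwork_arg_def)

lemma dwork_add: "dwork (s + t) = dwork s * dwork t"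
  by (simp add: dwork_def fps_exp_add_mult fps_compose_mult_distrib)

lemma fps_deriv_dwork_arg: "fps_deriv (dwork_arg :: 'p::prime_card padic fps) = 1 + fps_X ^ (CARD('p) - 1)"
  by (simp add: dwork_arg_def fps_deriv_power fps_of_nat flip: mult.assoc fps_const_mult)
    (simp flip: fps_of_nat)

lemma dwork_deriv:
  "fps_deriv (dwork s) = fps_const s * (1 + fps_X ^ (CARD('p) - 1)) * dwork (s :: 'p::prime_card padic)"
  by (simp add: dwork_def fps_compose_deriv fps_deriv_dwork_arg fps_const_mult_apply_left[symmetric] mult_ac)

definition dwork_coeff :: "nat \<Rightarrow> 'p::prime_card padic" where
  "dwork_coeff n = fps_nth (dwork 1) n"

lemma dwork_coeff_0 [simp]: "dwork_coeff 0 = 1"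
  by (simp add: dwork_coeff_def dwork_def)

lemma dwork_coeff_rec:
  assumes "n > 0"
  shows "of_nat n * (dwork_coeff n :: 'p::prime_card padic) =
    dwork_coeff (n - 1) + (if n \<ge> CARD('p) then dwork_coeff (n - CARD('p)) else 0)"
proof -
  obtain m where m: "n = Suc m" using assms by (cases n) auto
  have p0: "CARD('p) > 0" by simp
  have "fps_nth (fps_deriv (dwork 1 :: 'p padic fps)) m = fps_nth (dwork 1 * (1 + fps_X ^ (CARD('p) - 1))) m"
    by (simp add: dwork_deriv mult.commute)
  hence "of_nat n * (dwork_coeff n :: 'p padic) = dwork_coeff m + 
      (if m < CARD('p) - 1 then 0 else dwork_coeff (m - (CARD('p) - 1)))"
    by (simp add: dwork_coeff_def m distrib_left fps_X_power_mult_right_nth)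
  thus ?thesis using p0 m by (auto simp: not_less)
qed

text \<open>The equation \<open>C' = (1 + x ^ (p - 1)) C\<close> gives
  \<open>n c n = c (n - 1) + c (n - p)\<close>. For \<open>a > 0\<close> the predecessor of degree
  \<open>a + k p\<close> lies in the same row \<open>k\<close>; for \<open>a = 0\<close> it is the
  last entry \<open>p - 1\<close> of the preceding row.\<close>

lemma dwork_coeff_gamma_diff:
  assumes p: "CARD('p::prime_card) \<noteq> 2" and "a < CARD('p)"
  shows "(- of_nat CARD('p)) ^ k * fact k * (dwork_coeff (a + k * CARD('p)) :: 'p padic)
    = padic_of_int (gamma_diff a k)"
  using assms(2)
proof (induction "a + k * CARD('p)" arbitrary: a k rule: less_induct)
  case less
  let ?p = "CARD('p)" and ?c = "dwork_coeff :: nat \<Rightarrow> 'p padic"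
  let ?D = "\<lambda>a k. padic_of_int (gamma_diff a k) :: 'p padic"
  let ?m = "\<lambda>k. (- of_nat ?p) ^ k * fact k :: 'p padic"
  have p0: "?p > 0" by simp
  show ?case
  proof (cases a)
    case (Suc b)
    have n: "a + k * ?p > 0" using Suc by simp
    have IH1: "?m k * ?c (b + k * ?p) = ?D b k"
      using Suc less.prems by (intro less.hyps) auto
    have "?m k * (if a + k * ?p \<ge> ?p then ?c (a + k * ?p - ?p) else 0) = (- of_nat ?p) * of_nat k * ?D a (k - 1)"
    proof (cases k)
      case 0
      thus ?thesis using less.prems by simp
    next
      case (Suc j)
      have "?m j * ?c (a + j * ?p) = ?D a j"
        using Suc less.prems p0 by (intro less.hyps) auto
      thus ?thesis using Suc by (simp add: mult_ac)
    qed
    hence "?m k * (of_nat (a + k * ?p) * ?c (a + k * ?p)) = ?D b k - of_nat ?p * of_nat k * ?D a (k - 1)"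
      unfolding dwork_coeff_rec[OF n] distrib_left using IH1 Suc by simp
    also have "\<dots> = of_nat (a + k * ?p) * ?D a k"
      using gamma_diff_Suc_Suc[OF p, of b k] Suc less.prems
      by (simp add: padic_of_int_hom mult_ac)
    finally have "of_nat (a + k * ?p) * (?m k * ?c (a + k * ?p)) = of_nat (a + k * ?p) * ?D a k"
      by (simp only: mult_ac)
    thus ?thesis using n by (subst (asm) mult_left_cancel) (simp_all del: of_nat_add)
  next
    case 0
    note a = this
    show ?thesis
    proof (cases k)
      case 0
      thus ?thesis using a gamma_diff_0_0[OF p] by (simp add: padic_of_int_hom)
    next
      case (Suc j)
      have n: "k * ?p > 0" using Suc p0 by simp
      have e1: "k * ?p - 1 = (?p - 1) + j * ?p" and e2: "k * ?p - ?p = 0 + j * ?p" and e3: "k * ?p \<ge> ?p"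
        using Suc p0 by auto
      have IH1: "?m j * ?c ((?p - 1) + j * ?p) = ?D (?p - 1) j"
        using Suc a p0 by (intro less.hyps) auto
      have IH2: "?m j * ?c (0 + j * ?p) = ?D 0 j"
        using Suc a p0 by (intro less.hyps) auto
      have m: "?m k = (- of_nat ?p) * of_nat k * ?m j" using Suc by (simp add: mult_ac)
      have "?m k * (of_nat (k * ?p) * ?c (k * ?p)) = (- of_nat ?p) * of_nat k * (?m j * ?c ((?p - 1) + j * ?p) + ?m j * ?c (0 + j * ?p))"
        unfolding dwork_coeff_rec[OF n] e1 e2 if_P[OF e3] m by (simp only: distrib_left mult.assoc)
      also have "\<dots> = of_nat (k * ?p) * (- ?D (?p - 1) j - ?D 0 j)"
        unfolding IH1 IH2 by (simp add: algebra_simps)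
      also have "- ?D (?p - 1) j - ?D 0 j = ?D 0 k"
        unfolding Suc gamma_diff_0_Suc[OF p] padic_of_int_simps by simp
      finally have "of_nat (k * ?p) * (?m k * ?c (k * ?p)) = of_nat (k * ?p) * ?D 0 k"
        by (simp only: mult_ac)
      thus ?thesis using n a by (subst (asm) mult_left_cancel) (simp_all del: of_nat_mult)
    qed
  qed
qed

text \<open>The growth condition is weaker than integrality and stronger than convergence on the disc
  \<open>x ^ (p - 1) = - p\<close>; being given by a superadditive exponent it is preserved by products.\<close>

definition growth_exp :: "nat \<Rightarrow> nat \<Rightarrow> nat" where
  "growth_exp p n = 3 * (n div p) div 4"

definition growth_bounded :: "'p::prime_card padic fps \<Rightarrow> bool" where
  "growth_bounded F \<longleftrightarrow> (\<forall>n. of_nat CARD('p) ^ growth_exp CARD('p) n * fps_nth F n \<in> padic_ball 0)"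

lemma growth_exp_add: "growth_exp p m + growth_exp p n \<le> growth_exp p (m + n)"
proof -
  have add: "x div d + y div d \<le> (x + y) div d" for x y d :: nat
    by (metis div_add1_eq le_add1)
  have "3 * (m div p) div 4 + 3 * (n div p) div 4 \<le> (3 * (m div p) + 3 * (n div p)) div 4"
    by (rule add)
  also have "\<dots> \<le> 3 * ((m + n) div p) div 4"
    using add[of m p n] by (intro div_le_mono) simp
  finally show ?thesis by (simp add: growth_exp_def)
qed

lemma growth_bounded_mult:
  assumes "growth_bounded F" "growth_bounded G"
  shows "growth_bounded (F * G :: 'p::prime_card padic fps)"
  unfolding growth_bounded_def
proof
  fix n
  let ?P = "of_nat CARD('p) :: 'p padic" and ?f = "growth_exp CARD('p)"
  have "?P ^ ?f n * (fps_nth F i * fps_nth G (n - i)) \<in> padic_ball 0" if "i \<le> n" for i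
  proof -
    have le: "?f i + ?f (n - i) \<le> ?f n" using growth_exp_add[of "CARD('p)" i "n - i"] that by simp
    have "?P ^ ?f n = ?P ^ (?f n - (?f i + ?f (n - i))) * (?P ^ ?f i * ?P ^ ?f (n - i))"
      using le by (simp flip: power_add)
    hence "?P ^ ?f n * (fps_nth F i * fps_nth G (n - i))
        = ?P ^ (?f n - (?f i + ?f (n - i))) * ((?P ^ ?f i * fps_nth F i) * (?P ^ ?f (n - i) * fps_nth G (n - i)))"
      by (simp only: mult_ac)
    also have "\<dots> \<in> padic_ball 0"
      using assms unfolding growth_bounded_def
      by (intro padic_ball_mult_left[OF padic_ball_power[OF of_nat_padic_ball0] padic_ball_mult_left]) blast+
    finally show ?thesis .
  qed
  thus "?P ^ ?f n * fps_nth (F * G) n \<in> padic_ball 0"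
    unfolding fps_mult_nth sum_distrib_left by (intro padic_ball_sum) auto
qed

text \<open>This is the origin of the fraction \<open>3 / 4\<close> in \<open>growth_exp\<close>. In
  degree \<open>a + k p\<close> the denominator \<open>p ^ k k!\<close> costs at most
  \<open>k + k div 4\<close> powers of \<open>p\<close>, and the difference of
  \<open>Gamma_p\<close> in the numerator returns \<open>(k + 1) div 2\<close> of them.\<close>

lemma growth_bounded_dwork:
  assumes p: "CARD('p::prime_card) > 3"
  shows "growth_bounded (dwork 1 :: 'p padic fps)"
  unfolding growth_bounded_def
proof
  fix n
  let ?P = "of_nat CARD('p) :: 'p padic"
  define k a where "k = n div CARD('p)" and "a = n mod CARD('p)"
  have a: "a < CARD('p)" and n: "n = a + k * CARD('p)"
    by (simp_all add: a_def k_def)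
  have p2: "CARD('p) \<noteq> 2" using p by simp
  obtain w where w: "gamma_diff a k = (of_nat CARD('p) ^ ((k + 1) div 2) * w :: 'p padic_int)"
    using gamma_diff_divisible[OF p2 a, of k] by (elim dvdE)
  define f where "f = growth_exp CARD('p) n"
  have f: "f + (k + 1) div 2 = k + k div 4 + (f + (k + 1) div 2 - (k + k div 4))"
  proof -
    define q r where "q = k div 4" and "r = k mod 4"
    have "k = 4 * q + r" "r < 4" by (simp_all add: q_def r_def)
    moreover from this have "r = 0 \<or> r = 1 \<or> r = 2 \<or> r = 3" by linarith
    ultimately have "k + k div 4 \<le> 3 * k div 4 + (k + 1) div 2" by (elim disjE) simp_all
    thus ?thesis by (simp add: f_def growth_exp_def k_def)
  qed
  define e where "e = f + (k + 1) div 2 - (k + k div 4)"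
  define c where "c = (fps_nth (dwork 1) n :: 'p padic)"
  have sgn: "(-1) ^ k * ((-1) ^ k * x) = x" for x :: "'p padic"
    by (simp add: flip: mult.assoc power_mult_distrib)
  have "((-1) ^ k * ?P ^ k) * fact k * c = padic_of_int (gamma_diff a k)"
    using dwork_coeff_gamma_diff[OF p2 a, of k]
    by (simp only: dwork_coeff_def n c_def power_minus[of ?P])
  hence "(-1) ^ k * ((-1) ^ k * (?P ^ k * (fact k * c))) = (-1) ^ k * padic_of_int (gamma_diff a k)"
    by (simp only: mult.assoc)
  hence "?P ^ k * (fact k * c) = (-1) ^ k * (padic_of_int w * ?P ^ ((k + 1) div 2))"
    by (simp only: sgn w padic_of_int_hom mult.commute)
  hence "?P ^ f * (?P ^ k * (fact k * c)) = (-1) ^ k * padic_of_int w * ?P ^ (f + (k + 1) div 2)"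
    by (simp only: power_add mult_ac)
  also have "?P ^ (f + (k + 1) div 2) = ?P ^ (k + k div 4 + e)"
    unfolding e_def by (subst f) (rule refl)
  also have "(-1) ^ k * padic_of_int w * \<dots> = ?P ^ k * ((-1) ^ k * padic_of_int w * ?P ^ e * ?P ^ (k div 4))"
    by (simp only: power_add mult_ac)
  finally have "?P ^ k * (?P ^ f * (fact k * c)) = ?P ^ k * ((-1) ^ k * padic_of_int w * ?P ^ e * ?P ^ (k div 4))"
    by (simp only: mult.left_commute[of "?P ^ f"])
  hence "fact k * (?P ^ f * c) = (-1) ^ k * padic_of_int w * ?P ^ e * ?P ^ (k div 4)"
    by (subst (asm) mult_left_cancel) (simp_all only: power_eq_0_iff of_nat_eq_0_iff mult.left_commute, simp)
  hence "?P ^ f * c = (-1) ^ k * padic_of_int w * ?P ^ e * ?P ^ (k div 4) / fact k"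
    by (subst eq_divide_eq) (simp_all only: mult.commute fact_nonzero, simp)
  also have "\<dots> = ((-1) ^ k * padic_of_int w * ?P ^ e) * (?P ^ (k div 4) / fact k)"
    by (simp only: times_divide_eq_right)
  also have "\<dots> \<in> padic_ball 0"
  proof (rule padic_ball_mult_left[OF _ fact_padic_bound[OF p]])
    show "(-1) ^ k * padic_of_int w * ?P ^ e \<in> padic_ball 0"
      by (rule padic_ball_mult_left[OF padic_ball_mult_left]; (rule padic_ball_power)?) simp_all
  qed
  finally show "?P ^ growth_exp CARD('p) n * fps_nth (dwork 1) n \<in> padic_ball 0"
    by (simp only: f_def c_def)
qed

section \<open>Evaluation at the roots of \<open>x ^ (p - 1) = - p\<close>\<close>

definition padic_lim :: "(nat \<Rightarrow> 'p::prime_card padic) \<Rightarrow> 'p padic \<Rightarrow> bool" where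
  "padic_lim s L \<longleftrightarrow> (\<forall>n. eventually (\<lambda>J. s J - L \<in> padic_ball n) sequentially)"

lemma padic_lim_unique:
  assumes "padic_lim s L" "padic_lim s M"
  shows "L = M"
proof (rule padic_eqI)
  fix n
  have "eventually (\<lambda>J. s J - L \<in> padic_ball n \<and> s J - M \<in> padic_ball n) sequentially"
    using assms by (auto simp: padic_lim_def intro: eventually_conj)
  then obtain J where J: "s J - L \<in> padic_ball n" "s J - M \<in> padic_ball n"
    using eventually_happens'[OF trivial_limit_sequentially] by blast
  from padic_ball_diff[OF J(2) J(1)] show "L - M \<in> padic_ball n" by simp
qed

lemma padic_lim_const: "padic_lim (\<lambda>_. L) L"
  by (simp add: padic_lim_def)

lemma padic_lim_add:
  assumes "padic_lim s L" "padic_lim t M"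
  shows "padic_lim (\<lambda>J. s J + t J) (L + M)"
  unfolding padic_lim_def
proof
  fix n
  from assms have "eventually (\<lambda>J. s J - L \<in> padic_ball n) sequentially"
    "eventually (\<lambda>J. t J - M \<in> padic_ball n) sequentially" by (auto simp: padic_lim_def)
  thus "eventually (\<lambda>J. s J + t J - (L + M) \<in> padic_ball n) sequentially"
  proof eventually_elim
    case (elim J)
    from padic_ball_add[OF this] show ?case by (simp add: algebra_simps)
  qed
qed

lemma padic_lim_sum:
  "(\<And>i. i \<in> A \<Longrightarrow> padic_lim (s i) (L i)) \<Longrightarrow> padic_lim (\<lambda>J. \<Sum>i\<in>A. s i J) (\<Sum>i\<in>A. L i)"
  by (induction A rule: infinite_finite_induct) (auto intro: padic_lim_add padic_lim_const)

lemma padic_lim_integral: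
  assumes "padic_lim s L" "\<And>J. s J \<in> padic_ball 0"
  shows "L \<in> padic_ball 0"
proof -
  have "eventually (\<lambda>J. s J - L \<in> padic_ball 0) sequentially"
    using assms by (auto simp: padic_lim_def)
  then obtain J where J: "s J - L \<in> padic_ball 0"
    using eventually_happens'[OF trivial_limit_sequentially] by blast
  from padic_ball_diff[OF assms(2)[of J] J] show ?thesis by simp
qed

lemma padic_lim_mult:
  assumes s: "padic_lim s L" "\<And>J. s J \<in> padic_ball 0" and t: "padic_lim t M" "\<And>J. t J \<in> padic_ball 0"
  shows "padic_lim (\<lambda>J. s J * t J) (L * M)"
  unfolding padic_lim_def
proof
  fix n
  have L: "L \<in> padic_ball 0" using padic_lim_integral[OF s] .
  from s t have "eventually (\<lambda>J. s J - L \<in> padic_ball n) sequentially"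
    "eventually (\<lambda>J. t J - M \<in> padic_ball n) sequentially" by (auto simp: padic_lim_def)
  thus "eventually (\<lambda>J. s J * t J - L * M \<in> padic_ball n) sequentially"
  proof eventually_elim
    case (elim J)
    have "(s J - L) * t J + L * (t J - M) \<in> padic_ball n"
      using elim L t(2) by (intro padic_ball_add padic_ball_mult_right padic_ball_mult_left)
    thus ?case by (simp add: algebra_simps)
  qed
qed

lemma padic_lim_scale:
  assumes "padic_lim s L" "c \<in> padic_ball 0"
  shows "padic_lim (\<lambda>J. c * s J) (c * L)"
  unfolding padic_lim_def
proof
  fix n
  from assms have "eventually (\<lambda>J. s J - L \<in> padic_ball n) sequentially" by (auto simp: padic_lim_def)
  thus "eventually (\<lambda>J. c * s J - c * L \<in> padic_ball n) sequentially"
  proof eventually_elim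
    case (elim J)
    from padic_ball_mult_left[OF assms(2) this] show ?case by (simp add: right_diff_distrib)
  qed
qed

lemma padic_lim_0I:
  assumes "\<And>J. s J \<in> padic_ball (J div 4)"
  shows "padic_lim s 0"
  unfolding padic_lim_def
proof
  fix n
  show "eventually (\<lambda>J. s J - 0 \<in> padic_ball n) sequentially"
    using eventually_ge_at_top[of "4 * n"]
  proof eventually_elim
    case (elim J)
    hence "n \<le> J div 4" by simp
    with assms[of J] show ?case by (simp add: padic_ball_mono)
  qed
qed

lemma padic_lim_transfer:
  assumes "padic_lim s L" "padic_lim (\<lambda>J. t J - s J) 0"
  shows "padic_lim t L"
  using padic_lim_add[OF assms] by simp

lemma neg_p_power: "(- of_nat CARD('p)) ^ n = (-1) ^ n * (of_nat CARD('p) ^ n :: 'p::prime_card padic)"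
  by (rule power_minus)

lemma p_power_ball_decomp:
  assumes "of_nat CARD('p) ^ m * (x :: 'p::prime_card padic) \<in> padic_ball 0" "m + n \<le> k"
  shows "x * (- of_nat CARD('p)) ^ k \<in> padic_ball n"
proof -
  have k: "k = m + (k - m)" using assms(2) by simp
  have "x * (- of_nat CARD('p)) ^ k = ((-1) ^ k * (of_nat CARD('p) ^ m * x)) * of_nat CARD('p) ^ (k - m)"
    unfolding neg_p_power by (subst (2) k) (simp only: power_add mult_ac)
  also have "\<dots> \<in> padic_ball (0 + (k - m))"
    by (intro padic_ball_mult p_power_padic_ball padic_ball_mult_left[OF padic_ball_power] assms(1)) simp
  finally show ?thesis by (rule padic_ball_mono) (use assms(2) in simp)
qed

text \<open>Up to this degree a coefficient loses at most \<open>3 j div 4\<close> powers of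
  \<open>p\<close>, while the accompanying \<open>(- p) ^ j\<close> supplies \<open>j\<close>. What
  remains is the rate \<open>j div 4\<close> at which the cut-off errors tend to zero.\<close>

lemma growth_exp_bound: "n \<le> j * p + (p - 1) \<Longrightarrow> p > 0 \<Longrightarrow> growth_exp p n + j div 4 \<le> j"
proof -
  assume n: "n \<le> j * p + (p - 1)" and p: "p > 0"
  have "n div p \<le> (j * p + (p - 1)) div p" using n by (rule div_le_mono)
  also have "j * p + (p - 1) = (p - 1) + j * p" by (rule add.commute)
  also have "\<dots> div p = j" using p by (subst div_mult_self1) simp_all
  finally have "n div p \<le> j" .
  hence "growth_exp p n \<le> 3 * j div 4" unfolding growth_exp_def by (intro div_le_mono) simp
  moreover have "3 * j div 4 + j div 4 \<le> j"
  proof -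
    have "4 * (3 * j div 4) \<le> 3 * j" "4 * (j div 4) \<le> j" by simp_all
    thus ?thesis by linarith
  qed
  ultimately show ?thesis by linarith
qed

lemma growth_bounded_term:
  assumes "growth_bounded (F :: 'p::prime_card padic fps)" "n \<le> j * CARD('p) + (CARD('p) - 1)"
  shows "fps_nth F n * (- of_nat CARD('p)) ^ j \<in> padic_ball (j div 4)"
  using assms growth_exp_bound[OF assms(2)]
  by (intro p_power_ball_decomp[of "growth_exp CARD('p) n"]) (auto simp: growth_bounded_def)

text \<open>
  If \<open>\<pi> ^ (p - 1) = - p\<close>, then \<open>\<pi> ^ r * lam r J F\<close> is a partial sum of the terms of \<open>F \<pi>\<close> whose
  degree is \<open>r\<close> modulo \<open>p - 1\<close>.  Working with these components makes it unnecessary to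
  adjoin \<open>\<pi>\<close> to the \<open>p\<close>-adic numbers.
\<close>

definition lam :: "nat \<Rightarrow> nat \<Rightarrow> 'p::prime_card padic fps \<Rightarrow> 'p padic" where
  "lam r J F = (\<Sum>j<J. fps_nth F (r + j * (CARD('p) - 1)) * (- of_nat CARD('p)) ^ j)"

lemma lam_index_bound: "r < p - 1 \<Longrightarrow> r + j * (p - 1) \<le> j * p + (p - 1 :: nat)"
  by (simp add: algebra_simps diff_mult_distrib2)

lemma lam_ball:
  assumes "growth_bounded F" "r < CARD('p) - 1"
  shows "lam r J (F :: 'p::prime_card padic fps) \<in> padic_ball 0"
  unfolding lam_def
proof (rule padic_ball_sum)
  fix j
  have "fps_nth F (r + j * (CARD('p) - 1)) * (- of_nat CARD('p)) ^ j \<in> padic_ball (j div 4)"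
    using lam_index_bound[OF assms(2)] by (intro growth_bounded_term assms)
  thus "fps_nth F (r + j * (CARD('p) - 1)) * (- of_nat CARD('p)) ^ j \<in> padic_ball 0"
    by (rule padic_ball_mono) simp
qed

lemma sum_residue_class:
  fixes q :: nat
  assumes "r < q"
  shows "(\<Sum>j<J. f (r + j * q)) = (\<Sum>n | n < J * q \<and> n mod q = r. f n)"
proof (rule sum.reindex_bij_witness[where i = "\<lambda>n. n div q" and j = "\<lambda>j. r + j * q"])
  fix j assume "j \<in> {..<J}"
  hence "Suc j * q \<le> J * q" by (intro mult_le_mono) auto
  thus "r + j * q \<in> {n. n < J * q \<and> n mod q = r}" using assms by simp
next
  fix n assume n: "n \<in> {n. n < J * q \<and> n mod q = r}"
  thus "n div q \<in> {..<J}" by (simp add: less_mult_imp_div_less)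
  show "r + n div q * q = n" using n by (auto simp: mod_div_mult_eq)
qed (use assms in auto)

lemma lam_alt:
  assumes "r < CARD('p) - 1"
  shows "lam r J (F :: 'p::prime_card padic fps) =
    (\<Sum>n | n < J * (CARD('p) - 1) \<and> n mod (CARD('p) - 1) = r.
      fps_nth F n * (- of_nat CARD('p)) ^ (n div (CARD('p) - 1)))"
  using sum_residue_class[OF assms, of "\<lambda>n. fps_nth F n * (- of_nat CARD('p)) ^ (n div (CARD('p) - 1))" J] assms
  by (simp add: lam_def)

text \<open>The representative of \<open>r - i\<close> modulo \<open>q\<close>. The second case is a
  carry: there \<open>\<pi> ^ i\<close> times the complementary power is
  \<open>\<pi> ^ (r + q)\<close>, which for \<open>q = p - 1\<close> means
  \<open>- p \<pi> ^ r\<close>.\<close>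

definition conj_index :: "nat \<Rightarrow> nat \<Rightarrow> nat \<Rightarrow> nat" where
  "conj_index q r i = (if i \<le> r then r - i else r + q - i)"

lemma conj_index_less: "i < q \<Longrightarrow> r < q \<Longrightarrow> conj_index q r i < q"
  by (auto simp: conj_index_def)

lemma conj_index_add:
  assumes "i < q" "r < q" "m mod q = i" "n mod q = conj_index q r i"
  shows "(m + n) mod q = r" "(m + n) div q = m div q + n div q + (if i \<le> r then 0 else 1)"
proof -
  have m: "m = i + m div q * q" using assms(3) by (metis add.commute div_mult_mod_eq)
  have n: "n = conj_index q r i + n div q * q" using assms(4) by (metis add.commute div_mult_mod_eq)
  have ic: "i + conj_index q r i = r + (if i \<le> r then 0 else 1) * q"
    using assms by (auto simp: conj_index_def)
  have "m + n = (i + conj_index q r i) + (m div q + n div q) * q"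
    using m n by (metis (no_types, lifting) add.assoc add.left_commute distrib_right)
  also have "\<dots> = r + (m div q + n div q + (if i \<le> r then 0 else 1)) * q"
    unfolding ic by (simp add: algebra_simps)
  finally have e: "m + n = r + (m div q + n div q + (if i \<le> r then 0 else 1)) * q" .
  have q: "q > 0" using assms by simp
  show "(m + n) mod q = r" by (subst e, subst mod_mult_self1) (use assms(2) in simp)
  show "(m + n) div q = m div q + n div q + (if i \<le> r then 0 else 1)"
    by (subst e, subst div_mult_self1) (use assms(2) q in simp_all)
qed

lemma conj_index_iff:
  assumes "r < q"
  shows "(m + n) mod q = r \<longleftrightarrow> n mod q = conj_index q r (m mod q)"
proof
  assume "n mod q = conj_index q r (m mod q)"
  thus "(m + n) mod q = r" using assms by (intro conj_index_add(1)[of "m mod q"]) auto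
next
  assume mn: "(m + n) mod q = r"
  define k where "k = conj_index q r (m mod q)"
  have k: "k < q" unfolding k_def using assms by (intro conj_index_less) auto
  have "(m + k) mod q = r" using assms k by (intro conj_index_add(1)[of "m mod q"]) (auto simp: k_def)
  with mn have "[m + n = m + k] (mod q)" by (simp add: cong_def)
  hence "[n = k] (mod q)" by (simp add: cong_add_lcancel_nat)
  thus "n mod q = conj_index q r (m mod q)" using k by (simp add: cong_def k_def)
qed

text \<open>Multiplication of values at \<open>\<pi>\<close>, component by component. Both
  expressions sum the same terms, over the triangle \<open>m + n < J q\<close> and over the square
  \<open>m, n < J q\<close>; outside the triangle the total degree is at least \<open>J q\<close>,
  where superadditivity of \<open>growth_exp\<close> makes the terms small.\<close>

lemma lam_mult:
  fixes F G :: "'p::prime_card padic fps"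
  assumes F: "growth_bounded F" and G: "growth_bounded G" and r: "r < CARD('p) - 1"
  shows "lam r J (F * G) - (\<Sum>i<CARD('p) - 1. lam i J F * lam (conj_index (CARD('p) - 1) r i) J G *
    (- of_nat CARD('p)) ^ (if i \<le> r then 0 else 1)) \<in> padic_ball (J div 4)"
proof -
  let ?p = "CARD('p)"
  let ?P = "of_nat CARD('p) :: 'p padic"
  define q where "q = ?p - 1"
  have q: "q > 0" "r < q" using r by (simp_all add: q_def)
  define t where "t = (\<lambda>m n. fps_nth F m * fps_nth G n * (- ?P) ^ ((m + n) div q))"
  define Box where "Box = {(m, n). m < J * q \<and> n < J * q \<and> (m + n) mod q = r}"
  define A where "A = {(m, n). m + n < J * q \<and> (m + n) mod q = r}"
  have finBox: "finite Box"
    by (rule finite_subset[of _ "{..<J * q} \<times> {..<J * q}"]) (auto simp: Box_def)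
  have AB: "A \<subseteq> Box" by (auto simp: A_def Box_def)
  have 1: "lam r J (F * G) = (\<Sum>(m, n)\<in>A. t m n)"
  proof -
    have "lam r J (F * G) = (\<Sum>l | l < J * q \<and> l mod q = r. \<Sum>m\<le>l. t m (l - m))"
      unfolding lam_alt[OF r, folded q_def] fps_mult_nth sum_distrib_right atLeast0AtMost
      by (intro sum.cong refl) (auto simp: t_def)
    also have "\<dots> = (\<Sum>(l, m)\<in>Sigma {l. l < J * q \<and> l mod q = r} (\<lambda>l. {..l}). t m (l - m))"
      by (rule sum.Sigma) auto
    also have "\<dots> = (\<Sum>(m, n)\<in>A. t m n)"
      by (rule sum.reindex_bij_witness[where i = "\<lambda>(m, n). (m + n, m)" and j = "\<lambda>(l, m). (m, l - m)"])
        (auto simp: A_def)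
    finally show ?thesis .
  qed
  have 2: "(\<Sum>i<q. lam i J F * lam (conj_index q r i) J G * (- ?P) ^ (if i \<le> r then 0 else 1))
      = (\<Sum>(m, n)\<in>Box. t m n)"
  proof -
    have "(\<Sum>(m, n)\<in>Box. t m n) = (\<Sum>(m, n)\<in>Sigma {..<J * q} (\<lambda>m. {n. n < J * q \<and> n mod q = conj_index q r (m mod q)}). t m n)"
      using q by (intro sum.cong) (auto simp: Box_def conj_index_iff)
    also have "\<dots> = (\<Sum>m<J * q. \<Sum>n | n < J * q \<and> n mod q = conj_index q r (m mod q). t m n)"
      by (rule sum.Sigma[symmetric]) auto
    also have "\<dots> = (\<Sum>i<q. \<Sum>m | m \<in> {..<J * q} \<and> m mod q = i. \<Sum>n | n < J * q \<and> n mod q = conj_index q r (m mod q). t m n)"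
      using q by (intro sum.group[symmetric]) auto
    also have "\<dots> = (\<Sum>i<q. lam i J F * lam (conj_index q r i) J G * (- ?P) ^ (if i \<le> r then 0 else 1))"
    proof (intro sum.cong refl)
      fix i assume "i \<in> {..<q}"
      hence i: "i < q" by simp
      note c = conj_index_less[OF i q(2)]
      have "lam i J F * lam (conj_index q r i) J G * (- ?P) ^ (if i \<le> r then 0 else 1) =
        (\<Sum>m | m < J * q \<and> m mod q = i. \<Sum>n | n < J * q \<and> n mod q = conj_index q r i.
          fps_nth F m * (- ?P) ^ (m div q) * (fps_nth G n * (- ?P) ^ (n div q)) * (- ?P) ^ (if i \<le> r then 0 else 1))"
        unfolding lam_alt[OF i[unfolded q_def], folded q_def] lam_alt[OF c[unfolded q_def], folded q_def]
        by (subst sum_product) (simp only: sum_distrib_right)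
      also have "\<dots> = (\<Sum>m | m < J * q \<and> m mod q = i. \<Sum>n | n < J * q \<and> n mod q = conj_index q r i. t m n)"
      proof (intro sum.cong refl)
        fix m n assume "m \<in> {m. m < J * q \<and> m mod q = i}" "n \<in> {n. n < J * q \<and> n mod q = conj_index q r i}"
        hence "(m + n) div q = m div q + n div q + (if i \<le> r then 0 else 1)"
          using i q by (intro conj_index_add) auto
        thus "fps_nth F m * (- ?P) ^ (m div q) * (fps_nth G n * (- ?P) ^ (n div q)) * (- ?P) ^ (if i \<le> r then 0 else 1) = t m n"
          unfolding t_def by (simp only: power_add mult_ac)
      qed
      also have "\<dots> = (\<Sum>m | m \<in> {..<J * q} \<and> m mod q = i. \<Sum>n | n < J * q \<and> n mod q = conj_index q r (m mod q). t m n)"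
        by (intro sum.cong) auto
      finally show "(\<Sum>m | m \<in> {..<J * q} \<and> m mod q = i. \<Sum>n | n < J * q \<and> n mod q = conj_index q r (m mod q). t m n)
        = lam i J F * lam (conj_index q r i) J G * (- ?P) ^ (if i \<le> r then 0 else 1)" ..
    qed
    finally show ?thesis ..
  qed
  have "(\<Sum>(m, n)\<in>A. t m n) - (\<Sum>(m, n)\<in>Box. t m n) = - (\<Sum>(m, n)\<in>Box - A. t m n)"
    using sum.subset_diff[OF AB finBox, of "\<lambda>(m, n). t m n"] by simp
  also have "\<dots> \<in> padic_ball (J div 4)"
    unfolding padic_ball_uminus_iff
  proof (rule padic_ball_sum)
    fix z assume z: "z \<in> Box - A"
    obtain m n where zmn: "z = (m, n)" by (cases z)
    have mn: "z = (m, n)" "(m + n) mod q = r" "m + n \<ge> J * q"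
      using z by (auto simp: Box_def A_def zmn not_less)
    define l where "l = (m + n) div q"
    have l: "m + n = r + l * q" using mn(2) by (metis add.commute div_mult_mod_eq l_def)
    have Jl: "J \<le> l" using mn(3) q by (simp add: l_def less_eq_div_iff_mult_less_eq)
    have le: "m + n \<le> l * ?p + (?p - 1)"
      unfolding l q_def by (rule lam_index_bound[OF r])
    have "?P ^ (growth_exp ?p m + growth_exp ?p n) * (fps_nth F m * fps_nth G n)
        = (?P ^ growth_exp ?p m * fps_nth F m) * (?P ^ growth_exp ?p n * fps_nth G n)"
      by (simp only: power_add mult_ac)
    also have "\<dots> \<in> padic_ball 0"
      using F G unfolding growth_bounded_def by - (rule padic_ball_mult_left; blast)
    finally have "?P ^ (growth_exp ?p m + growth_exp ?p n) * (fps_nth F m * fps_nth G n) \<in> padic_ball 0" .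
    moreover have "growth_exp ?p m + growth_exp ?p n + l div 4 \<le> l"
      using growth_exp_add[of ?p m n] growth_exp_bound[OF le] by simp
    ultimately have "fps_nth F m * fps_nth G n * (- ?P) ^ l \<in> padic_ball (l div 4)"
      by (rule p_power_ball_decomp)
    thus "(case z of (m, n) \<Rightarrow> t m n) \<in> padic_ball (J div 4)"
      using Jl by (auto simp: mn t_def l_def[symmetric] div_le_mono intro: padic_ball_mono)
  qed
  finally show ?thesis unfolding 1 q_def[symmetric] 2 .
qed

text \<open>Equality of the values at \<open>\<pi>\<close>, stated through differences of partial
  sums so that convergence of the components need not be known beforehand.\<close>

definition lam_equiv :: "'p::prime_card padic fps \<Rightarrow> 'p padic fps \<Rightarrow> bool" where
  "lam_equiv F G \<longleftrightarrow> (\<forall>r<CARD('p) - 1. padic_lim (\<lambda>J. lam r J F - lam r J G) 0)"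

lemma lam_equiv_lim:
  fixes F G :: "'p::prime_card padic fps"
  shows "lam_equiv F G \<Longrightarrow> r < CARD('p) - 1 \<Longrightarrow> padic_lim (\<lambda>J. lam r J G) L \<Longrightarrow> padic_lim (\<lambda>J. lam r J F) L"
  by (rule padic_lim_transfer[of "\<lambda>J. lam r J G"]) (auto simp: lam_equiv_def)

lemma lam_equiv_mult:
  fixes F F' G :: "'p::prime_card padic fps"
  assumes FF: "lam_equiv F F'" and F: "growth_bounded F" "growth_bounded F'" and G: "growth_bounded G"
  shows "lam_equiv (F * G) (F' * G)"
  unfolding lam_equiv_def
proof (intro allI impI)
  fix r assume r: "r < CARD('p) - 1"
  let ?P = "of_nat CARD('p) :: 'p padic"
  define q where "q = CARD('p) - 1"
  have rq: "r < q" using r by (simp add: q_def)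
  define c where "c = (\<lambda>F J. \<Sum>i<q. lam i J F * lam (conj_index q r i) J G * (- ?P) ^ (if i \<le> r then 0 else 1))"
  have e: "padic_lim (\<lambda>J. lam r J (F * G) - c F J) 0" if "growth_bounded F" for F
    unfolding c_def q_def by (intro padic_lim_0I lam_mult that G r)
  have "padic_lim (\<lambda>J. \<Sum>i<q. (lam i J F - lam i J F') * (lam (conj_index q r i) J G * (- ?P) ^ (if i \<le> r then 0 else 1))) (\<Sum>i<q. 0)"
  proof (rule padic_lim_sum)
    fix i assume "i \<in> {..<q}"
    hence i: "i < q" by simp
    have g: "lam (conj_index q r i) J G * (- ?P) ^ (if i \<le> r then 0 else 1) \<in> padic_ball 0" for J
      using conj_index_less[OF i rq] G
      by (intro padic_ball_mult_left lam_ball padic_ball_power) (auto simp: q_def)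
    have "padic_lim (\<lambda>J. lam i J F - lam i J F') 0"
      using FF i by (simp add: lam_equiv_def q_def)
    thus "padic_lim (\<lambda>J. (lam i J F - lam i J F') * (lam (conj_index q r i) J G * (- ?P) ^ (if i \<le> r then 0 else 1))) 0"
      unfolding padic_lim_def
    proof (intro allI)
      fix n
      assume "\<forall>n. eventually (\<lambda>J. lam i J F - lam i J F' - 0 \<in> padic_ball n) sequentially"
      hence "eventually (\<lambda>J. lam i J F - lam i J F' - 0 \<in> padic_ball n) sequentially" by blast
      thus "eventually (\<lambda>J. (lam i J F - lam i J F') * (lam (conj_index q r i) J G * (- ?P) ^ (if i \<le> r then 0 else 1)) - 0 \<in> padic_ball n) sequentially"
        by eventually_elim (simp only: diff_zero, rule padic_ball_mult_right[OF _ g])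
    qed
  qed
  also have "(\<lambda>J. \<Sum>i<q. (lam i J F - lam i J F') * (lam (conj_index q r i) J G * (- ?P) ^ (if i \<le> r then 0 else 1))) = (\<lambda>J. c F J - c F' J)"
    by (simp only: c_def left_diff_distrib sum_subtractf mult.assoc)
  finally have c: "padic_lim (\<lambda>J. c F J - c F' J) 0" by simp
  have "padic_lim (\<lambda>J. ((lam r J (F * G) - c F J) + (c F J - c F' J)) + -1 * (lam r J (F' * G) - c F' J)) (0 + 0 + -1 * 0)"
    by (intro padic_lim_add e F c padic_lim_scale) simp
  thus "padic_lim (\<lambda>J. lam r J (F * G) - lam r J (F' * G)) 0" by simp
qed

lemma lam_mult_lim:
  fixes F G :: "'p::prime_card padic fps"
  assumes F: "growth_bounded F" and G: "growth_bounded G" and r: "r < CARD('p) - 1"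
    and L: "\<And>i. i < CARD('p) - 1 \<Longrightarrow> padic_lim (\<lambda>J. lam i J F) (L i)"
    and M: "\<And>i. i < CARD('p) - 1 \<Longrightarrow> padic_lim (\<lambda>J. lam i J G) (M i)"
  shows "padic_lim (\<lambda>J. lam r J (F * G)) (\<Sum>i<CARD('p) - 1. L i * M (conj_index (CARD('p) - 1) r i) *
    (- of_nat CARD('p)) ^ (if i \<le> r then 0 else 1))"
proof (rule padic_lim_transfer)
  let ?P = "of_nat CARD('p) :: 'p padic"
  show "padic_lim (\<lambda>J. lam r J (F * G) - (\<Sum>i<CARD('p) - 1. lam i J F * lam (conj_index (CARD('p) - 1) r i) J G *
    (- ?P) ^ (if i \<le> r then 0 else 1))) 0"
    by (intro padic_lim_0I lam_mult assms)
  show "padic_lim (\<lambda>J. \<Sum>i<CARD('p) - 1. lam i J F * lam (conj_index (CARD('p) - 1) r i) J G *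
    (- ?P) ^ (if i \<le> r then 0 else 1)) (\<Sum>i<CARD('p) - 1. L i * M (conj_index (CARD('p) - 1) r i) *
    (- ?P) ^ (if i \<le> r then 0 else 1))"
  proof (rule padic_lim_sum)
    fix i assume "i \<in> {..<CARD('p) - 1}"
    hence i: "i < CARD('p) - 1" by simp
    note c = conj_index_less[OF i r]
    have "padic_lim (\<lambda>J. lam i J F * lam (conj_index (CARD('p) - 1) r i) J G) (L i * M (conj_index (CARD('p) - 1) r i))"
      by (intro padic_lim_mult lam_ball F G i c L M)
    from padic_lim_scale[OF this, of "(- ?P) ^ (if i \<le> r then 0 else 1)"]
    show "padic_lim (\<lambda>J. lam i J F * lam (conj_index (CARD('p) - 1) r i) J G * (- ?P) ^ (if i \<le> r then 0 else 1))
       (L i * M (conj_index (CARD('p) - 1) r i) * (- ?P) ^ (if i \<le> r then 0 else 1))"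
      by (simp only: mult.commute) (simp add: padic_ball_power)
  qed
qed

section \<open>The exponential of a multiple of \<open>p\<close>\<close>

lemma fps_ode_unique:
  fixes F G D :: "'a::field_char_0 fps"
  assumes "fps_deriv F = D * F" "fps_deriv G = D * G" "fps_nth F 0 = fps_nth G 0"
  shows "F = G"
proof -
  have "fps_nth F n = fps_nth G n" for n
  proof (induction n rule: less_induct)
    case (less n)
    show ?case
    proof (cases n)
      case (Suc m)
      have "of_nat (Suc m) * fps_nth F (Suc m) = (\<Sum>i=0..m. fps_nth D i * fps_nth F (m - i))"
        using arg_cong[OF assms(1), of "\<lambda>H. fps_nth H m"] by (simp add: fps_mult_nth)
      also have "\<dots> = (\<Sum>i=0..m. fps_nth D i * fps_nth G (m - i))"
        using less Suc by (intro sum.cong refl) auto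
      also have "\<dots> = of_nat (Suc m) * fps_nth G (Suc m)"
        using arg_cong[OF assms(2), of "\<lambda>H. fps_nth H m"] by (simp add: fps_mult_nth)
      finally show ?thesis unfolding Suc by (subst (asm) mult_left_cancel) (simp_all del: of_nat_Suc)
    qed (simp add: assms(3))
  qed
  thus ?thesis by (simp add: fps_eq_iff)
qed

definition exp_X_p :: "'p::prime_card padic \<Rightarrow> 'p padic fps" where
  "exp_X_p t = fps_exp t oo fps_X ^ CARD('p)"

lemma exp_X_p_nth:
  "fps_nth (exp_X_p t :: 'p::prime_card padic fps) n = (if CARD('p) dvd n then t ^ (n div CARD('p)) / fact (n div CARD('p)) else 0)"
proof -
  have p0: "CARD('p) > 0" by simp
  have "fps_nth (exp_X_p t :: 'p padic fps) n = (\<Sum>i=0..n. t ^ i / fact i * (if n = CARD('p) * i then 1 else 0))"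
    by (simp add: exp_X_p_def fps_compose_nth fps_X_power_nth flip: power_mult)
  also have "\<dots> = (\<Sum>i\<in>{0..n}. if i = n div CARD('p) \<and> CARD('p) dvd n then t ^ i / fact i else 0)"
    using p0 by (intro sum.cong refl) auto
  also have "\<dots> = (if CARD('p) dvd n then t ^ (n div CARD('p)) / fact (n div CARD('p)) else 0)"
    by (cases "CARD('p) dvd n") (simp_all add: sum.delta)
  finally show ?thesis .
qed

text \<open>Both sides have constant term \<open>1\<close> and logarithmic derivative
  \<open>p t (1 + x ^ (p - 1))\<close>. The point of the factorization is that
  \<open>exp (p t x)\<close> and \<open>exp (t x ^ p)\<close> can each be evaluated at
  \<open>\<pi>\<close>.\<close>

lemma dwork_p_multiple:
  "dwork (of_nat CARD('p) * t) = fps_exp (of_nat CARD('p) * t) * exp_X_p (t :: 'p::prime_card padic)"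
proof (rule fps_ode_unique)
  let ?P = "of_nat CARD('p) :: 'p padic"
  have d: "fps_deriv (exp_X_p t) = fps_const (?P * t) * fps_X ^ (CARD('p) - 1) * exp_X_p t"
    by (simp add: exp_X_p_def fps_compose_deriv fps_deriv_power fps_const_mult_apply_left[symmetric]
        mult_ac flip: fps_of_nat fps_const_mult)
  show "fps_deriv (dwork (?P * t)) = fps_const (?P * t) * (1 + fps_X ^ (CARD('p) - 1)) * dwork (?P * t)"
    by (rule dwork_deriv)
  show "fps_deriv (fps_exp (?P * t) * exp_X_p t) = fps_const (?P * t) * (1 + fps_X ^ (CARD('p) - 1)) * (fps_exp (?P * t) * exp_X_p t)"
    unfolding fps_deriv_mult d fps_exp_deriv by (simp add: algebra_simps)
  show "fps_nth (dwork (?P * t)) 0 = fps_nth (fps_exp (?P * t) * exp_X_p t) 0"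
    by (simp add: dwork_def exp_X_p_nth)
qed

lemma fact_padic_bound':
  assumes "CARD('p::prime_card) > 3" "k div 4 \<le> e"
  shows "(of_nat CARD('p) ^ e / fact k :: 'p padic) \<in> padic_ball (e - k div 4)"
proof -
  have "(of_nat CARD('p) ^ e :: 'p padic) = of_nat CARD('p) ^ (e - k div 4) * of_nat CARD('p) ^ (k div 4)"
    using assms(2) by (simp flip: power_add)
  hence "(of_nat CARD('p) ^ e / fact k :: 'p padic) = of_nat CARD('p) ^ (e - k div 4) * (of_nat CARD('p) ^ (k div 4) / fact k)"
    by (simp only: times_divide_eq_right)
  also have "\<dots> \<in> padic_ball (e - k div 4 + 0)"
    by (intro padic_ball_mult p_power_padic_ball fact_padic_bound assms)
  finally show ?thesis by simp
qed

lemma growth_bounded_exp: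
  assumes p: "CARD('p::prime_card) > 3" and t: "t \<in> padic_ball 0"
  shows "growth_bounded (fps_exp (of_nat CARD('p) * t) :: 'p padic fps)"
  unfolding growth_bounded_def
proof
  fix n
  let ?P = "of_nat CARD('p) :: 'p padic"
  have "?P ^ growth_exp CARD('p) n * fps_nth (fps_exp (?P * t)) n = ?P ^ growth_exp CARD('p) n * t ^ n * (?P ^ n / fact n)"
    by (simp add: power_mult_distrib)
  also have "?P ^ n / fact n \<in> padic_ball 0"
    by (rule padic_ball_mono[OF fact_padic_bound'[OF p]]) auto
  hence "?P ^ growth_exp CARD('p) n * t ^ n * (?P ^ n / fact n) \<in> padic_ball 0"
    by (intro padic_ball_mult_left[OF padic_ball_mult_left[OF padic_ball_power padic_ball_power[OF t]]]) auto
  finally show "?P ^ growth_exp CARD('p) n * fps_nth (fps_exp (?P * t)) n \<in> padic_ball 0" .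
qed

lemma growth_bounded_exp_X_p:
  assumes p: "CARD('p::prime_card) > 3" and t: "t \<in> padic_ball 0"
  shows "growth_bounded (exp_X_p t :: 'p padic fps)"
  unfolding growth_bounded_def
proof
  fix n
  let ?P = "of_nat CARD('p) :: 'p padic"
  let ?k = "n div CARD('p)"
  have "?P ^ growth_exp CARD('p) n / fact ?k \<in> padic_ball 0"
    by (rule padic_ball_mono[OF fact_padic_bound'[OF p]]) (auto simp: growth_exp_def intro: div_le_mono)
  hence "t ^ ?k * (?P ^ growth_exp CARD('p) n / fact ?k) \<in> padic_ball 0"
    by (rule padic_ball_mult_left[OF padic_ball_power[OF t]])
  thus "?P ^ growth_exp CARD('p) n * fps_nth (exp_X_p t) n \<in> padic_ball 0"
    by (simp add: exp_X_p_nth mult.commute)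
qed

lemma growth_bounded_1: "growth_bounded 1"
  by (auto simp: growth_bounded_def padic_ball_power)

lemma lam_1: "J > 0 \<Longrightarrow> lam r J (1 :: 'p::prime_card padic fps) = (if r = 0 then 1 else 0)"
  if "r < CARD('p) - 1"
proof -
  assume J: "J > 0"
  have "lam r J (1 :: 'p padic fps) = (\<Sum>j<J. if j = 0 then (if r = 0 then 1 else 0) else 0)"
    unfolding lam_def using that by (intro sum.cong refl) auto
  thus ?thesis using J by (simp add: sum.delta)
qed

text \<open>On the roots of \<open>x ^ (p - 1) = - p\<close> one has \<open>x ^ p = - p x\<close>.\<close>

lemma lam_equiv_exp_X_p:
  assumes p: "CARD('p::prime_card) > 3" and t: "t \<in> padic_ball 0"
  shows "lam_equiv (exp_X_p t) (fps_exp (of_nat CARD('p) * (- t)) :: 'p padic fps)"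
  unfolding lam_equiv_def
proof (intro allI impI padic_lim_0I)
  fix r J assume r: "r < CARD('p) - 1"
  let ?p = "CARD('p)"
  let ?P = "of_nat ?p :: 'p padic"
  define q where "q = ?p - 1"
  have pq: "?p = Suc q" using p by (simp add: q_def)
  define u where "u = (\<lambda>i. t ^ (r + i * q) / fact (r + i * q) * (- ?P) ^ (i + (r + i * q)))"
  define I where "I = {i. i + (r + i * q) < J}"
  have I: "I \<subseteq> {..<J}" by (auto simp: I_def)
  have "lam r J (exp_X_p t) = (\<Sum>j<J. fps_nth (exp_X_p t) (r + j * q) * (- ?P) ^ j)"
    by (simp add: lam_def q_def)
  \<comment> \<open>Only degrees divisible by \<open>p\<close> occur. Since \<open>q\<close> is
    \<open>- 1\<close> modulo \<open>p\<close>, divisibility of \<open>r + j q\<close> means that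
    \<open>j\<close> is \<open>r\<close> modulo \<open>p\<close>, and \<open>j = r + i p\<close>
    gives the degree \<open>(r + i q) p\<close>.\<close>
  also have "\<dots> = (\<Sum>j\<in>(\<lambda>i. r + i * ?p) ` I. fps_nth (exp_X_p t) (r + j * q) * (- ?P) ^ j)"
  proof (intro sum.mono_neutral_right ballI)
    show "(\<lambda>i. r + i * ?p) ` I \<subseteq> {..<J}" by (auto simp: I_def pq algebra_simps)
    fix j assume j: "j \<in> {..<J} - (\<lambda>i. r + i * ?p) ` I"
    have "\<not> ?p dvd r + j * q"
    proof
      assume "?p dvd r + j * q"
      hence "[j + (r + j * q) = j] (mod ?p)" by (simp add: cong_add_lcancel_0_nat cong_0_iff)
      moreover have "j + (r + j * q) = r + j * ?p" by (simp add: pq)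
      ultimately have "[r + j * ?p = j] (mod ?p)" by simp
      hence "j mod ?p = r mod ?p" by (simp add: cong_def)
      also have "\<dots> = r" using r by simp
      finally have "j = r + j div ?p * ?p" by (metis add.commute div_mult_mod_eq)
      moreover from this have "j div ?p \<in> I"
        using j by (auto simp: I_def pq algebra_simps)
      ultimately show False using j by blast
    qed
    thus "fps_nth (exp_X_p t) (r + j * q) * (- ?P) ^ j = 0" by (simp add: exp_X_p_nth)
  qed auto
  also have "\<dots> = (\<Sum>i\<in>I. fps_nth (exp_X_p t) (r + (r + i * ?p) * q) * (- ?P) ^ (r + i * ?p))"
    by (subst sum.reindex) (auto simp: inj_on_def)
  also have "\<dots> = (\<Sum>i\<in>I. u i)"
  proof (intro sum.cong refl)
    fix i
    have e1: "r + (r + i * ?p) * q = (r + i * q) * ?p" by (simp add: pq algebra_simps)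
    have e2: "r + i * ?p = i + (r + i * q)" by (simp add: pq)
    have h: "fps_nth (exp_X_p t) ((r + i * q) * ?p) = t ^ (r + i * q) / fact (r + i * q)"
      by (simp add: exp_X_p_nth)
    show "fps_nth (exp_X_p t) (r + (r + i * ?p) * q) * (- ?P) ^ (r + i * ?p) = u i"
      unfolding e1 h unfolding e2 u_def by (rule refl)
  qed
  finally have 1: "lam r J (exp_X_p t) = (\<Sum>i\<in>I. u i)" .
  have 2: "lam r J (fps_exp (?P * (- t))) = (\<Sum>i<J. u i)"
    unfolding lam_def
  proof (intro sum.cong refl)
    fix i
    have h: "(?P * (- t)) ^ (r + i * q) = (- ?P) ^ (r + i * q) * t ^ (r + i * q)"
      by (simp flip: power_mult_distrib)
    have "fps_nth (fps_exp (?P * (- t))) (r + i * q) * (- ?P) ^ i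
        = (- ?P) ^ (r + i * q) * t ^ (r + i * q) / fact (r + i * q) * (- ?P) ^ i"
      by (simp only: fps_exp_nth h of_nat_fact)
    also have "\<dots> = u i" by (simp add: u_def power_add)
    finally show "fps_nth (fps_exp (?P * (- t))) (r + i * (CARD('p) - 1)) * (- ?P) ^ i = u i"
      by (simp only: q_def)
  qed
  \<comment> \<open>The two partial sums have the same terms and differ only in where they are cut
    off.\<close>
  have "(\<Sum>i\<in>I. u i) - (\<Sum>i<J. u i) = - (\<Sum>i\<in>{..<J} - I. u i)"
    using sum.subset_diff[OF I, of u] by simp
  also have "\<dots> \<in> padic_ball (J div 4)"
    unfolding padic_ball_uminus_iff
  proof (rule padic_ball_sum)
    fix i assume "i \<in> {..<J} - I"
    hence i: "J \<le> i + (r + i * q)" by (auto simp: I_def)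
    let ?k = "r + i * q"
    have "4 * (?k div 4) \<le> ?k" by simp
    moreover have "4 * (J div 4) \<le> J" by simp
    ultimately have le: "?k div 4 \<le> i + ?k" "J div 4 \<le> i + ?k - ?k div 4" using i by linarith+
    have "?P ^ (i + ?k) / fact ?k \<in> padic_ball (J div 4)"
      by (rule padic_ball_mono[OF fact_padic_bound'[OF p le(1)] le(2)])
    hence "((-1) ^ (i + ?k) * t ^ ?k) * (?P ^ (i + ?k) / fact ?k) \<in> padic_ball (J div 4)"
      by (intro padic_ball_mult_left[OF padic_ball_mult_left[OF padic_ball_power padic_ball_power[OF t]]]) auto
    also have "((-1) ^ (i + ?k) * t ^ ?k) * (?P ^ (i + ?k) / fact ?k) = u i"
      unfolding u_def neg_p_power by (simp add: mult_ac)
    finally show "u i \<in> padic_ball (J div 4)" .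
  qed
  finally show "lam r J (exp_X_p t) - lam r J (fps_exp (?P * (- t))) \<in> padic_ball (J div 4)"
    by (simp only: 1 2)
qed

lemma growth_bounded_dwork_p:
  assumes p: "CARD('p::prime_card) > 3" and t: "t \<in> padic_ball 0"
  shows "growth_bounded (dwork (of_nat CARD('p) * t) :: 'p padic fps)"
  unfolding dwork_p_multiple by (intro growth_bounded_mult growth_bounded_exp growth_bounded_exp_X_p assms)

text \<open>At \<open>\<pi>\<close> the two factors become \<open>exp (p t \<pi>)\<close> and
  \<open>exp (- p t \<pi>)\<close>. Therefore changing a parameter of \<open>dwork\<close> by a
  multiple of \<open>p\<close> does not affect the value.\<close>

lemma lam_equiv_dwork_p:
  assumes p: "CARD('p::prime_card) > 3" and t: "t \<in> padic_ball 0"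
  shows "lam_equiv (dwork (of_nat CARD('p) * t)) (1 :: 'p padic fps)"
proof -
  have t': "- t \<in> padic_ball 0" using t by simp
  have "lam_equiv (exp_X_p t * fps_exp (of_nat CARD('p) * t)) (fps_exp (of_nat CARD('p) * (- t)) * fps_exp (of_nat CARD('p) * t))"
    by (intro lam_equiv_mult lam_equiv_exp_X_p growth_bounded_exp growth_bounded_exp_X_p p t t')
  also have "exp_X_p t * fps_exp (of_nat CARD('p) * t) = dwork (of_nat CARD('p) * t)"
    by (simp only: dwork_p_multiple mult.commute[of "exp_X_p t"])
  also have "fps_exp (of_nat CARD('p) * (- t)) * fps_exp (of_nat CARD('p) * t) = (1 :: 'p padic fps)"
    by (simp flip: fps_exp_add_mult)
  finally show ?thesis .
qed

text \<open>Because \<open>x ^ p = x\<close>, scaling the variable by \<open>x\<close> multiplies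
  both terms of \<open>dwork_arg\<close> by the same factor \<open>x\<close>.\<close>

lemma dwork_nth_root_of_unity:
  assumes "x ^ CARD('p) = x"
  shows "fps_nth (dwork (x :: 'p::prime_card padic)) n = x ^ n * dwork_coeff n"
proof -
  have "dwork x = (fps_exp 1 oo (fps_const x * fps_X)) oo dwork_arg"
    by (simp add: dwork_def)
  also have "\<dots> = fps_exp 1 oo ((fps_const x * fps_X) oo dwork_arg)"
    by (rule fps_compose_assoc[symmetric]) simp_all
  also have "(fps_const x * fps_X) oo dwork_arg = dwork_arg oo (fps_const x * fps_X)"
  proof (rule fps_ext)
    fix n
    have "fps_nth ((fps_const x * fps_X) oo dwork_arg) n = x * fps_nth dwork_arg n"
      by (simp flip: fps_const_mult_apply_left)
    also have "\<dots> = x ^ n * fps_nth dwork_arg n"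
      using assms by (auto simp: dwork_arg_def fps_X_power_nth)
    also have "\<dots> = fps_nth (dwork_arg oo (fps_const x * fps_X)) n" by simp
    finally show "fps_nth ((fps_const x * fps_X) oo dwork_arg) n = fps_nth (dwork_arg oo (fps_const x * fps_X)) n" .
  qed
  also have "fps_exp 1 oo (dwork_arg oo (fps_const x * fps_X)) = dwork 1 oo (fps_const x * fps_X)"
    unfolding dwork_def by (rule fps_compose_assoc) simp_all
  finally show ?thesis by (simp add: dwork_coeff_def)
qed

lemma growth_bounded_dwork_root_of_unity:
  assumes p: "CARD('p::prime_card) > 3" and "x ^ CARD('p) = x" "x \<in> padic_ball 0"
  shows "growth_bounded (dwork (x :: 'p padic))"
  unfolding growth_bounded_def
proof
  fix n
  have "x ^ n * (of_nat CARD('p) ^ growth_exp CARD('p) n * fps_nth (dwork 1) n) \<in> padic_ball 0"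
    using growth_bounded_dwork[OF p]
    by (intro padic_ball_mult_left[OF padic_ball_power[OF assms(3)]]) (auto simp: growth_bounded_def)
  thus "of_nat CARD('p) ^ growth_exp CARD('p) n * fps_nth (dwork x) n \<in> padic_ball 0"
    by (simp only: dwork_nth_root_of_unity[OF assms(2)] dwork_coeff_def mult_ac)
qed

lemma lam_dwork_root_of_unity:
  assumes "x ^ (CARD('p) - 1) = 1"
  shows "lam r J (dwork (x :: 'p::prime_card padic)) = x ^ r * lam r J (dwork 1)"
proof -
  have p0: "CARD('p) = Suc (CARD('p) - 1)" by simp
  have x: "x ^ CARD('p) = x" by (subst p0) (simp only: power_Suc assms mult_1_right)
  have "x ^ (r + j * (CARD('p) - 1)) = x ^ r" for j
    by (simp only: power_add mult.commute[of j] power_mult assms power_one mult_1_right)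
  thus ?thesis
    unfolding lam_def dwork_nth_root_of_unity[OF x]
    by (simp only: dwork_coeff_def sum_distrib_left mult.assoc)
qed

section \<open>The Gamma function at \<open>r / (p - 1)\<close>\<close>

lemma gchoose_approx:
  fixes x :: "'p::prime_card padic_int"
  assumes p: "CARD('p) > 3" and X: "of_nat CARD('p) ^ M dvd x - of_nat X" and i: "i div 4 \<le> M"
  shows "(padic_of_int x gchoose i) - (of_nat X gchoose i) \<in> padic_ball (M - i div 4)"
proof -
  have "of_nat CARD('p) ^ M dvd (\<Prod>l=0..<i. x - of_nat l) - (\<Prod>l=0..<i. of_nat X - of_nat l)"
    using X by (intro dvd_prod_diff) simp
  then obtain w where w: "(\<Prod>l=0..<i. x - of_nat l) - (\<Prod>l=0..<i. of_nat X - of_nat l) = of_nat CARD('p) ^ M * w"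
    by (elim dvdE)
  have "(\<Prod>l=0..<i. padic_of_int x - of_nat l) - (\<Prod>l=0..<i. of_nat X - of_nat l) = of_nat CARD('p) ^ M * padic_of_int w"
    using arg_cong[OF w, of padic_of_int] by (simp only: padic_of_int_hom)
  hence "(padic_of_int x gchoose i) - (of_nat X gchoose i) = (of_nat CARD('p) ^ M / fact i) * padic_of_int w"
    by (simp add: gbinomial_prod_rev flip: diff_divide_distrib)
  also have "\<dots> \<in> padic_ball (M - i div 4)"
    by (intro padic_ball_mult_right fact_padic_bound' p i) simp
  finally show ?thesis .
qed

lemma gamma_diff_ball:
  assumes "CARD('p::prime_card) \<noteq> 2" "a < CARD('p)"
  shows "(padic_of_int (gamma_diff a k) :: 'p padic) \<in> padic_ball ((k + 1) div 2)"
  using gamma_diff_divisible[OF assms, of k] by (simp add: padic_of_int_ball_iff)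

text \<open>Newton's formula is exact at a natural number \<open>X\<close> near \<open>x\<close>.
  The divisibility of \<open>gamma_diff\<close> makes the terms beyond \<open>2 n\<close> vanish
  modulo \<open>p ^ n\<close>, uniformly in \<open>X\<close>, and the remaining ones depend
  continuously on the argument.\<close>

lemma Gamma_p_mahler:
  fixes x :: "'p::prime_card padic_int"
  assumes p: "CARD('p) > 3" and a: "a < CARD('p)"
  shows "padic_lim (\<lambda>N. \<Sum>i\<le>N. padic_of_int (gamma_diff a i) * (padic_of_int x gchoose i))
    (padic_of_int (Gamma_p (- (of_nat a + of_nat CARD('p) * x))))"
  unfolding padic_lim_def
proof
  fix n
  have p2: "CARD('p) \<noteq> 2" using p by simp
  let ?D = "\<lambda>i. padic_of_int (gamma_diff a i) :: 'p padic"
  let ?G = "Gamma_p (- (of_nat a + of_nat CARD('p) * x))"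
  show "eventually (\<lambda>N. (\<Sum>i\<le>N. ?D i * (padic_of_int x gchoose i)) - padic_of_int ?G \<in> padic_ball n) sequentially"
    using eventually_ge_at_top[of "2 * n"]
  proof eventually_elim
    case (elim N)
    \<comment> \<open>The surplus precision \<open>N\<close> pays for the denominators
      \<open>i!\<close> of the binomial coefficients with \<open>i \<le> N\<close>.\<close>
    obtain X where X: "of_nat CARD('p) ^ (n + N) dvd x - of_nat X"
      using exists_nat_approx .
    define K where "K = max N X"
    have 1: "(\<Sum>i\<le>N. ?D i * ((padic_of_int x gchoose i) - (of_nat X gchoose i))) \<in> padic_ball n"
    proof (intro padic_ball_sum padic_ball_mult_left)
      fix i assume "i \<in> {..N}"
      hence iN: "i div 4 \<le> N" by (simp add: le_trans[OF div_le_dividend])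
      hence "i div 4 \<le> n + N" by simp
      from padic_ball_mono[OF gchoose_approx[OF p X this]]
      show "(padic_of_int x gchoose i) - (of_nat X gchoose i) \<in> padic_ball n" using iN by simp
    qed simp
    have 2: "(\<Sum>i\<in>{N<..K}. ?D i * of_nat (X choose i)) \<in> padic_ball n"
    proof (intro padic_ball_sum padic_ball_mult_right)
      fix i assume "i \<in> {N<..K}"
      hence "2 * n \<le> i + 1" using elim by simp
      hence "2 * n div 2 \<le> (i + 1) div 2" by (rule div_le_mono)
      hence "n \<le> (i + 1) div 2" by simp
      with gamma_diff_ball[OF p2 a, of i] show "?D i \<in> padic_ball n" by (rule padic_ball_mono)
    qed simp
    have "(gamma_ap a (0 + X) :: 'p padic_int) = (\<Sum>i\<le>X. of_nat (X choose i) * gamma_diff a i)"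
      unfolding newton_forward[of "gamma_ap a" 0 X] gamma_diff_def ..
    hence "padic_of_int (gamma_ap a X :: 'p padic_int) = (\<Sum>i\<le>X. ?D i * of_nat (X choose i))"
      by (simp only: padic_of_int_hom add_0 mult.commute)
    also have "\<dots> = (\<Sum>i\<le>K. ?D i * of_nat (X choose i))"
      by (intro sum.mono_neutral_left) (auto simp: K_def)
    also have "{..K} = {..N} \<union> {N<..K}" by (auto simp: K_def)
    also have "(\<Sum>i\<in>\<dots>. ?D i * of_nat (X choose i)) = (\<Sum>i\<le>N. ?D i * of_nat (X choose i)) + (\<Sum>i\<in>{N<..K}. ?D i * of_nat (X choose i))"
      by (intro sum.union_disjoint) auto
    finally have g: "padic_of_int (gamma_ap a X :: 'p padic_int) = (\<Sum>i\<le>N. ?D i * of_nat (X choose i)) + (\<Sum>i\<in>{N<..K}. ?D i * of_nat (X choose i))" .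
    have "of_nat CARD('p) ^ n dvd x - of_nat X"
      using X by (rule dvd_trans[rotated]) (simp add: le_imp_power_dvd)
    hence "of_nat CARD('p) ^ n dvd - of_nat CARD('p) * (x - of_nat X)" by (rule dvd_mult)
    also have "- of_nat CARD('p) * (x - of_nat X) = - (of_nat a + of_nat CARD('p) * x) - - of_nat (a + CARD('p) * X)"
      by (simp add: algebra_simps)
    finally have "of_nat CARD('p) ^ n dvd ?G - gamma_ap a X"
      unfolding gamma_ap_def by (rule Gamma_p_cong[OF p2])
    hence 3: "padic_of_int ?G - padic_of_int (gamma_ap a X) \<in> padic_ball n"
      by (simp only: padic_of_int_ball_iff flip: padic_of_int_simps)
    have e: "(\<Sum>i\<le>N. ?D i * (padic_of_int x gchoose i)) - padic_of_int ?G
      = (\<Sum>i\<le>N. ?D i * ((padic_of_int x gchoose i) - (of_nat X gchoose i)))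
        - (\<Sum>i\<in>{N<..K}. ?D i * of_nat (X choose i)) - (padic_of_int ?G - padic_of_int (gamma_ap a X))"
      unfolding g by (simp add: right_diff_distrib sum_subtractf binomial_gbinomial)
    show ?case
      unfolding e by (intro padic_ball_diff 1 2 3)
  qed
qed

text \<open>
  Let \<open>C = exp (x + x ^ p / p)\<close> be Dwork's series, \<open>c n\<close> its coefficients, and \<open>s = a / (p - 1)\<close>.
  The sum of \<open>c (a + j (p - 1)) (- p) ^ j\<close> over \<open>j\<close> is the trace of Dwork's operator \<open>T\<close> for the
  function \<open>x ^ (- a) C\<close>.  As \<open>T \<circ> D = p D \<circ> T\<close> for a derivation \<open>D\<close> with one-dimensional
  cokernel, on which \<open>T\<close> has the eigenvalue \<open>Gamma_p s\<close>, this trace is \<open>Gamma_p s / (1 - p)\<close>.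
  Cutting off the infinite matrices after \<open>N\<close> rows leaves the following boundary term.
\<close>

definition trace_boundary :: "nat \<Rightarrow> 'p::prime_card padic \<Rightarrow> nat \<Rightarrow> 'p padic" where
  "trace_boundary a s N = of_nat CARD('p) * (- of_nat CARD('p)) ^ N *
    (\<Sum>m\<le>N. (-1) ^ (N - m) * dwork_coeff (a + N * CARD('p) - m) * (\<Prod>l\<in>{m<..N}. of_nat l + s))"

lemma trace_step:
  fixes s :: "'p::prime_card padic"
  assumes s: "of_nat (CARD('p) - 1) * s = of_nat a"
  defines "P \<equiv> of_nat CARD('p)"
  shows "(1 - P) * (dwork_coeff (a + Suc K * (CARD('p) - 1)) * (- P) ^ Suc K) =
    (- P) ^ Suc K * dwork_coeff (a + Suc K * CARD('p)) * (\<Prod>l<Suc K. - s - of_nat l)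
      + trace_boundary a s K - trace_boundary a s (Suc K)"
proof -
  let ?p = "CARD('p)" and ?c = "dwork_coeff :: nat \<Rightarrow> 'p padic"
  define N where "N = Suc K"
  have p0: "?p > 0" by simp
  have sP: "(P - 1) * s = of_nat a" using s by (simp add: P_def of_nat_diff)
  define n where "n = (\<lambda>m. a + N * ?p - m)"
  define pr where "pr = (\<lambda>m N. \<Prod>l\<in>{m<..N}. of_nat l + s)"
  define u where "u = (\<lambda>m. (-1) ^ (N - m) * ?c (n m) * (\<Prod>l\<in>{m..K}. of_nat l + s))"
  have step: "(-1) ^ (K - m) * ?c (a + K * ?p - m) * pr m K
      = - (P * ((-1) ^ (N - m) * ?c (n m) * pr m N)) - (u (Suc m) - u m)" if m: "m \<le> K" for m
  proof -
    have KK: "K \<le> K * ?p" using p0 by simp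
    have Np: "N * ?p = ?p + K * ?p" by (simp add: N_def)
    have nm: "n m \<ge> ?p" "n m > 0" "n m - ?p = a + K * ?p - m" "n m - 1 = n (Suc m)"
      using m KK p0 unfolding n_def Np by linarith+
    \<comment> \<open>Through \<open>(P - 1) s = a\<close> the degree splits as
      \<open>P (N + s) - (m + s)\<close>. The first part completes the product in the next boundary
      term; the second part and the coefficient of degree \<open>n (Suc m)\<close> telescope in
      \<open>m\<close>. The ends of the telescope are the new term of the trace (\<open>u N\<close>)
      and the new term of the Mahler series (\<open>u 0\<close>).\<close>
    have "of_nat (n m) = (of_nat a + of_nat N * P - of_nat m :: 'p padic)"
    proof -
      have "m \<le> a + N * ?p" unfolding Np using m KK by linarith
      thus ?thesis by (simp add: n_def of_nat_diff P_def)
    qed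
    also have "\<dots> = P * (of_nat N + s) - (of_nat m + s)"
      unfolding sP[symmetric] by (simp add: algebra_simps)
    finally have nn: "of_nat (n m) = P * (of_nat N + s) - (of_nat m + s)" .
    have c: "?c (a + K * ?p - m) = (P * (of_nat N + s) - (of_nat m + s)) * ?c (n m) - ?c (n (Suc m))"
      using dwork_coeff_rec[OF nm(2), where 'p='p] nm unfolding nn by simp
    have sg: "(-1) ^ (N - m) = - ((-1) ^ (K - m) :: 'p padic)"
      using m by (simp add: N_def Suc_diff_le)
    have ivl: "{m<..N} = insert N {m<..K}" "{m..K} = insert m {m<..K}" "{Suc m..K} = {m<..K}"
      using m by (auto simp: N_def)
    have pr: "pr m N = (of_nat N + s) * pr m K" "(\<Prod>l\<in>{m..K}. of_nat l + s) = (of_nat m + s) * pr m K"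
      "(\<Prod>l\<in>{Suc m..K}. of_nat l + s) = pr m K"
      by (simp_all add: pr_def ivl) (simp_all add: N_def)
    have uS: "u (Suc m) = (-1) ^ (K - m) * ?c (n (Suc m)) * pr m K"
      by (simp only: u_def pr N_def diff_Suc_Suc)
    have um: "u m = - ((-1) ^ (K - m)) * ?c (n m) * ((of_nat m + s) * pr m K)"
      by (simp only: u_def pr sg)
    show ?thesis
      unfolding c sg pr(1) uS um by (simp add: algebra_simps)
  qed
  have "(\<Sum>m\<le>K. (-1) ^ (K - m) * ?c (a + K * ?p - m) * pr m K)
      = (\<Sum>m\<le>K. - (P * ((-1) ^ (N - m) * ?c (n m) * pr m N)) - (u (Suc m) - u m))"
    by (intro sum.cong refl step) auto
  also have "\<dots> = - (P * (\<Sum>m\<le>K. (-1) ^ (N - m) * ?c (n m) * pr m N)) - (\<Sum>m<N. u (Suc m) - u m)"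
    unfolding N_def lessThan_Suc_atMost by (simp only: sum_subtractf sum_negf sum_distrib_left)
  also have "(\<Sum>m<N. u (Suc m) - u m) = u N - u 0"
    by (rule sum_lessThan_telescope)
  also have "(\<Sum>m\<le>K. (-1) ^ (N - m) * ?c (n m) * pr m N)
      = (\<Sum>m\<le>N. (-1) ^ (N - m) * ?c (n m) * pr m N) - ?c (n N)"
    by (simp add: N_def pr_def)
  finally have sum: "(\<Sum>m\<le>K. (-1) ^ (K - m) * ?c (a + K * ?p - m) * pr m K)
      = - (P * ((\<Sum>m\<le>N. (-1) ^ (N - m) * ?c (n m) * pr m N) - ?c (n N))) - (u N - u 0)" .
  have BK: "trace_boundary a s K = - ((- P) ^ N * (\<Sum>m\<le>K. (-1) ^ (K - m) * ?c (a + K * ?p - m) * pr m K))"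
    unfolding trace_boundary_def P_def[symmetric] pr_def by (simp add: N_def)
  have BN: "trace_boundary a s N = (- P) ^ N * (P * (\<Sum>m\<le>N. (-1) ^ (N - m) * ?c (n m) * pr m N))"
    unfolding trace_boundary_def P_def[symmetric] pr_def n_def by (simp only: mult_ac)
  have nN: "n N = a + N * (?p - 1)"
    by (simp add: n_def diff_mult_distrib2)
  have uN: "u N = ?c (n N)" by (simp add: u_def N_def)
  have u0: "u 0 = ?c (a + N * ?p) * (\<Prod>l<N. - s - of_nat l)"
  proof -
    have "(\<Prod>l<N. - s - of_nat l) = (\<Prod>l<N. (-1) * (of_nat l + s))" by (intro prod.cong) auto
    also have "\<dots> = (-1) ^ N * (\<Prod>l<N. of_nat l + s)" by (simp only: prod.distrib prod_constant card_lessThan)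
    also have "(\<Prod>l<N. of_nat l + s) = (\<Prod>l\<in>{0..K}. of_nat l + s)"
      by (intro prod.cong) (auto simp: N_def)
    finally show ?thesis by (simp add: u_def n_def mult_ac)
  qed
  have alg: "(1 - P) * (y * X) = X * z * w + b - b'" if "b - b' = X * ((1 - P) * y - z * w)"
    for b b' X y z w :: "'p padic"
    unfolding add_diff_eq[symmetric] that by (simp add: algebra_simps)
  have "trace_boundary a s K - trace_boundary a s N
      = (- P) ^ N * ((1 - P) * ?c (n N) - ?c (a + N * ?p) * (\<Prod>l<N. - s - of_nat l))"
    unfolding BK BN sum uN u0 by (simp add: algebra_simps)
  from alg[OF this[unfolded nN]] show ?thesis by (simp only: N_def)
qed

lemma trace_partial_sum:
  fixes s :: "'p::prime_card padic"
  assumes s: "of_nat (CARD('p) - 1) * s = of_nat a"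
  shows "(1 - of_nat CARD('p)) * lam a (Suc N) (dwork 1) =
    (\<Sum>i\<le>N. (- of_nat CARD('p)) ^ i * dwork_coeff (a + i * CARD('p)) * (\<Prod>l<i. - s - of_nat l))
      - trace_boundary a s N"
proof (induction N)
  case 0
  show ?case by (simp add: lam_def trace_boundary_def dwork_coeff_def algebra_simps)
next
  case (Suc K)
  have "(1 - of_nat CARD('p)) * lam a (Suc (Suc K)) (dwork 1 :: 'p padic fps) = (1 - of_nat CARD('p)) * lam a (Suc K) (dwork 1)
      + (1 - of_nat CARD('p)) * (dwork_coeff (a + Suc K * (CARD('p) - 1)) * (- of_nat CARD('p)) ^ Suc K)"
    by (simp add: lam_def dwork_coeff_def distrib_left del: mult_Suc power_Suc)
  thus ?case unfolding Suc trace_step[OF s] by (simp del: mult_Suc power_Suc)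
qed

lemma trace_boundary_ball:
  assumes p: "CARD('p::prime_card) > 3" and s: "s \<in> padic_ball 0" and a: "a < CARD('p)"
  shows "trace_boundary a (s :: 'p padic) N \<in> padic_ball (N div 4)"
proof -
  let ?P = "of_nat CARD('p) :: 'p padic"
  have "trace_boundary a s N = (\<Sum>m\<le>N. ?P * (-1) ^ (N - m) * (\<Prod>l\<in>{m<..N}. of_nat l + s) *
      (dwork_coeff (a + N * CARD('p) - m) * (- ?P) ^ N))"
    unfolding trace_boundary_def sum_distrib_left by (simp only: mult_ac)
  also have "\<dots> \<in> padic_ball (N div 4)"
  proof (rule padic_ball_sum, rule padic_ball_mult_left)
    fix m
    show "?P * (-1) ^ (N - m) * (\<Prod>l\<in>{m<..N}. of_nat l + s) \<in> padic_ball 0"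
      using s by (intro padic_ball_mult_left padic_ball_power padic_ball_prod padic_ball_add) auto
    have "a + N * CARD('p) - m \<le> N * CARD('p) + (CARD('p) - 1)"
      using a by linarith
    thus "dwork_coeff (a + N * CARD('p) - m) * (- ?P) ^ N \<in> padic_ball (N div 4)"
      unfolding dwork_coeff_def by (rule growth_bounded_term[OF growth_bounded_dwork[OF p]])
  qed
  finally show ?thesis .
qed

lemma padic_lim_Suc: "padic_lim (\<lambda>J. s (Suc J)) L \<Longrightarrow> padic_lim s L"
  unfolding padic_lim_def
proof (intro allI)
  fix n
  assume "\<forall>n. eventually (\<lambda>J. s (Suc J) - L \<in> padic_ball n) sequentially"
  thus "eventually (\<lambda>J. s J - L \<in> padic_ball n) sequentially"
    using eventually_sequentially_Suc[of "\<lambda>J. s J - L \<in> padic_ball n"] by blast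
qed

text \<open>In \<open>trace_partial_sum\<close> the boundary term tends to \<open>0\<close>, and the
  sum on the right is the Mahler series of \<open>gamma_ap a\<close> at \<open>- z\<close>. Its
  value is \<open>Gamma_p z\<close>, because \<open>(p - 1) z = a\<close> gives
  \<open>- (a - p z) = z\<close>.\<close>

lemma lam_dwork_lim:
  fixes z :: "'p::prime_card padic_int"
  assumes p: "CARD('p) > 3" and a: "a < CARD('p)" and z: "of_nat (CARD('p) - 1) * z = of_nat a"
  shows "padic_lim (\<lambda>J. lam a J (dwork 1)) (padic_of_int (Gamma_p z) / (1 - of_nat CARD('p)))"
proof -
  let ?p = "CARD('p)" and ?P = "of_nat CARD('p) :: 'p padic"
  define s where "s = padic_of_int z"
  have p2: "?p \<noteq> 2" using p by simp
  have s: "of_nat (?p - 1) * s = of_nat a"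
    using arg_cong[OF z, of padic_of_int] by (simp only: padic_of_int_hom s_def)
  have s0: "s \<in> padic_ball 0" by (simp add: s_def)
  have "padic_of_int (Gamma_p (- (of_nat a + of_nat ?p * (- z)))) = (padic_of_int (Gamma_p z) :: 'p padic)"
  proof -
    have "- (of_nat a + of_nat ?p * (- z)) = z"
      unfolding z[symmetric] by (simp add: of_nat_diff algebra_simps)
    thus ?thesis by simp
  qed
  with Gamma_p_mahler[OF p a, of "- z"]
  have 1: "padic_lim (\<lambda>N. \<Sum>i\<le>N. padic_of_int (gamma_diff a i) * (- s gchoose i)) (padic_of_int (Gamma_p z))"
    by (simp only: padic_of_int_simps s_def)
  have t: "(- ?P) ^ i * dwork_coeff (a + i * ?p) * (\<Prod>l<i. - s - of_nat l) = padic_of_int (gamma_diff a i) * (- s gchoose i)" for i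
    unfolding dwork_coeff_gamma_diff[OF p2 a, symmetric]
    by (simp add: gbinomial_prod_rev atLeast0LessThan)
  have 2: "padic_lim (\<lambda>N. -1 * trace_boundary a s N) (-1 * 0)"
    by (intro padic_lim_scale padic_lim_0I trace_boundary_ball p s0 a) simp
  from padic_lim_add[OF 1 2]
  have "padic_lim (\<lambda>N. (1 - ?P) * lam a (Suc N) (dwork 1)) (padic_of_int (Gamma_p z))"
    by (simp add: trace_partial_sum[OF s] t)
  hence lim: "padic_lim (\<lambda>N. (1 - ?P) * lam a N (dwork 1)) (padic_of_int (Gamma_p z))"
    by (rule padic_lim_Suc)
  have "\<not> ?p dvd ?p - 1" using p by (intro nat_dvd_not_less) auto
  hence "inverse (of_nat (?p - 1)) \<in> (padic_ball 0 :: 'p padic set)" by (rule inverse_of_nat_padic_ball0)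
  moreover have nz: "1 - ?P = - of_nat (?p - 1)" by (simp add: of_nat_diff)
  ultimately have "inverse (1 - ?P) \<in> padic_ball 0" by (simp only: nz inverse_minus_eq padic_ball_uminus_iff)
  from padic_lim_scale[OF lim this]
  have "padic_lim (\<lambda>J. inverse (1 - ?P) * ((1 - ?P) * lam a J (dwork 1))) (inverse (1 - ?P) * padic_of_int (Gamma_p z))" .
  moreover have "1 - ?P \<noteq> 0" using p by (simp only: nz) simp
  hence "inverse (1 - ?P) * ((1 - ?P) * y) = y" for y by (simp flip: mult.assoc)
  ultimately show ?thesis by (simp only: divide_inverse mult.commute[of _ "inverse (1 - ?P)"])
qed

section \<open>Rational numbers with arbitrary, not necessarily reduced, denominators prime to
  p\<close>

lemma padic_int_of_rat_eqI:
  fixes z :: "'p::prime_card padic_int"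
  assumes d: "\<not> CARD('p) dvd d" and z: "of_nat d * z = of_int n"
  shows "padic_int_of_rat (of_int n / of_nat d) = z"
proof -
  define q where "q = (of_int n / of_nat d :: rat)"
  obtain a b where ab: "quotient_of q = (a, b)" by (cases "quotient_of q")
  have b0: "b > 0" using quotient_of_denom_pos[OF ab] .
  have d0: "d > 0" using d by (intro Nat.gr0I) auto
  have cop: "coprime a b" using quotient_of_coprime[OF ab] .
  have q: "q = of_int a / of_int b" using quotient_of_div[OF ab] .
  have "(of_int (a * int d) :: rat) = of_int (n * b)"
    using q b0 d0 unfolding q_def by (simp add: field_simps)
  hence ad: "a * int d = n * b" by (simp only: of_int_eq_iff)
  hence "b dvd a * int d" by simp
  hence bd: "b dvd int d" using cop by (simp add: coprime_commute coprime_dvd_mult_right_iff)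
  have "\<not> int CARD('p) dvd b"
  proof
    assume "int CARD('p) dvd b"
    hence "int CARD('p) dvd int d" using bd by (rule dvd_trans)
    with d show False by simp
  qed
  hence "coprime b (int CARD('p))"
    using prime_card_int[where 'a='p] by (metis coprime_commute prime_imp_coprime)
  from padic_int_of_rat[of q, where 'p='p] this ab
  have r: "of_int b * (padic_int_of_rat q :: 'p padic_int) = of_int a" by simp
  have "of_nat d * (of_int b * z) = of_int b * (of_nat d * z)" by (simp only: mult_ac)
  also have "\<dots> = of_int (n * b)" unfolding z by (simp add: mult.commute)
  also have "\<dots> = of_nat d * of_int a" unfolding ad[symmetric] by (simp add: mult.commute)
  finally have "of_int b * z = of_int a" using d0 by (subst (asm) mult_left_cancel) simp_all
  with r have "of_int b * (padic_int_of_rat q) = of_int b * z" by simp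
  thus ?thesis using b0 by (simp add: q_def)
qed

lemma padic_int_of_rat_mult:
  assumes "\<not> CARD('p::prime_card) dvd d"
  shows "of_nat d * (padic_int_of_rat (of_int n / of_nat d) :: 'p padic_int) = of_int n"
proof -
  have "(of_nat d :: 'p padic_int) dvd 1"
    using assms by (simp add: padic_int_is_unit_iff p_dvd_of_nat_iff)
  then obtain w where w: "1 = of_nat d * (w :: 'p padic_int)" by (elim dvdE)
  have "of_nat d * (of_int n * w) = of_int n" by (simp add: mult.left_commute flip: w)
  with padic_int_of_rat_eqI[OF assms this] show ?thesis by simp
qed

definition gauss_gamma :: "nat \<Rightarrow> 'p::prime_card padic_int" where
  "gauss_gamma r = Gamma_p (padic_int_of_rat (of_nat r / of_nat (CARD('p) - 1)))"

lemma p_not_dvd_p_minus_1: "\<not> CARD('p::prime_card) dvd CARD('p) - 1"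
  using prime_gt_1_nat[OF prime_card[where 'a='p]] by (intro nat_dvd_not_less) auto

lemma padic_int_of_rat_p_minus_1:
  "of_nat (CARD('p) - 1) * (padic_int_of_rat (of_nat r / of_nat (CARD('p) - 1)) :: 'p::prime_card padic_int) = of_nat r"
  using padic_int_of_rat_mult[OF p_not_dvd_p_minus_1, of "int r", where 'p='p] by simp

lemma lam_dwork_lim_gauss:
  assumes p: "CARD('p::prime_card) > 3" and r: "r < CARD('p) - 1" and x: "x ^ (CARD('p) - 1) = 1" "x \<in> padic_ball 0"
  shows "padic_lim (\<lambda>J. lam r J (dwork (x :: 'p padic)))
    (x ^ r * (padic_of_int (gauss_gamma r) / (1 - of_nat CARD('p))))"
  unfolding lam_dwork_root_of_unity[OF x(1)] gauss_gamma_def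
  using r by (intro padic_lim_scale lam_dwork_lim p padic_int_of_rat_p_minus_1 padic_ball_power x) simp

lemma gauss_gamma_0: "CARD('p::prime_card) > 3 \<Longrightarrow> gauss_gamma 0 = (1 :: 'p padic_int)"
  using padic_int_of_rat_p_minus_1[of 0, where 'p='p] by (simp add: gauss_gamma_def Gamma_p_0)

section \<open>A product formula for Jacobi sums\<close>

abbreviation teich :: "'p::prime_card mod_ring \<Rightarrow> 'p padic" where
  "teich x \<equiv> padic_of_int (teichmuller x)"

lemma mod_ring_fermat: "x \<noteq> 0 \<Longrightarrow> (x :: 'p::prime_card mod_ring) ^ (CARD('p) - 1) = 1"
proof -
  assume x: "x \<noteq> 0"
  have p0: "CARD('p) = Suc (CARD('p) - 1)" by simp
  have "x * x ^ (CARD('p) - 1) = x * 1"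
    using mod_ring_power_card[of x] p0 by (metis power_Suc mult_1_right)
  thus ?thesis using x by (metis mult_left_cancel)
qed

lemma teich_fermat: "x \<noteq> 0 \<Longrightarrow> teich (x :: 'p::prime_card mod_ring) ^ (CARD('p) - 1) = 1"
proof -
  assume "x \<noteq> 0"
  hence "teichmuller x ^ (CARD('p) - 1) = 1"
    by (metis teichmuller_power mod_ring_fermat teichmuller_simps(2))
  thus ?thesis by (simp only: padic_of_int_power[symmetric] padic_of_int_simps)
qed

lemma teich_power_card: "teich (x :: 'p::prime_card mod_ring) ^ CARD('p) = teich x"
  by (simp only: padic_of_int_power[symmetric] teichmuller_power_card)

text \<open>The component of degree zero of the additive character at \<open>z\<close>: the
  character is \<open>1\<close> at \<open>z = 0\<close>, and elsewhere its component is
  \<open>Gamma_p 0 / (1 - p)\<close>.\<close>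

definition dwork3_value :: "'p::prime_card mod_ring \<Rightarrow> 'p padic" where
  "dwork3_value z = (if z = 0 then 1 else 1 / (1 - of_nat CARD('p)))"

text \<open>Three Teichmuller representatives add up to the representative of
  \<open>x + y + 1\<close> plus a multiple of \<open>p\<close>, and the multiple of \<open>p\<close>
  is invisible at \<open>\<pi>\<close>.\<close>

lemma lam_dwork3_lim:
  fixes x y :: "'p::prime_card mod_ring"
  assumes p: "CARD('p) > 3"
  shows "padic_lim (\<lambda>J. lam 0 J (dwork (teich x) * (dwork (teich y) * dwork (teich 1)))) (dwork3_value (x + y + 1))"
proof -
  let ?P = "of_nat CARD('p) :: 'p padic"
  define z where "z = x + y + 1"
  have q0: "0 < CARD('p) - 1" using p by simp
  have "padic_reduce (teichmuller x + teichmuller y + teichmuller 1) = padic_reduce (teichmuller z)"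
    by (simp add: padic_reduce_hom z_def)
  hence "of_nat CARD('p) dvd teichmuller x + teichmuller y + teichmuller 1 - teichmuller z"
    by (simp only: padic_reduce_eq_iff)
  then obtain t where "teichmuller x + teichmuller y + teichmuller 1 - teichmuller z = of_nat CARD('p) * t"
    by (elim dvdE)
  hence "teichmuller x + teichmuller y + teichmuller 1 = teichmuller z + of_nat CARD('p) * t"
    by (simp add: algebra_simps)
  hence eq: "teich x + teich y + teich 1 = teich z + ?P * padic_of_int t"
    using arg_cong[of _ _ padic_of_int] by (metis padic_of_int_hom(1,4,7))
  have "dwork (teich x) * (dwork (teich y) * dwork (teich 1)) = dwork (teich x + teich y + teich 1)"
    by (simp only: dwork_add mult.assoc)
  also have "\<dots> = dwork (?P * padic_of_int t) * dwork (teich z)"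
    unfolding eq by (simp only: dwork_add mult.commute)
  finally have d: "dwork (teich x) * (dwork (teich y) * dwork (teich 1)) = dwork (?P * padic_of_int t) * dwork (teich z)" .
  have "lam_equiv (dwork (?P * padic_of_int t) * dwork (teich z)) (1 * dwork (teich z))"
    by (intro lam_equiv_mult lam_equiv_dwork_p growth_bounded_dwork_p growth_bounded_1
        growth_bounded_dwork_root_of_unity p padic_of_int_ball0 teich_power_card)
  moreover have "padic_lim (\<lambda>J. lam 0 J (1 * dwork (teich z))) (dwork3_value z)"
  proof (cases "z = 0")
    case True
    have "dwork 0 = (1 :: 'p padic fps)" by (simp add: dwork_def)
    hence "lam 0 (Suc J) (1 * dwork (teich z)) = 1" for J
      using lam_1[OF q0, of "Suc J"] True by (simp add: padic_of_int_simps)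
    hence "padic_lim (\<lambda>J. lam 0 (Suc J) (1 * dwork (teich z))) 1" by (simp add: padic_lim_const)
    thus ?thesis using True by (simp add: dwork3_value_def padic_lim_Suc)
  next
    case False
    thus ?thesis
      using lam_dwork_lim_gauss[OF p q0 teich_fermat[OF False]] gauss_gamma_0[OF p]
      by (simp add: dwork3_value_def padic_of_int_simps)
  qed
  ultimately show ?thesis
    unfolding d z_def[symmetric] by (rule lam_equiv_lim[OF _ q0])
qed

text \<open>The component of degree zero of the triple product is computed twice, by multiplying
  components and by \<open>lam_dwork3_lim\<close>. The cube clears the denominators
  \<open>1 - p\<close> of the three components. This is the Fourier expansion, in \<open>x\<close>
  and \<open>y\<close>, of the indicator of \<open>x + y + 1 = 0\<close> up to an affine
  change.\<close>

lemma jacobi_product: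
  fixes x y :: "'p::prime_card mod_ring"
  assumes p: "CARD('p) > 3" and x: "x \<noteq> 0" and y: "y \<noteq> 0"
  defines "q \<equiv> CARD('p) - 1"
  shows "(\<Sum>i<q. \<Sum>j<q. teich x ^ i * teich y ^ j *
      padic_of_int (gauss_gamma i * gauss_gamma j * gauss_gamma (conj_index q (conj_index q 0 i) j)) *
      (- of_nat CARD('p)) ^ ((if i \<le> 0 then 0 else 1) + (if j \<le> conj_index q 0 i then 0 else 1)))
    = (1 - of_nat CARD('p)) ^ 3 * dwork3_value (x + y + 1)"
proof -
  let ?P = "of_nat CARD('p) :: 'p padic"
  let ?g = "\<lambda>i. padic_of_int (gauss_gamma i) / (1 - ?P)"
  have q0: "0 < q" using p by (simp add: q_def)
  have one: "(1 :: 'p mod_ring) \<noteq> 0" by simp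
  note gb = growth_bounded_dwork_root_of_unity[OF p teich_power_card padic_of_int_ball0]
  have L: "padic_lim (\<lambda>J. lam i J (dwork (teich w))) (teich w ^ i * ?g i)" if "i < q" "w \<noteq> 0" for i and w :: "'p mod_ring"
    using that unfolding q_def by (intro lam_dwork_lim_gauss p teich_fermat) auto
  have 2: "padic_lim (\<lambda>J. lam r J (dwork (teich y) * dwork (teich 1)))
      (\<Sum>j<q. teich y ^ j * ?g j * (teich 1 ^ conj_index q r j * ?g (conj_index q r j)) * (- ?P) ^ (if j \<le> r then 0 else 1))" if "r < q" for r
    unfolding q_def by (rule lam_mult_lim[OF gb gb that[unfolded q_def] L[OF _ y, unfolded q_def] L[OF _ one, unfolded q_def]])
  have 1: "padic_lim (\<lambda>J. lam 0 J (dwork (teich x) * (dwork (teich y) * dwork (teich 1))))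
      (\<Sum>i<q. teich x ^ i * ?g i * (\<Sum>j<q. teich y ^ j * ?g j * (teich 1 ^ conj_index q (conj_index q 0 i) j *
        ?g (conj_index q (conj_index q 0 i) j)) * (- ?P) ^ (if j \<le> conj_index q 0 i then 0 else 1))
        * (- ?P) ^ (if i \<le> 0 then 0 else 1))"
    unfolding q_def by (rule lam_mult_lim[OF gb growth_bounded_mult[OF gb gb] q0[unfolded q_def] L[OF _ x, unfolded q_def] 2[unfolded q_def]])
  have nz: "1 - ?P \<noteq> 0"
    using p of_nat_eq_iff[of 1 "CARD('p)", where 'a="'p padic"] by simp
  have "(1 - ?P) ^ 3 * dwork3_value (x + y + 1) = (1 - ?P) ^ 3 *
      (\<Sum>i<q. teich x ^ i * ?g i * (\<Sum>j<q. teich y ^ j * ?g j * (teich 1 ^ conj_index q (conj_index q 0 i) j *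
        ?g (conj_index q (conj_index q 0 i) j)) * (- ?P) ^ (if j \<le> conj_index q 0 i then 0 else 1))
        * (- ?P) ^ (if i \<le> 0 then 0 else 1))"
    using padic_lim_unique[OF lam_dwork3_lim[OF p] 1] by simp
  also have "\<dots> = (\<Sum>i<q. \<Sum>j<q. teich x ^ i * teich y ^ j *
      padic_of_int (gauss_gamma i * gauss_gamma j * gauss_gamma (conj_index q (conj_index q 0 i) j)) *
      (- ?P) ^ ((if i \<le> 0 then 0 else 1) + (if j \<le> conj_index q 0 i then 0 else 1)))"
    unfolding sum_distrib_left sum_distrib_right
  proof (intro sum.cong refl)
    fix i j
    define k where "k = conj_index q (conj_index q 0 i) j"
    define e1 e2 where "e1 = (if i \<le> 0 then 0 else 1 :: nat)" and "e2 = (if j \<le> conj_index q 0 i then 0 else 1 :: nat)"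
    have alg: "D ^ 3 * (a * (g / D) * (b * (h / D) * (1 * (l / D)) * u) * v) = a * b * (g * h * l) * (v * u)"
      if "D \<noteq> 0" for D a b g h l u v :: "'p padic"
      using that by (simp add: field_simps power3_eq_cube)
    have t1: "teich 1 ^ k = (1 :: 'p padic)" by (simp add: padic_of_int_simps)
    show "(1 - ?P) ^ 3 * (teich x ^ i * ?g i * (teich y ^ j * ?g j * (teich 1 ^ k * ?g k) * (- ?P) ^ e2) * (- ?P) ^ e1)
      = teich x ^ i * teich y ^ j * padic_of_int (gauss_gamma i * gauss_gamma j * gauss_gamma k) * (- ?P) ^ (e1 + e2)"
      unfolding t1 padic_of_int_simps power_add by (rule alg[OF nz])
  qed
  finally show ?thesis ..
qed

section \<open>Summation over a fibre\<close>

lemma of_int_mod_ring_eq_0_iff: "(of_int a :: 'p::prime_card mod_ring) = 0 \<longleftrightarrow> int CARD('p) dvd a"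
proof -
  have "(of_int a :: 'p mod_ring) = 0 \<longleftrightarrow> to_int_mod_ring (of_int a :: 'p mod_ring) = to_int_mod_ring (0 :: 'p mod_ring)"
    by (metis of_int_mod_ring_to_int_mod_ring)
  thus ?thesis by (simp add: to_int_mod_ring_of_int dvd_eq_mod_eq_0)
qed

text \<open>Otherwise the polynomial \<open>x ^ e' - 1\<close>, with \<open>e'\<close> the nonzero
  remainder of \<open>e\<close> modulo \<open>p - 1\<close>, would have all \<open>p - 1\<close>
  nonzero elements as roots.\<close>

lemma exists_power_neq_1:
  assumes "\<not> (CARD('p::prime_card) - 1) dvd e"
  obtains g :: "'p::prime_card mod_ring" where "g \<noteq> 0" "g ^ e \<noteq> 1"
proof (rule ccontr)
  let ?q = "CARD('p) - 1"
  note witness = that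
  assume "\<not> thesis"
  hence all: "g ^ e = 1" if "g \<noteq> 0" for g :: "'p mod_ring" using that witness by blast
  define e' where "e' = e mod ?q"
  have p1: "CARD('p) > 1" by (rule prime_gt_1_nat) simp
  have e': "0 < e'" "e' < ?q" using assms p1 by (auto simp: e'_def dvd_eq_mod_eq_0)
  have all': "g ^ e' = 1" if g: "g \<noteq> 0" for g :: "'p mod_ring"
  proof -
    have "g ^ e = g ^ (?q * (e div ?q) + e')" by (simp only: e'_def mult_div_mod_eq)
    also have "\<dots> = g ^ e'" by (simp only: power_add power_mult mod_ring_fermat[OF g] power_one mult_1_left)
    finally show ?thesis using all[OF g] by simp
  qed
  define f where "f = (monom 1 e' - 1 :: 'p mod_ring poly)"
  have "coeff f e' = 1" using e' by (simp add: f_def coeff_1)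
  hence f0: "f \<noteq> 0" by auto
  have "degree f \<le> e'" unfolding f_def by (intro degree_diff_le) (auto simp: degree_monom_le)
  have "card (UNIV - {0 :: 'p mod_ring}) \<le> card {x. poly f x = 0}"
    using all' by (intro card_mono) (auto simp: f_def poly_monom)
  also have "\<dots> \<le> degree f" using f0 by (rule card_poly_roots_bound)
  also have "\<dots> \<le> e'" by fact
  finally show False using e' by (simp add: card_Diff_subset)
qed

lemma teich_power: "teich x ^ n = teich (x ^ n)"
  by (simp only: teichmuller_power padic_of_int_power)

lemma teich_mult: "teich (x * y) = teich x * teich y"
  by (simp only: teichmuller_simps padic_of_int_simps)

lemma teich_eq_1_iff: "teich x = 1 \<longleftrightarrow> x = 1"
  by (metis padic_of_int_eq_iff padic_of_int_simps(6) teichmuller_simps(2,4))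

lemma teich_eq_0_iff: "teich x = 0 \<longleftrightarrow> x = 0"
  by (metis padic_of_int_eq_iff padic_of_int_simps(5) teichmuller_simps(1,4) padic_reduce_hom(4))

lemma sum_teich_power:
  "(\<Sum>y\<in>UNIV - {0 :: 'p::prime_card mod_ring}. teich y ^ e) = (if (CARD('p) - 1) dvd e then of_nat (CARD('p) - 1) else 0)"
proof (cases "(CARD('p) - 1) dvd e")
  case True
  then obtain k where k: "e = (CARD('p) - 1) * k" by (elim dvdE)
  have "(\<Sum>y\<in>UNIV - {0 :: 'p mod_ring}. teich y ^ e) = (\<Sum>y\<in>UNIV - {0 :: 'p mod_ring}. 1)"
  proof (intro sum.cong refl)
    fix y :: "'p mod_ring" assume "y \<in> UNIV - {0}"
    hence "y \<noteq> 0" by simp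
    from teich_fermat[OF this] show "teich y ^ e = 1" by (simp only: k power_mult power_one)
  qed
  thus ?thesis using True by (simp add: card_Diff_subset)
next
  case False
  from exists_power_neq_1[OF False] obtain g :: "'p mod_ring" where g: "g \<noteq> 0" "g ^ e \<noteq> 1" .
  let ?S = "\<Sum>y\<in>UNIV - {0 :: 'p mod_ring}. teich y ^ e"
  have "teich g ^ e * ?S = (\<Sum>y\<in>UNIV - {0}. teich (g * y) ^ e)"
    by (simp only: sum_distrib_left teich_mult power_mult_distrib)
  also have "\<dots> = ?S"
    by (rule sum.reindex_bij_witness[where i = "\<lambda>y. y / g" and j = "\<lambda>y. g * y"]) (use g in auto)
  finally have "(teich g ^ e - 1) * ?S = 0" by (simp add: algebra_simps)
  moreover have "teich g ^ e \<noteq> 1" using g by (simp only: teich_power teich_eq_1_iff) simp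
  ultimately show ?thesis using False by simp
qed

text \<open>A Jacobi sum up to normalization, namely the product of the three
  \<open>\<pi> ^ l g(l)\<close> for \<open>l = i\<close>, \<open>j\<close> and \<open>k\<close>, the
  representative of \<open>- i - j\<close>. The exponent of \<open>- p\<close> is
  \<open>(i + j + k) / (p - 1)\<close>.\<close>

definition jacobi_term :: "nat \<Rightarrow> nat \<Rightarrow> 'p::prime_card padic" where
  "jacobi_term i j = (let q = CARD('p) - 1 in
    padic_of_int (gauss_gamma i * gauss_gamma j * gauss_gamma (conj_index q (conj_index q 0 i) j)) *
      (- of_nat CARD('p)) ^ ((if i \<le> 0 then 0 else 1) + (if j \<le> conj_index q 0 i then 0 else 1)))"

text \<open>Put \<open>x = u / y ^ 2\<close> in \<open>jacobi_product\<close> and sum over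
  \<open>y\<close>. Orthogonality of characters keeps only the index \<open>j\<close> congruent to
  \<open>2 i\<close>, and \<open>x + y + 1 = 0\<close>, multiplied by \<open>y ^ 2\<close>, is the
  cubic equation.\<close>

lemma jacobi_cubic:
  fixes u :: "'p::prime_card mod_ring"
  assumes p: "CARD('p) > 3" and u: "u \<noteq> 0"
  defines "q \<equiv> CARD('p) - 1"
  defines "N \<equiv> card {y. y ^ 3 + y ^ 2 + u = 0}"
  shows "(\<Sum>i<q. teich u ^ i * jacobi_term i (2 * i mod q)) = of_nat q * (of_nat q - of_nat CARD('p) * of_nat N)"
proof -
  let ?U = "UNIV - {0 :: 'p mod_ring}"
  let ?P = "of_nat CARD('p) :: 'p padic"
  have q0: "q > 0" using p by (simp add: q_def)
  have Pq: "1 - ?P = - of_nat q" using p by (simp add: q_def of_nat_diff)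
  have J: "(\<Sum>i<q. \<Sum>j<q. teich (u / y ^ 2) ^ i * teich y ^ j * jacobi_term i j)
      = (1 - ?P) ^ 3 * dwork3_value (u / y ^ 2 + y + 1)" if "y \<noteq> 0" for y
    using jacobi_product[OF p, of "u / y ^ 2" y] that u
    by (simp only: jacobi_term_def Let_def q_def mult.assoc) simp
  \<comment> \<open>The inverse of \<open>y\<close> is written as \<open>y ^ (q - 1)\<close> to keep
    all exponents natural numbers.\<close>
  have T: "teich (u / y ^ 2) ^ i * teich y ^ j = teich u ^ i * teich y ^ (j + 2 * i * (q - 1))" if y: "y \<noteq> 0" for y i j
  proof -
    have qq: "q = Suc (q - 1)" using q0 by simp
    have "y * y ^ (q - 1) = 1" using mod_ring_fermat[OF y, folded q_def] by (subst (asm) qq) simp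
    hence "inverse y = y ^ (q - 1)" by (rule inverse_unique)
    hence "inverse (y ^ 2) = (y ^ (q - 1)) ^ 2" by (metis power_inverse)
    hence "u / y ^ 2 = u * y ^ (2 * (q - 1))"
      by (simp only: divide_inverse power_mult[symmetric] mult.commute)
    thus ?thesis
      by (simp only: teich_mult power_mult_distrib teich_power power_add power_mult[symmetric] mult_ac)
  qed
  have div: "q dvd j + 2 * i * (q - 1) \<longleftrightarrow> j = 2 * i mod q" if "j < q" for i j
  proof -
    have "q dvd j + 2 * i * (q - 1) \<longleftrightarrow> [j + 2 * i * (q - 1) + 2 * i = 0 + 2 * i] (mod q)"
      by (simp only: cong_add_rcancel_nat cong_0_iff)
    also have "j + 2 * i * (q - 1) + 2 * i = j + 2 * i * q"
      using q0 by (cases q) simp_all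
    also have "[j + 2 * i * q = 0 + 2 * i] (mod q) \<longleftrightarrow> j = 2 * i mod q"
      using that by (simp add: cong_def)
    finally show ?thesis .
  qed
  have "(\<Sum>y\<in>?U. (1 - ?P) ^ 3 * dwork3_value (u / y ^ 2 + y + 1))
      = (\<Sum>y\<in>?U. \<Sum>i<q. \<Sum>j<q. teich u ^ i * jacobi_term i j * teich y ^ (j + 2 * i * (q - 1)))"
  proof (intro sum.cong refl)
    fix y assume "y \<in> ?U"
    hence y: "y \<noteq> 0" by simp
    show "(1 - ?P) ^ 3 * dwork3_value (u / y ^ 2 + y + 1)
      = (\<Sum>i<q. \<Sum>j<q. teich u ^ i * jacobi_term i j * teich y ^ (j + 2 * i * (q - 1)))"
      unfolding J[OF y, symmetric] T[OF y] by (simp only: mult_ac)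
  qed
  also have "\<dots> = (\<Sum>i<q. \<Sum>y\<in>?U. \<Sum>j<q. teich u ^ i * jacobi_term i j * teich y ^ (j + 2 * i * (q - 1)))"
    by (rule sum.swap)
  also have "\<dots> = (\<Sum>i<q. \<Sum>j<q. \<Sum>y\<in>?U. teich u ^ i * jacobi_term i j * teich y ^ (j + 2 * i * (q - 1)))"
    by (intro sum.cong refl sum.swap)
  also have "\<dots> = (\<Sum>i<q. \<Sum>j<q. if j = 2 * i mod q then teich u ^ i * jacobi_term i j * of_nat q else 0)"
  proof (intro sum.cong refl)
    fix i j assume "j \<in> {..<q}"
    hence j: "j < q" by simp
    show "(\<Sum>y\<in>?U. teich u ^ i * jacobi_term i j * teich y ^ (j + 2 * i * (q - 1)))
        = (if j = 2 * i mod q then teich u ^ i * jacobi_term i j * of_nat q else 0)"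
      unfolding sum_distrib_left[symmetric] sum_teich_power[where 'p='p, folded q_def] div[OF j]
      by simp
  qed
  also have "\<dots> = (\<Sum>i<q. teich u ^ i * jacobi_term i (2 * i mod q) * of_nat q)"
    using q0 by (simp add: sum.delta)
  finally have 1: "(\<Sum>y\<in>?U. (1 - ?P) ^ 3 * dwork3_value (u / y ^ 2 + y + 1))
      = (\<Sum>i<q. teich u ^ i * jacobi_term i (2 * i mod q)) * of_nat q"
    by (simp only: sum_distrib_right)
  define Z where "Z = {y. y ^ 3 + y ^ 2 + u = 0}"
  have ZU: "Z \<subseteq> ?U" using u by (auto simp: Z_def)
  have Z: "u / y ^ 2 + y + 1 = 0 \<longleftrightarrow> y \<in> Z" if "y \<in> ?U" for y
  proof -
    have y: "y ^ 2 \<noteq> 0" using that by simp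
    have "y ^ 3 + y ^ 2 + u = y ^ 2 * (u / y ^ 2 + y + 1)"
      using y by (simp add: distrib_left power3_eq_cube power2_eq_square)
    thus ?thesis using y by (simp add: Z_def)
  qed
  have NU: "card Z \<le> q"
    using card_mono[OF _ ZU] by (simp add: card_Diff_subset q_def)
  have "(\<Sum>y\<in>?U. dwork3_value (u / y ^ 2 + y + 1)) = (\<Sum>y\<in>Z. dwork3_value (u / y ^ 2 + y + 1)) + (\<Sum>y\<in>?U - Z. dwork3_value (u / y ^ 2 + y + 1))"
    using sum.subset_diff[OF ZU, of "\<lambda>y. dwork3_value (u / y ^ 2 + y + 1)"] by (simp add: add.commute)
  also have "(\<Sum>y\<in>Z. dwork3_value (u / y ^ 2 + y + 1)) = (\<Sum>y\<in>Z. 1)"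
    using Z ZU by (intro sum.cong refl) (auto simp: dwork3_value_def)
  also have "(\<Sum>y\<in>?U - Z. dwork3_value (u / y ^ 2 + y + 1)) = (\<Sum>y\<in>?U - Z. 1 / (1 - ?P))"
    using Z by (intro sum.cong refl) (auto simp: dwork3_value_def)
  also have "(\<Sum>y\<in>Z. 1) + (\<Sum>y\<in>?U - Z. 1 / (1 - ?P)) = of_nat N + of_nat (q - N) * (1 / (1 - ?P))"
    using ZU by (simp add: card_Diff_subset N_def Z_def q_def)
  also have "of_nat (q - N) = (of_nat q - of_nat N :: 'p padic)"
    using NU by (simp add: of_nat_diff N_def Z_def)
  finally have 2: "(\<Sum>y\<in>?U. (1 - ?P) ^ 3 * dwork3_value (u / y ^ 2 + y + 1))
      = (1 - ?P) ^ 3 * (of_nat N + (of_nat q - of_nat N) * (1 / (1 - ?P)))"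
    by (simp only: sum_distrib_left[symmetric])
  have P: "?P = of_nat q + 1" using Pq by (simp add: algebra_simps)
  have alg: "(- Q) ^ 3 * (n + (Q - n) * (1 / (- Q))) = Q * (Q - (Q + 1) * n) * Q" if "Q \<noteq> 0" for Q n :: "'p padic"
  proof -
    have "(- Q) ^ 3 * (n + (Q - n) * (1 / (- Q))) = (- Q) ^ 3 * n + (- Q) ^ 2 * (Q - n) * ((- Q) * (1 / (- Q)))"
      by (simp only: distrib_left power3_eq_cube power2_eq_square mult_ac)
    also have "(- Q) * (1 / (- Q)) = 1" using that by simp
    finally show ?thesis by (simp add: power3_eq_cube power2_eq_square algebra_simps)
  qed
  have "(\<Sum>i<q. teich u ^ i * jacobi_term i (2 * i mod q)) * of_nat q
      = (1 - ?P) ^ 3 * (of_nat N + (of_nat q - of_nat N) * (1 / (1 - ?P)))"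
    by (rule trans[OF 1[symmetric] 2])
  also have "\<dots> = of_nat q * (of_nat q - (of_nat q + 1) * of_nat N) * of_nat q"
    unfolding Pq using q0 by (intro alg) simp
  finally have "(\<Sum>i<q. teich u ^ i * jacobi_term i (2 * i mod q)) * of_nat q
      = of_nat q * (of_nat q - (of_nat q + 1) * of_nat N) * of_nat q" .
  thus ?thesis using q0 by (subst (asm) mult_right_cancel) (simp_all add: P)
qed

section \<open>The quadratic character\<close>

text \<open>By Euler's criterion both sides are congruent modulo \<open>p\<close>. The left one is
  \<open>1\<close> or \<open>- 1\<close> and the right one lies in \<open>{-1, 0, 1}\<close>, so
  they differ by at most \<open>2\<close>, which is less than \<open>p\<close>.\<close>

lemma teich_half_power:
  fixes a :: "'p::prime_card mod_ring"
  assumes p: "CARD('p) > 3" and a: "a \<noteq> 0"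
  shows "teichmuller a ^ ((CARD('p) - 1) div 2) = of_int (quadratic_char a)"
proof -
  let ?h = "(CARD('p) - 1) div 2"
  define A where "A = to_int_mod_ring a"
  have aA: "a = of_int A" by (simp add: A_def of_int_of_int_mod_ring)
  have odd: "odd CARD('p)" using p primes_dvd_imp_eq[of 2 "CARD('p)"] by auto
  hence h2: "?h * 2 = CARD('p) - 1" by simp
  define T where "T = teichmuller a ^ ?h"
  have "T ^ 2 = teichmuller (a ^ (CARD('p) - 1))"
    unfolding T_def power_mult[symmetric] h2 teichmuller_power ..
  also have "\<dots> = 1" by (simp only: mod_ring_fermat[OF a] teichmuller_simps)
  finally have T: "T = 1 \<or> T = -1" by (simp add: power2_eq_1_iff)
  define L where "L = quadratic_char a"
  have "[L = A ^ ?h] (mod int CARD('p))"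
    unfolding L_def quadratic_char_def A_def using p by (intro euler_criterion) auto
  hence "int CARD('p) dvd L - A ^ ?h" by (simp only: cong_iff_dvd_diff)
  hence "(of_int (L - A ^ ?h) :: 'p mod_ring) = 0" by (simp only: of_int_mod_ring_eq_0_iff)
  hence "of_int L = a ^ ?h" by (simp add: aA)
  hence "padic_reduce T = padic_reduce (of_int L)"
  proof -
    assume L: "of_int L = a ^ ?h"
    have "padic_reduce (of_int L :: 'p padic_int) = of_int L"
      by (cases L) (simp_all add: padic_reduce_of_nat padic_reduce_hom(2)[of 0, simplified] padic_reduce_hom(4) del: of_nat_Suc)
    thus ?thesis unfolding L T_def by (simp flip: teichmuller_power)
  qed
  hence d: "of_nat CARD('p) dvd T - of_int L" by (simp only: padic_reduce_eq_iff)
  have L3: "L = -1 \<or> L = 0 \<or> L = 1" by (auto simp: L_def quadratic_char_def Legendre_def)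
  have small: "k = 0" if "of_nat CARD('p) dvd (of_int k :: 'p padic_int)" "\<bar>k\<bar> \<le> 2" for k
  proof (rule ccontr)
    assume "k \<noteq> 0"
    moreover have "int CARD('p) dvd k" using that(1) by (simp only: p_dvd_of_int_iff)
    ultimately have "int CARD('p) \<le> \<bar>k\<bar>" by (intro zdvd_imp_le) auto
    thus False using that(2) p by simp
  qed
  have "T = of_int L"
    using T
  proof
    assume "T = 1"
    with d have "of_nat CARD('p) dvd (of_int (1 - L) :: 'p padic_int)" by simp
    from small[OF this] L3 have "1 - L = 0" by auto
    thus ?thesis using \<open>T = 1\<close> by simp
  next
    assume "T = -1"
    with d have "of_nat CARD('p) dvd (of_int (-1 - L) :: 'p padic_int)" by simp
    from small[OF this] L3 have "-1 - L = 0" by auto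
    hence "L = -1" by simp
    thus ?thesis using \<open>T = -1\<close> by simp
  qed
  thus ?thesis by (simp only: T_def L_def)
qed

section \<open>Rational arguments of the Gamma function\<close>

lemma Gamma_p_rat_multiplication:
  assumes p: "CARD('p::prime_card) > 3" and m: "\<not> CARD('p) dvd m" and r: "r \<le> CARD('p) - 1"
  shows "(\<Prod>h<m. Gamma_p_rat ((of_nat r / of_nat (CARD('p) - 1) + of_nat h) / of_nat m)) * teich (of_nat m) ^ (CARD('p) - 1 - r)
    = (Gamma_p_rat (of_nat r / of_nat (CARD('p) - 1)) * (\<Prod>h<m. Gamma_p_rat (of_nat h / of_nat m)) :: 'p padic)"
proof -
  let ?q = "CARD('p) - 1"
  have p2: "CARD('p) \<noteq> 2" using p by simp
  have q0: "?q > 0" using p by simp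
  have m0: "m > 0" using m by (intro Nat.gr0I) auto
  define z :: "'p padic_int" where "z = padic_int_of_rat (of_nat r / of_nat ?q)"
  define i :: "'p padic_int" where "i = padic_int_of_rat (1 / of_nat m)"
  have z: "of_nat ?q * z = of_nat r" unfolding z_def by (rule padic_int_of_rat_p_minus_1)
  have i: "of_nat m * i = 1" using padic_int_of_rat_mult[OF m, of 1] by (simp add: i_def)
  have 1: "padic_int_of_rat ((of_nat r / of_nat ?q + of_nat h) / of_nat m) = (z + of_nat h) * i" for h
  proof -
    have "\<not> CARD('p) dvd ?q * m" using m p_not_dvd_p_minus_1[where 'p='p] by (simp add: prime_dvd_mult_iff)
    moreover have "of_nat (?q * m) * ((z + of_nat h) * i) = of_int (int (r + h * ?q))"
    proof -
      have "of_nat (?q * m) * ((z + of_nat h) * i) = (of_nat ?q * z + of_nat h * of_nat ?q) * (of_nat m * i)"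
        by (simp only: of_nat_mult distrib_left distrib_right mult_ac)
      thus ?thesis by (simp only: z i) simp
    qed
    ultimately have "padic_int_of_rat (of_int (int (r + h * ?q)) / of_nat (?q * m)) = (z + of_nat h) * i"
      by (rule padic_int_of_rat_eqI)
    moreover have "(of_int (int (r + h * ?q)) / of_nat (?q * m) :: rat) = (of_nat r / of_nat ?q + of_nat h) / of_nat m"
      using q0 m0 by (simp add: field_simps del: of_nat_diff)
    ultimately show ?thesis by simp
  qed
  have 2: "padic_int_of_rat (of_nat h / of_nat m) = of_nat h * i" for h
  proof -
    have "of_nat m * (of_nat h * i) = of_int (int h)" using i by (simp add: mult.left_commute)
    from padic_int_of_rat_eqI[OF m this] show ?thesis by simp
  qed
  have "padic_of_int ((\<Prod>h<m. Gamma_p ((z + of_nat h) * i)) * teichmuller (of_nat m) ^ (?q - r))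
      = padic_of_int (Gamma_p z * (\<Prod>h<m. Gamma_p (of_nat h * i)))"
    by (simp only: Gamma_p_multiplication[OF p2 i z r])
  thus ?thesis by (simp only: 1 2 z_def[symmetric] padic_of_int_hom)
qed

lemma Gamma_p_rat_reflection:
  assumes p: "CARD('p::prime_card) > 3" and r: "r \<le> CARD('p) - 1"
  shows "Gamma_p_rat (of_nat r / of_nat (CARD('p) - 1)) * Gamma_p_rat (1 - of_nat r / of_nat (CARD('p) - 1))
    = (- ((-1) ^ r) :: 'p padic)"
proof -
  let ?q = "CARD('p) - 1"
  have p2: "CARD('p) \<noteq> 2" using p by simp
  have q0: "?q > 0" using p by simp
  define z :: "'p padic_int" where "z = padic_int_of_rat (of_nat r / of_nat ?q)"
  have z: "of_nat ?q * z = of_nat r" unfolding z_def by (rule padic_int_of_rat_p_minus_1)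
  have "of_nat ?q * (1 - z) = of_int (int (?q - r))"
    unfolding right_diff_distrib z mult_1_right of_int_of_nat_eq of_nat_diff[OF r]
    by (simp only: of_int_diff of_int_of_nat_eq)
  from padic_int_of_rat_eqI[OF p_not_dvd_p_minus_1 this]
  have "padic_int_of_rat (of_int (int (?q - r)) / of_nat ?q) = 1 - z" .
  moreover have "(of_int (int (?q - r)) / of_nat ?q :: rat) = 1 - of_nat r / of_nat ?q"
    unfolding of_int_of_nat_eq of_nat_diff[OF r] using q0 by (simp add: diff_divide_distrib del: of_nat_diff)
  ultimately have 1: "padic_int_of_rat (1 - of_nat r / of_nat ?q) = 1 - z" by simp
  have "padic_of_int (Gamma_p z * Gamma_p (1 - z)) = (padic_of_int (- ((-1) ^ r)) :: 'p padic)"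
    by (simp only: Gamma_p_reflection[OF p2 z r])
  thus ?thesis by (simp only: 1 z_def[symmetric] padic_of_int_hom)
qed

section \<open>Combinatorics of the parameters\<close>

text \<open>
  Substituting \<open>i = j + (p - 1) / 2\<close> turns the parameters into \<open>i\<close>, \<open>2 i\<close> and \<open>- 3 i\<close> modulo \<open>p - 1\<close>;
  the five cases are those of the position of \<open>x = j / (p - 1)\<close> relative to \<open>1/6\<close>, \<open>1/2\<close>, \<open>5/6\<close>.
\<close>

lemma parameter_identities:
  fixes G :: "rat \<Rightarrow> 'a::comm_monoid_mult"
  assumes h: "h > 0" and q: "q = 2 * h" and j: "j < q"
  defines "x \<equiv> of_nat j / of_nat q :: rat" and "i \<equiv> (j + h) mod q"
  defines "r2 \<equiv> 2 * i mod q"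
  defines "r3 \<equiv> conj_index q (conj_index q 0 i) r2"
  defines "E \<equiv> (if i \<le> 0 then 0 else 1) + (if r2 \<le> conj_index q 0 i then 0 else 1) :: nat"
  shows "frac x = x" "frac (x - 1/2) = of_nat i / of_nat q"
    "G x * G (of_nat i / of_nat q) = G (of_nat r2 / of_nat q / 2) * G ((of_nat r2 / of_nat q + 1) / 2)"
    "G (frac (1/6 - x)) * G (frac (5/6 - x)) * G (frac (1/2 - x)) =
      G (of_nat r3 / of_nat q / 3) * G ((of_nat r3 / of_nat q + 1) / 3) * G ((of_nat r3 / of_nat q + 2) / 3)"
    "i \<noteq> 0 \<Longrightarrow> frac (1/2 - x) = 1 - of_nat i / of_nat q" "i = 0 \<Longrightarrow> frac (1/2 - x) = 0"
    "i \<noteq> 0 \<Longrightarrow> - \<lfloor>1/6 - x\<rfloor> - \<lfloor>x\<rfloor> + (- \<lfloor>5/6 - x\<rfloor> - \<lfloor>1/2 + x\<rfloor>) = int E - 1"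
    "i = 0 \<Longrightarrow> - \<lfloor>1/6 - x\<rfloor> - \<lfloor>x\<rfloor> + (- \<lfloor>5/6 - x\<rfloor> - \<lfloor>1/2 + x\<rfloor>) = 0"
    "i = 0 \<Longrightarrow> r2 = 0 \<and> r3 = 0 \<and> E = 0" "r2 < q" "r3 < q"
proof -
  have q0: "q > 0" using h q by simp
  have qr: "of_nat q = (2 * of_nat h :: rat)" using q by simp
  have hr: "of_nat h > (0 :: rat)" using h by simp
  have jr: "of_nat j = x * (2 * of_nat h)" using hr by (simp add: x_def qr)
  have x01: "0 \<le> x" "x < 1"
    using j hr by (simp_all add: x_def divide_simps)
  show "r2 < q" using q0 by (simp add: r2_def)
  show "r3 < q" unfolding r3_def using q0 by (intro conj_index_less) (simp_all add: r2_def i_def)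
  have floorI: "\<lfloor>y\<rfloor> = k" if "of_int k \<le> y" "y < of_int k + 1" for y :: rat and k
    using that by linarith
  have fx: "\<lfloor>x\<rfloor> = 0" using x01 by (intro floorI) auto
  show "frac x = x" using x01 by (simp add: frac_eq)
  \<comment> \<open>The inequalities are weak at \<open>1/6\<close> and \<open>5/6\<close> because
    there \<open>\<lfloor>1/6 - x\<rfloor>\<close> and \<open>\<lfloor>5/6 - x\<rfloor>\<close>
    still have the values they take to the left. The point \<open>x = 1/2\<close> is the index
    \<open>i = 0\<close> of the trivial character.\<close>
  consider (a) "6 * j \<le> q" | (b) "q < 6 * j" "2 * j < q" | (c) "2 * j = q" | (d) "q < 2 * j" "6 * j \<le> 5 * q" | (e) "5 * q < 6 * j"
    by linarith
  hence "frac (x - 1/2) = of_nat i / of_nat q \<and>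
    G x * G (of_nat i / of_nat q) = G (of_nat r2 / of_nat q / 2) * G ((of_nat r2 / of_nat q + 1) / 2) \<and>
    G (frac (1/6 - x)) * G (frac (5/6 - x)) * G (frac (1/2 - x)) =
      G (of_nat r3 / of_nat q / 3) * G ((of_nat r3 / of_nat q + 1) / 3) * G ((of_nat r3 / of_nat q + 2) / 3) \<and>
    (i \<noteq> 0 \<longrightarrow> frac (1/2 - x) = 1 - of_nat i / of_nat q) \<and> (i = 0 \<longrightarrow> frac (1/2 - x) = 0) \<and>
    (i \<noteq> 0 \<longrightarrow> - \<lfloor>1/6 - x\<rfloor> - \<lfloor>x\<rfloor> + (- \<lfloor>5/6 - x\<rfloor> - \<lfloor>1/2 + x\<rfloor>) = int E - 1) \<and>
    (i = 0 \<longrightarrow> - \<lfloor>1/6 - x\<rfloor> - \<lfloor>x\<rfloor> + (- \<lfloor>5/6 - x\<rfloor> - \<lfloor>1/2 + x\<rfloor>) = 0) \<and>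
    (i = 0 \<longrightarrow> r2 = 0 \<and> r3 = 0 \<and> E = 0)"
  proof cases
    case a
    have xle: "x \<le> 1/6"
    proof -
      have "of_nat (6 * j) \<le> (of_nat q :: rat)" using a by (simp only: of_nat_le_iff)
      thus ?thesis using hr by (simp add: x_def qr divide_simps)
    qed
    have i: "i = j + h" using a q h by (simp add: i_def)
    have r2: "r2 = 2 * j" using a q h by (simp add: r2_def i mult_2 mod_if)
    have c: "conj_index q 0 i = h - j" using a q h by (auto simp: conj_index_def i)
    have r3: "r3 = h - 3 * j" "E = 1" using a q h by (auto simp: r3_def E_def c r2 i conj_index_def)
    have ir: "of_nat i / of_nat q = x + 1/2" using hr by (simp add: i qr jr field_simps)
    have r2r: "of_nat r2 / of_nat q = 2 * x" using hr by (simp add: r2 qr jr field_simps)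
    have "3 * j \<le> h" using a q by simp
    hence r3r: "of_nat r3 / of_nat q = 1/2 - 3 * x" using hr by (simp add: r3 of_nat_diff qr jr field_simps)
    have fl: "\<lfloor>x - 1/2\<rfloor> = -1" "\<lfloor>1/6 - x\<rfloor> = 0" "\<lfloor>5/6 - x\<rfloor> = 0" "\<lfloor>1/2 - x\<rfloor> = 0" "\<lfloor>1/2 + x\<rfloor> = 0"
      using xle x01 by (intro floorI; simp)+
    have i0: "i \<noteq> 0" using h by (simp add: i)
    \<comment> \<open>As \<open>G\<close> is arbitrary, the identities for \<open>G\<close> amount
      to equalities of multisets of arguments. These rewritings display the arguments on the right
      as the fractional parts on the left.\<close>
    have t: "2 * x / 2 = x" "(2 * x + 1) / 2 = x + 1/2" "(1/2 - 3 * x) / 3 = 1/6 - x"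
      "(1/2 - 3 * x + 1) / 3 = 1/2 - x" "(1/2 - 3 * x + 2) / 3 = 5/6 - x" by (simp_all add: field_simps)
    show ?thesis
      unfolding ir r2r r3r t frac_def fl fx using i0 by (simp add: r3 mult_ac)
  next
    case b
    have xle: "1/6 < x" "x < 1/2"
    proof -
      have "(of_nat q :: rat) < of_nat (6 * j)" "of_nat (2 * j) < (of_nat q :: rat)" using b by (simp_all only: of_nat_less_iff)
      thus "1/6 < x" "x < 1/2" using hr by (simp_all add: x_def qr divide_simps)
    qed
    have i: "i = j + h" using b q h by (simp add: i_def)
    have r2: "r2 = 2 * j" using b q h by (simp add: r2_def i mult_2 mod_if)
    have c: "conj_index q 0 i = h - j" using b q h by (auto simp: conj_index_def i)
    have r3: "r3 = 3 * h - 3 * j" "E = 2" using b q h by (auto simp: r3_def E_def c r2 i conj_index_def)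
    have ir: "of_nat i / of_nat q = x + 1/2" using hr by (simp add: i qr jr field_simps)
    have r2r: "of_nat r2 / of_nat q = 2 * x" using hr by (simp add: r2 qr jr field_simps)
    have "3 * j \<le> 3 * h" using b q by simp
    hence r3r: "of_nat r3 / of_nat q = 3/2 - 3 * x" using hr unfolding r3(1) by (simp only: of_nat_diff) (simp add: qr jr field_simps)
    have fl: "\<lfloor>x - 1/2\<rfloor> = -1" "\<lfloor>1/6 - x\<rfloor> = -1" "\<lfloor>5/6 - x\<rfloor> = 0" "\<lfloor>1/2 - x\<rfloor> = 0" "\<lfloor>1/2 + x\<rfloor> = 0"
      using xle x01 by (intro floorI; simp)+
    have i0: "i \<noteq> 0" using h by (simp add: i)
    have t: "2 * x / 2 = x" "(2 * x + 1) / 2 = x + 1/2" "(3/2 - 3 * x) / 3 = 1/2 - x"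
      "(3/2 - 3 * x + 1) / 3 = 5/6 - x" "(3/2 - 3 * x + 2) / 3 = 7/6 - x" by (simp_all add: field_simps)
    show ?thesis
      unfolding ir r2r r3r t frac_def fl fx using i0 by (simp add: r3 mult_ac)
  next
    case c
    have x: "x = 1/2"
    proof -
      have "(of_nat (2 * j) :: rat) = of_nat q" using c by (simp only: of_nat_eq_iff)
      thus ?thesis using hr by (simp add: x_def qr divide_simps)
    qed
    have i: "i = 0" using c q by (simp add: i_def flip: mult_2)
    have r: "r2 = 0" "r3 = 0" "E = 0" using q0 by (simp_all add: r2_def r3_def E_def i conj_index_def)
    have fl: "\<lfloor>1/6 - 1/2 :: rat\<rfloor> = -1" "\<lfloor>5/6 - 1/2 :: rat\<rfloor> = 0" "\<lfloor>1/2 - 1/2 :: rat\<rfloor> = 0" "\<lfloor>1/2 + 1/2 :: rat\<rfloor> = 1"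
      by (intro floorI; simp)+
    show ?thesis
      unfolding fx unfolding x frac_def fl by (simp add: i r mult_ac)
  next
    case d
    have xle: "1/2 < x" "x \<le> 5/6"
    proof -
      have "(of_nat q :: rat) < of_nat (2 * j)" "of_nat (6 * j) \<le> (of_nat (5 * q) :: rat)" using d by (simp_all only: of_nat_less_iff of_nat_le_iff)
      thus "1/2 < x" "x \<le> 5/6" using hr by (simp_all add: x_def qr divide_simps)
    qed
    have jh: "h < j" "3 * j \<le> 5 * h" "j < 2 * h" using d q j by simp_all
    have i: "i = j - h" using jh q by (simp add: i_def mod_if)
    have r2: "r2 = 2 * j - 2 * h" using jh q by (simp add: r2_def i mod_if diff_mult_distrib2)
    have c: "conj_index q 0 i = 3 * h - j" using jh q by (auto simp: conj_index_def i)
    have r3: "r3 = 5 * h - 3 * j" "E = 1" using jh q by (auto simp: r3_def E_def c r2 i conj_index_def)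
    have ir: "of_nat i / of_nat q = x - 1/2" using hr jh by (simp add: i of_nat_diff qr jr field_simps)
    have "2 * h \<le> 2 * j" using jh by simp
    hence r2r: "of_nat r2 / of_nat q = 2 * x - 1" using hr unfolding r2 by (simp only: of_nat_diff) (simp add: qr jr field_simps)
    have r3r: "of_nat r3 / of_nat q = 5/2 - 3 * x" using hr jh unfolding r3(1) by (simp only: of_nat_diff) (simp add: qr jr field_simps)
    have fl: "\<lfloor>x - 1/2\<rfloor> = 0" "\<lfloor>1/6 - x\<rfloor> = -1" "\<lfloor>5/6 - x\<rfloor> = 0" "\<lfloor>1/2 - x\<rfloor> = -1" "\<lfloor>1/2 + x\<rfloor> = 1"
      using xle x01 by (intro floorI; simp)+
    have i0: "i \<noteq> 0" using jh by (simp add: i)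
    have t: "(2 * x - 1) / 2 = x - 1/2" "(2 * x - 1 + 1) / 2 = x" "(5/2 - 3 * x) / 3 = 5/6 - x"
      "(5/2 - 3 * x + 1) / 3 = 7/6 - x" "(5/2 - 3 * x + 2) / 3 = 3/2 - x" by (simp_all add: field_simps)
    show ?thesis
      unfolding ir r2r r3r t frac_def fl fx using i0 by (simp add: r3 mult_ac)
  next
    case e
    have xle: "5/6 < x"
    proof -
      have "(of_nat (5 * q) :: rat) < of_nat (6 * j)" using e by (simp only: of_nat_less_iff)
      thus "5/6 < x" using hr by (simp add: x_def qr divide_simps)
    qed
    have jh: "h < j" "5 * h < 3 * j" "j < 2 * h" using e q j by simp_all
    have i: "i = j - h" using jh q by (simp add: i_def mod_if)
    have r2: "r2 = 2 * j - 2 * h" using jh q by (simp add: r2_def i mod_if diff_mult_distrib2)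
    have c: "conj_index q 0 i = 3 * h - j" using jh q by (auto simp: conj_index_def i)
    have r3: "r3 = 7 * h - 3 * j" "E = 2" using jh q by (auto simp: r3_def E_def c r2 i conj_index_def)
    have ir: "of_nat i / of_nat q = x - 1/2" using hr jh by (simp add: i of_nat_diff qr jr field_simps)
    have "2 * h \<le> 2 * j" using jh by simp
    hence r2r: "of_nat r2 / of_nat q = 2 * x - 1" using hr unfolding r2 by (simp only: of_nat_diff) (simp add: qr jr field_simps)
    have "3 * j \<le> 7 * h" using jh by simp
    hence r3r: "of_nat r3 / of_nat q = 7/2 - 3 * x" using hr jh unfolding r3(1) by (simp only: of_nat_diff) (simp add: qr jr field_simps)
    have fl: "\<lfloor>x - 1/2\<rfloor> = 0" "\<lfloor>1/6 - x\<rfloor> = -1" "\<lfloor>5/6 - x\<rfloor> = -1" "\<lfloor>1/2 - x\<rfloor> = -1" "\<lfloor>1/2 + x\<rfloor> = 1"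
      using xle x01 by (intro floorI; simp)+
    have i0: "i \<noteq> 0" using jh by (simp add: i)
    have t: "(2 * x - 1) / 2 = x - 1/2" "(2 * x - 1 + 1) / 2 = x" "(7/2 - 3 * x) / 3 = 7/6 - x"
      "(7/2 - 3 * x + 1) / 3 = 3/2 - x" "(7/2 - 3 * x + 2) / 3 = 11/6 - x" by (simp_all add: field_simps)
    show ?thesis
      unfolding ir r2r r3r t frac_def fl fx using i0 by (simp add: r3 mult_ac)
  qed
  thus "frac (x - 1/2) = of_nat i / of_nat q"
    "G x * G (of_nat i / of_nat q) = G (of_nat r2 / of_nat q / 2) * G ((of_nat r2 / of_nat q + 1) / 2)"
    "G (frac (1/6 - x)) * G (frac (5/6 - x)) * G (frac (1/2 - x)) =
      G (of_nat r3 / of_nat q / 3) * G ((of_nat r3 / of_nat q + 1) / 3) * G ((of_nat r3 / of_nat q + 2) / 3)"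
    "i \<noteq> 0 \<Longrightarrow> frac (1/2 - x) = 1 - of_nat i / of_nat q" "i = 0 \<Longrightarrow> frac (1/2 - x) = 0"
    "i \<noteq> 0 \<Longrightarrow> - \<lfloor>1/6 - x\<rfloor> - \<lfloor>x\<rfloor> + (- \<lfloor>5/6 - x\<rfloor> - \<lfloor>1/2 + x\<rfloor>) = int E - 1"
    "i = 0 \<Longrightarrow> - \<lfloor>1/6 - x\<rfloor> - \<lfloor>x\<rfloor> + (- \<lfloor>5/6 - x\<rfloor> - \<lfloor>1/2 + x\<rfloor>) = 0"
    "i = 0 \<Longrightarrow> r2 = 0 \<and> r3 = 0 \<and> E = 0"
    by blast+
qed

section \<open>McCarthy's function\<close>

definition mccarthy_term :: "nat \<Rightarrow> 'p::prime_card padic" where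
  "mccarthy_term j = (let x = of_nat j / of_nat (CARD('p) - 1) in
    ((- of_nat CARD('p)) powi (- \<lfloor>1/6 - x\<rfloor> - \<lfloor>x\<rfloor>) *
      (Gamma_p_rat (frac (1/6 - x)) / Gamma_p_rat (1/6)) * (Gamma_p_rat (frac x) / Gamma_p_rat 0)) *
    ((- of_nat CARD('p)) powi (- \<lfloor>5/6 - x\<rfloor> - \<lfloor>1/2 + x\<rfloor>) *
      (Gamma_p_rat (frac (5/6 - x)) / Gamma_p_rat (5/6)) * (Gamma_p_rat (frac (x - 1/2)) / Gamma_p_rat (1/2))))"

lemma G2_tilde_expand:
  assumes "CARD('p::prime_card) > 3"
  shows "G2_tilde (t :: 'p mod_ring) =
    - 1 / of_nat (CARD('p) - 1) * (\<Sum>j<CARD('p) - 1. teichmuller_bar_pow j t * mccarthy_term j)"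
proof -
  have ivl: "{0..CARD('p) - 2} = {..<CARD('p) - 1}" using assms by auto
  have fr: "frac (1/6 :: rat) = 1/6" "frac (5/6 :: rat) = 5/6" "frac (1/2 :: rat) = 1/2"
    by (simp_all add: frac_eq)
  have fm: "frac (- (1/2) :: rat) = 1/2" unfolding frac_unique_iff by simp
  have f0: "frac (- 0 :: rat) = 0" by simp
  have m: "- 0 + x = x" "- (1/2) + x = x - 1/2" for x :: rat by simp_all
  have prod2: "(\<Prod>k<length [a, a']. F ([a, a'] ! k) ([b, b'] ! k)) = F a b * F a' b'"
    for F :: "rat \<Rightarrow> rat \<Rightarrow> 'p padic" and a a' b b'
    by (simp add: lessThan_Suc mult.commute)
  have sgn: "(-1) ^ (j * length [1/6, 5/6 :: rat]) = (1 :: 'p padic)" for j by simp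
  show ?thesis
    unfolding G2_tilde_def mccarthy_G_def Let_def ivl sgn mult_1_left
      prod2[of "\<lambda>a b. (- of_nat CARD('p)) powi (- \<lfloor>frac a - of_nat j / of_nat (CARD('p) - 1)\<rfloor>
          - \<lfloor>frac (- b) + of_nat j / of_nat (CARD('p) - 1)\<rfloor>) *
        (Gamma_p_rat (frac (a - of_nat j / of_nat (CARD('p) - 1))) / Gamma_p_rat (frac a)) *
        (Gamma_p_rat (frac (- b + of_nat j / of_nat (CARD('p) - 1))) / Gamma_p_rat (frac (- b)))" for j]
      fr fm f0 m mccarthy_term_def add_0
    by (rule refl)
qed

lemma Gamma_p_rat_nonzero: "CARD('p) \<noteq> 2 \<Longrightarrow> (Gamma_p_rat a :: 'p::prime_card padic) \<noteq> 0"
  using Gamma_p_nonzero padic_of_int_eq_iff padic_of_int_simps(5) by metis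

lemma gauss_gamma_eq: "padic_of_int (gauss_gamma r) = (Gamma_p_rat (of_nat r / of_nat (CARD('p) - 1)) :: 'p::prime_card padic)"
  by (simp only: gauss_gamma_def)

lemma teich_minus_1: "CARD('p) > 3 \<Longrightarrow> teich (-1 :: 'p::prime_card mod_ring) = -1"
proof -
  assume p: "CARD('p) > 3"
  have "teichmuller (-1 :: 'p mod_ring) ^ 2 = 1" by (simp flip: teichmuller_power)
  moreover have "teichmuller (-1 :: 'p mod_ring) \<noteq> 1"
  proof
    assume "teichmuller (-1 :: 'p mod_ring) = 1"
    hence "(-1 :: 'p mod_ring) = 1" by (metis teichmuller_simps(4) padic_reduce_hom(5))
    hence "(of_int 2 :: 'p mod_ring) = 0" by (simp add: eq_neg_iff_add_eq_0)
    hence "int CARD('p) dvd 2" by (simp only: of_int_mod_ring_eq_0_iff)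
    with p show False by (auto dest: zdvd_imp_le)
  qed
  ultimately have "teichmuller (-1 :: 'p mod_ring) = -1" by (auto simp: power2_eq_1_iff)
  thus ?thesis by (simp only: padic_of_int_simps)
qed

text \<open>Duplication merges the Gamma factors at \<open>x\<close> and \<open>i / q\<close> into
  \<open>g(2 i)\<close>. Those at \<open>1/6 - x\<close> and \<open>5/6 - x\<close> lack the one at
  \<open>1/2 - x\<close> for triplication to give \<open>g(- 3 i)\<close>; reflection exchanges
  division by this factor for multiplication by \<open>g(i)\<close>. At \<open>i = 0\<close> the
  missing factor is \<open>1\<close> and no reflection takes place, hence the exceptional
  value.\<close>

lemma mccarthy_term_value:
  fixes t :: "'p::prime_card mod_ring"
  assumes p: "CARD('p) > 3" and t: "t \<noteq> 0" and j: "j < CARD('p) - 1"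
  defines "q \<equiv> CARD('p) - 1"
  defines "h \<equiv> q div 2"
  defines "i \<equiv> (j + h) mod q"
  shows "teichmuller_bar_pow j t * mccarthy_term j = of_int (quadratic_char (3 * t)) *
    (if i = 0 then 1 else teich (- 4 / (27 * t)) ^ i * jacobi_term i (2 * i mod q) / of_nat CARD('p))"
proof -
  let ?P = "of_nat CARD('p) :: 'p padic"
  let ?G = "Gamma_p_rat :: rat \<Rightarrow> 'p padic"
  let ?T2 = "teich (of_nat 2 :: 'p mod_ring)" and ?T3 = "teich (of_nat 3 :: 'p mod_ring)" and ?Tt = "teich t"
  define x where "x = (of_nat j / of_nat q :: rat)"
  define r2 where "r2 = 2 * i mod q"
  define r3 where "r3 = conj_index q (conj_index q 0 i) r2"
  define E where "E = (if i \<le> 0 then 0 else 1) + (if r2 \<le> conj_index q 0 i then 0 else 1 :: nat)"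
  have p2: "CARD('p) \<noteq> 2" using p by simp
  have odd: "odd CARD('p)" using p2 primes_dvd_imp_eq[of 2 "CARD('p)"] by auto
  have q0: "q > 0" using p by (simp add: q_def)
  have qh: "q = 2 * h" using odd by (simp add: q_def h_def)
  have h0: "h > 0" using p by (simp add: h_def q_def)
  have jq: "j < q" using j by (simp add: q_def)
  note par = parameter_identities[OF h0 qh jq, folded x_def i_def, folded r2_def, folded r3_def, folded E_def]
  have iq: "i < q" using q0 by (simp add: i_def)
  have nd: "\<not> CARD('p) dvd 2" "\<not> CARD('p) dvd 3" using p by (auto dest: dvd_imp_le)
  have nz: "(of_nat 2 :: 'p mod_ring) \<noteq> 0" "(of_nat 3 :: 'p mod_ring) \<noteq> 0"
    using nd of_int_mod_ring_eq_0_iff[of 2, where 'p='p] of_int_mod_ring_eq_0_iff[of 3, where 'p='p]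
    by (auto simp: int_dvd_int_iff[of _ 2, simplified] int_dvd_int_iff[of _ 3, simplified])
  have T: "?T2 ^ q = 1" "?T3 ^ q = 1" "?Tt ^ q = 1"
    unfolding q_def by (intro teich_fermat nz t)+
  have Tnz: "?T2 \<noteq> 0" "?T3 \<noteq> 0" "?Tt \<noteq> 0" using nz t by (simp_all only: teich_eq_0_iff not_False_eq_True)
  have Gnz: "?G a \<noteq> 0" for a by (rule Gamma_p_rat_nonzero[OF p2])
  have G0: "?G 0 = 1"
    using gauss_gamma_0[OF p] gauss_gamma_eq[of 0, where 'p='p] by (simp add: padic_of_int_simps)
  define g where "g = (\<lambda>r. ?G (of_nat r / of_nat q))"
  have pw: "a ^ (q - r) * a ^ r = 1" if "a ^ q = 1" "r \<le> q" for a :: "'p padic" and r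
    using that by (simp flip: power_add)
  have "g r2 * ?G (1/2) = (?G x * g i) * ?T2 ^ (q - r2)"
  proof -
    have "(\<Prod>h<2. ?G ((of_nat r2 / of_nat q + of_nat h) / of_nat 2)) * ?T2 ^ (q - r2) = g r2 * (\<Prod>h<2. ?G (of_nat h / of_nat 2))"
      unfolding g_def q_def
      by (rule Gamma_p_rat_multiplication[OF p nd(1)]) (use par(10) in \<open>simp add: q_def\<close>)
    thus ?thesis using par(3)[of ?G] by (simp add: numeral_2_eq_2 lessThan_Suc G0 g_def mult_ac)
  qed
  hence "g r2 * ?G (1/2) * ?T2 ^ r2 = (?G x * g i) * (?T2 ^ (q - r2) * ?T2 ^ r2)"
    by (simp only: mult.assoc)
  hence A: "?G x * g i = g r2 * ?G (1/2) * ?T2 ^ r2"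
    by (simp only: pw[OF T(1) less_imp_le[OF par(10)]] mult_1_right)
  define A3 where "A3 = ?G (1/3) * ?G (2/3)"
  have mult3: "?G (y / 3) * ?G ((y + 1) / 3) * ?G ((y + 2) / 3) = ?G y * A3 * ?T3 ^ r"
    if y: "y = of_nat r / of_nat q" and r: "r \<le> q" for y r
  proof -
    have "(\<Prod>h<3. ?G ((of_nat r / of_nat q + of_nat h) / of_nat 3)) * ?T3 ^ (q - r) = ?G (of_nat r / of_nat q) * (\<Prod>h<3. ?G (of_nat h / of_nat 3))"
      unfolding q_def by (rule Gamma_p_rat_multiplication[OF p nd(2)]) (use r in \<open>simp add: q_def\<close>)
    hence "(?G (y / 3) * ?G ((y + 1) / 3) * ?G ((y + 2) / 3)) * ?T3 ^ (q - r) = ?G y * A3"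
      unfolding y[symmetric] by (simp add: numeral_3_eq_3 lessThan_Suc G0 A3_def mult_ac)
    hence "(?G (y / 3) * ?G ((y + 1) / 3) * ?G ((y + 2) / 3)) * (?T3 ^ (q - r) * ?T3 ^ r) = ?G y * A3 * ?T3 ^ r"
      by (simp only: mult.assoc[symmetric])
    thus ?thesis by (simp only: pw[OF T(2) r] mult_1_right)
  qed
  define f1 f3 f5 where "f1 = ?G (frac (1/6 - x))" and "f3 = ?G (frac (1/2 - x))" and "f5 = ?G (frac (5/6 - x))"
  have B: "f1 * f5 * f3 = g r3 * A3 * ?T3 ^ r3"
    unfolding f1_def f3_def f5_def par(4)[of ?G] g_def using par(11) by (intro mult3) auto
  \<comment> \<open>Triplication at \<open>1/2\<close> evaluates the normalizing denominators at
    \<open>1/6\<close> and \<open>5/6\<close>. The half power of the representative of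
    \<open>3\<close> that it leaves becomes the \<open>3\<close> in
    \<open>quadratic_char (3 * t)\<close>.\<close>
  have half: "(of_nat h / of_nat q :: rat) = 1/2" using h0 by (simp add: qh)
  have "?G (1/2 / 3) * ?G ((1/2 + 1) / 3) * ?G ((1/2 + 2) / 3) = ?G (1/2) * A3 * ?T3 ^ h"
    by (rule mult3[OF half[symmetric]]) (simp add: qh)
  hence "?G (1/2) * (?G (1/6) * ?G (5/6)) = ?G (1/2) * (A3 * ?T3 ^ h)"
    by (simp add: mult_ac)
  hence B0: "?G (1/6) * ?G (5/6) = A3 * ?T3 ^ h"
    using Gnz[of "1/2"] by (simp only: mult_left_cancel not_False_eq_True)
  have T3h: "?T3 ^ h * ?T3 ^ h = 1" "?Tt ^ h * ?Tt ^ h = 1"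
    using T by (simp_all add: qh mult_2 power_add)
  define V where "V = (f1 * ?G x * f5 * g i) / (?G (1/6) * ?G (5/6) * ?G (1/2))"
  have A3nz: "A3 \<noteq> 0" using Gnz by (simp add: A3_def)
  have "V * f3 = (f1 * f5 * f3) * (?G x * g i) / (?G (1/6) * ?G (5/6) * ?G (1/2))"
    by (simp only: V_def times_divide_eq_left times_divide_eq_right mult_ac)
  also have "\<dots> = (g r3 * A3 * ?T3 ^ r3) * (g r2 * ?G (1/2) * ?T2 ^ r2) * (?T3 ^ h * ?T3 ^ h) / (A3 * ?T3 ^ h * ?G (1/2))"
    by (simp only: A B B0 T3h mult_1_right)
  also have "\<dots> = g r2 * g r3 * ?T3 ^ h * (?T3 ^ r3 * ?T2 ^ r2)"
    using A3nz Gnz[of "1/2"] Tnz by (simp add: field_simps)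
  finally have Vf3: "V * f3 = g r2 * g r3 * ?T3 ^ h * (?T3 ^ r3 * ?T2 ^ r2)" .
  have mt: "mccarthy_term j = (- ?P) powi (- \<lfloor>1/6 - x\<rfloor> - \<lfloor>x\<rfloor> + (- \<lfloor>5/6 - x\<rfloor> - \<lfloor>1/2 + x\<rfloor>)) * V"
  proof -
    have mP: "- ?P \<noteq> 0" by simp
    show ?thesis
      unfolding mccarthy_term_def Let_def q_def[symmetric] x_def[symmetric] par(1,2) G0 V_def f1_def f5_def g_def
        power_int_add[OF disjI1[OF mP]]
      by (simp only: div_by_1 times_divide_eq_left times_divide_eq_right divide_divide_eq_left mult_ac)
  qed
  have u3t: "(of_int (quadratic_char (3 * t)) :: 'p padic) = ?T3 ^ h * ?Tt ^ h"
  proof -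
    have "3 * t \<noteq> 0" using nz(2) t by simp
    from teich_half_power[OF p this] have "(of_int (quadratic_char (3 * t)) :: 'p padic) = teich (3 * t) ^ h"
      unfolding h_def q_def by (metis padic_of_int_of_int padic_of_int_power)
    thus ?thesis by (simp only: teich_mult power_mult_distrib of_nat_numeral)
  qed
  define W where "W = inverse ?Tt"
  have Wt: "?Tt * W = 1" using Tnz by (simp add: W_def)
  have Wq: "W ^ q = 1" using T by (simp add: W_def power_inverse)
  have Wh: "W ^ h = ?Tt ^ h" using T3h(2) by (simp add: W_def power_inverse inverse_unique)
  \<comment> \<open>Shifting the index by half of \<open>q\<close> splits off the half power of the
    character, which is its own inverse and yields the quadratic character of
    \<open>t\<close>.\<close>
  have bar: "teichmuller_bar_pow j t = W ^ i * ?Tt ^ h"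
  proof -
    have "W ^ j = W ^ (j + h) * W ^ h"
      using Wq by (simp add: power_add qh mult_2 mult.assoc)
    also have "W ^ (j + h) = W ^ (q * ((j + h) div q) + i)" by (simp only: i_def mult_div_mod_eq)
    also have "\<dots> = W ^ i" by (simp add: power_add power_mult Wq)
    finally show ?thesis using t by (simp add: teichmuller_bar_pow_def W_def[symmetric] Wh)
  qed
  show ?thesis
  proof (cases "i = 0")
    case True
    have "f3 = 1" unfolding f3_def par(6)[OF True] by (rule G0)
    hence "V = ?T3 ^ h" using Vf3 par(9)[OF True] True by (simp add: g_def G0)
    thus ?thesis
      using True par(8) by (simp add: mt bar u3t)
  next
    case False
    have "g i * f3 = - ((-1) ^ i)"
      using Gamma_p_rat_reflection[OF p, of i] iq par(5)[OF False] by (simp add: g_def f3_def q_def)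
    hence gf: "f3 * g i = - ((-1) ^ i)" by (simp only: mult.commute)
    have Vfg: "V * (f3 * g i) = g i * g r2 * g r3 * ?T3 ^ h * (?T3 ^ r3 * ?T2 ^ r2)"
      unfolding mult.assoc[symmetric] Vf3 by (simp only: mult_ac)
    have "V = (V * (f3 * g i)) * - ((-1) ^ i)"
      unfolding gf by (simp add: mult.assoc flip: power_mult_distrib)
    hence V: "V = - ((-1) ^ i * (g i * g r2 * g r3 * ?T3 ^ h * (?T3 ^ r3 * ?T2 ^ r2)))"
      unfolding Vfg by (simp only: mult_minus_left mult_minus_right mult.commute)
    have red: "a ^ r2 = a ^ (2 * i)" if "a ^ q = 1" for a :: "'p padic"
    proof -
      have "a ^ (2 * i) = a ^ (q * (2 * i div q) + r2)" by (simp only: r2_def mult_div_mod_eq)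
      thus ?thesis by (simp add: power_add power_mult that)
    qed
    \<comment> \<open>The three exponents sum to a multiple of \<open>q\<close>. So the power
      \<open>r3\<close> of the representative of \<open>3\<close>, left by triplication, is the
      inverse of its power \<open>3 i\<close>.\<close>
    have Eq: "i + r2 + r3 = E * q"
      using iq par(10) by (auto simp: E_def r3_def conj_index_def)
    have e3: "3 * i = i + 2 * i" by simp
    have "?T3 ^ r3 * ?T3 ^ (3 * i) = ?T3 ^ r3 * (?T3 ^ i * ?T3 ^ r2)"
      unfolding e3 power_add red[OF T(2)] ..
    also have "\<dots> = ?T3 ^ (i + r2 + r3)" by (simp only: power_add mult_ac)
    also have "\<dots> = 1" unfolding Eq by (simp only: mult.commute[of E] power_mult T(2) power_one)
    finally have T33: "?T3 ^ r3 * (?T3 ^ 3) ^ i = 1" by (simp only: power_mult)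
    \<comment> \<open>Origin of the constant: the sign \<open>(-1) ^ i\<close> comes from
      reflection, \<open>4 ^ i\<close> from duplication, \<open>27 ^ i\<close> in the denominator
      from triplication, and \<open>t ^ i\<close> in the denominator from the inverse Teichmuller
      character.\<close>
    define u where "u = (- 4 / (27 * t) :: 'p mod_ring)"
    have "u * (of_nat 3 ^ 3 * t) = -1 * of_nat 2 ^ 2"
    proof -
      have e: "of_nat 3 ^ 3 * t = 27 * t" "-1 * of_nat 2 ^ 2 = (-4 :: 'p mod_ring)" by simp_all
      have "of_nat 3 ^ 3 * t \<noteq> 0"
        unfolding mult_eq_0_iff power_eq_0_iff using nz(2) t by blast
      hence "27 * t \<noteq> 0" by (simp only: e not_False_eq_True)
      thus ?thesis unfolding e u_def by (simp only: times_divide_eq_left nonzero_mult_div_cancel_right not_False_eq_True)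
    qed
    from arg_cong[OF this, of "\<lambda>x. teich x"] have "teich u * (?T3 ^ 3 * ?Tt) = -1 * ?T2 ^ 2"
      by (simp only: teich_mult teich_power[symmetric] teich_minus_1[OF p])
    hence u4: "teich u * (?T3 ^ 3 * ?Tt) = - (?T2 ^ 2)" by (simp only: mult_minus1)
    have "(teich u * (?T3 ^ 3 * ?Tt)) ^ i = (-1) ^ i * (?T2 ^ 2) ^ i"
      unfolding u4 by (rule power_minus)
    hence "teich u ^ i * ((?T3 ^ 3) ^ i * ?Tt ^ i) = (-1) ^ i * ?T2 ^ (2 * i)"
      by (simp only: power_mult_distrib power_mult)
    hence u5: "(teich u ^ i * ((?T3 ^ 3) ^ i * ?Tt ^ i)) * (?T3 ^ r3 * W ^ i) = ((-1) ^ i * ?T2 ^ (2 * i)) * (?T3 ^ r3 * W ^ i)"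
      by (rule arg_cong)
    have u6: "(teich u ^ i * ((?T3 ^ 3) ^ i * ?Tt ^ i)) * (?T3 ^ r3 * W ^ i) = teich u ^ i * (?T3 ^ r3 * (?T3 ^ 3) ^ i) * (?Tt * W) ^ i"
      by (simp only: power_mult_distrib mult_ac)
    have tu: "teich u ^ i = (-1) ^ i * ?T2 ^ r2 * ?T3 ^ r3 * W ^ i"
      using trans[OF u6[symmetric] u5] unfolding T33 Wt red[OF T(1)] by (simp only: mult.assoc power_one mult_1_right)
    have jt: "jacobi_term i r2 = g i * g r2 * g r3 * (- ?P) ^ E"
      unfolding jacobi_term_def Let_def padic_of_int_simps gauss_gamma_eq
      unfolding q_def[symmetric] unfolding r3_def[symmetric] E_def[symmetric] g_def by (rule refl)
    have mP: "- ?P \<noteq> 0" by simp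
    have "(- ?P) powi (int E - 1) = (- ?P) ^ E / (- ?P)"
      using mP by (simp add: power_int_diff)
    hence "teichmuller_bar_pow j t * mccarthy_term j = (W ^ i * ?Tt ^ h) * ((- ?P) ^ E / (- ?P) *
        - ((-1) ^ i * (g i * g r2 * g r3 * ?T3 ^ h * (?T3 ^ r3 * ?T2 ^ r2))))"
      unfolding mt par(7)[OF False] bar V by simp
    also have "\<dots> = (?T3 ^ h * ?Tt ^ h) * (((-1) ^ i * ?T2 ^ r2 * ?T3 ^ r3 * W ^ i) * (g i * g r2 * g r3 * (- ?P) ^ E) / ?P)"
      by (simp add: mult_ac)
    finally have "teichmuller_bar_pow j t * mccarthy_term j = \<dots>" .
    thus ?thesis
      unfolding r2_def[symmetric] u_def[symmetric] if_not_P[OF False] jt tu u3t .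
  qed
qed

lemma jacobi_term_0: "CARD('p::prime_card) > 3 \<Longrightarrow> (jacobi_term 0 0 :: 'p padic) = 1"
  using gauss_gamma_0[where 'p='p] by (simp add: jacobi_term_def conj_index_def padic_of_int_simps)

lemma mod_ring_numeral_nonzero:
  assumes p: "CARD('p::prime_card) > 3"
  shows "(2 :: 'p mod_ring) \<noteq> 0" "(3 :: 'p mod_ring) \<noteq> 0" "(4 :: 'p mod_ring) \<noteq> 0" "(27 :: 'p mod_ring) \<noteq> 0"
proof -
  have nz: "(of_int k :: 'p mod_ring) \<noteq> 0" if "0 < k" "k \<le> 3" for k
    using that p by (auto simp: of_int_mod_ring_eq_0_iff dest: zdvd_imp_le)
  show 2: "(2 :: 'p mod_ring) \<noteq> 0" and 3: "(3 :: 'p mod_ring) \<noteq> 0" using nz[of 2] nz[of 3] by simp_all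
  have e: "2 ^ 2 = (4 :: 'p mod_ring)" "3 ^ 3 = (27 :: 'p mod_ring)" by simp_all
  show "(4 :: 'p mod_ring) \<noteq> 0" "(27 :: 'p mod_ring) \<noteq> 0"
    using power_not_zero[OF 2, of 2] power_not_zero[OF 3, of 3] unfolding e .
qed

text \<open>Replacing \<open>y\<close> by \<open>- y\<close> and dividing by \<open>- 27\<close>
  turns the cubic that defines \<open>S_roots\<close> into the one produced by the Jacobi
  sums.\<close>

lemma card_S_roots:
  fixes t :: "'p::prime_card mod_ring"
  assumes p: "CARD('p) > 3" and t: "t \<noteq> 0"
  shows "card {y. y ^ 3 + y ^ 2 + - 4 / (27 * t) = 0} = card (S_roots t)"
proof -
  define w where "w = 4 / (27 * t)"
  note n27 = mod_ring_numeral_nonzero(4)[OF p]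
  have w: "- 4 / (27 * t) = - w" "4 / t = 27 * w"
    by (simp add: w_def) (simp only: w_def times_divide_eq_right mult_divide_mult_cancel_left[OF n27])
  have eq: "(- y) \<in> S_roots t \<longleftrightarrow> y ^ 3 + y ^ 2 + - w = 0" for y
  proof -
    have k: "27 * (- y) ^ 3 - 27 * (- y) ^ 2 + 27 * w = - 27 * (y ^ 3 + y ^ 2 + - w)"
      by (simp add: algebra_simps power2_eq_square power3_eq_cube)
    show ?thesis
      unfolding S_roots_def w(2) mem_Collect_eq k mult_eq_0_iff neg_equal_0_iff_equal using n27 by blast
  qed
  have "bij_betw uminus {y. y ^ 3 + y ^ 2 + - w = 0} (S_roots t)"
  proof (rule bij_betwI[where g = uminus])
    show "uminus \<in> {y. y ^ 3 + y ^ 2 + - w = 0} \<rightarrow> S_roots t"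
      using eq by blast
    show "uminus \<in> S_roots t \<rightarrow> {y. y ^ 3 + y ^ 2 + - w = 0}"
    proof
      fix y assume "y \<in> S_roots t"
      hence "- (- y) \<in> S_roots t" by simp
      thus "- y \<in> {y. y ^ 3 + y ^ 2 + - w = 0}" unfolding eq by blast
    qed
  qed simp_all
  thus ?thesis unfolding w by (rule bij_betw_same_card)
qed

lemma G2_tilde_formula:
  fixes t :: "'p::prime_card mod_ring"
  assumes p: "CARD('p) > 3" and t: "t \<noteq> 0"
  shows "G2_tilde t = of_int (quadratic_char (3 * t) * (int (card (S_roots t)) - 1))"
proof -
  let ?P = "of_nat CARD('p) :: 'p padic"
  define q where "q = CARD('p) - 1"
  define h where "h = q div 2"
  define u where "u = (- 4 / (27 * t) :: 'p mod_ring)"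
  define N where "N = card (S_roots t)"
  define F where "F = (\<lambda>i. teich u ^ i * jacobi_term i (2 * i mod q))"
  define \<phi> where "\<phi> = (of_int (quadratic_char (3 * t)) :: 'p padic)"
  have odd: "odd CARD('p)" using p primes_dvd_imp_eq[of 2 "CARD('p)"] by auto
  have qh: "q = h + h" using odd by (simp add: q_def h_def flip: mult_2)
  have q0: "q > 0" using p by (simp add: q_def)
  have u0: "u \<noteq> 0" using t mod_ring_numeral_nonzero[OF p] by (simp add: u_def)
  have P: "?P = of_nat q + 1" using p by (simp add: q_def of_nat_diff)
  have "(\<Sum>j<q. teichmuller_bar_pow j t * mccarthy_term j)
      = (\<Sum>j<q. \<phi> * (if (j + h) mod q = 0 then 1 else F ((j + h) mod q) / ?P))"
  proof (intro sum.cong refl)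
    fix j assume "j \<in> {..<q}"
    hence "j < CARD('p) - 1" by (simp add: q_def)
    from mccarthy_term_value[OF p t this]
    show "teichmuller_bar_pow j t * mccarthy_term j = \<phi> * (if (j + h) mod q = 0 then 1 else F ((j + h) mod q) / ?P)"
      unfolding F_def \<phi>_def u_def h_def q_def .
  qed
  also have "\<dots> = (\<Sum>i<q. \<phi> * (if i = 0 then 1 else F i / ?P))"
    by (rule sum.reindex_bij_witness[where i = "\<lambda>j. (j + h) mod q" and j = "\<lambda>j. (j + h) mod q"])
      (use q0 in \<open>auto simp: mod_simps add.assoc qh[symmetric]\<close>)
  \<comment> \<open>The trivial character contributes \<open>1\<close>, whereas the pattern of the
    other indices would give \<open>F 0 / p = 1 / p\<close>. The difference is separated so that the
    complete sum over \<open>F\<close> can be evaluated by \<open>jacobi_cubic\<close>.\<close>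
  also have "\<dots> = \<phi> * (\<Sum>i<q. F i / ?P + (if i = 0 then 1 - F 0 / ?P else 0))"
    unfolding sum_distrib_left by (intro sum.cong refl) auto
  also have "(\<Sum>i<q. F i / ?P + (if i = 0 then 1 - F 0 / ?P else 0)) = (\<Sum>i<q. F i) / ?P + (1 - F 0 / ?P)"
    using q0 by (simp add: sum.distrib sum_divide_distrib sum.delta)
  also have "F 0 = 1" using jacobi_term_0[OF p] by (simp add: F_def)
  also have "(\<Sum>i<q. F i) = of_nat q * (of_nat q - ?P * of_nat N)"
    using jacobi_cubic[OF p u0] card_S_roots[OF p t]
    by (simp only: F_def q_def N_def u_def)
  also have "of_nat q * (of_nat q - ?P * of_nat N) / ?P + (1 - 1 / ?P) = of_nat q * (1 - of_nat N)"
  proof -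
    have "of_nat q * (of_nat q - ?P * of_nat N) + (?P - 1) = ?P * (of_nat q * (1 - of_nat N))"
      unfolding P by (simp add: algebra_simps)
    moreover have "?P \<noteq> 0" by simp
    ultimately show ?thesis by (simp add: divide_simps mult.commute)
  qed
  finally have S: "(\<Sum>j<q. teichmuller_bar_pow j t * mccarthy_term j) = \<phi> * (of_nat q * (1 - of_nat N))" .
  have "G2_tilde t = - 1 / of_nat q * (\<phi> * (of_nat q * (1 - of_nat N)))"
    unfolding G2_tilde_expand[OF p] q_def[symmetric] S ..
  also have "\<dots> = \<phi> * (of_nat N - 1)"
    using q0 by (simp add: field_simps)
  finally show ?thesis by (simp add: \<phi>_def N_def)
qed

text \<open>At \<open>t = 1\<close> the cubic has the double root \<open>2 / 3\<close> besides
  \<open>- 1 / 3\<close>, and these differ as \<open>3 \<noteq> 0\<close>. The factor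
  \<open>2 - 1\<close> in the general formula then leaves the bare character value.\<close>

lemma card_S_roots_1:
  assumes p: "CARD('p::prime_card) > 3"
  shows "card (S_roots (1 :: 'p mod_ring)) = 2"
proof -
  note n3 = mod_ring_numeral_nonzero(2)[OF p]
  have "27 * y ^ 3 - 27 * y ^ 2 + 4 / 1 = (3 * y - 2) ^ 2 * (3 * y + 1)" for y :: "'p mod_ring"
    by (simp add: power2_eq_square power3_eq_cube algebra_simps)
  hence "y \<in> S_roots 1 \<longleftrightarrow> 3 * y - 2 = 0 \<or> 3 * y + 1 = 0" for y :: "'p mod_ring"
    by (simp add: S_roots_def)
  moreover have "3 * y - 2 = 0 \<longleftrightarrow> y = 2 / 3" "3 * y + 1 = 0 \<longleftrightarrow> y = - 1 / 3" for y :: "'p mod_ring"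
    unfolding nonzero_eq_divide_eq[OF n3] eq_iff_diff_eq_0[of "y * 3"] by (simp_all add: mult.commute)
  ultimately have "S_roots 1 = {2 / 3, - 1 / 3 :: 'p mod_ring}" by auto
  moreover have "2 / 3 \<noteq> (- 1 / 3 :: 'p mod_ring)"
  proof
    assume "2 / 3 = (- 1 / 3 :: 'p mod_ring)"
    hence "2 = (- 1 :: 'p mod_ring)" using n3 by (simp only: divide_cancel_right simp_thms)
    hence "2 + 1 = (0 :: 'p mod_ring)" by (simp only: eq_neg_iff_add_eq_0)
    thus False using n3 by simp
  qed
  ultimately show ?thesis by simp
qed

theorem theorem1p6:
  fixes t :: "'p::prime_card mod_ring"
  assumes "CARD('p) > 3"
    and "t \<noteq> 0"
  shows "G2_tilde (1 :: 'p mod_ring) = of_int (quadratic_char (3 :: 'p mod_ring)) \<and>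
    (t \<noteq> 1 \<longrightarrow>
      G2_tilde t = of_int (quadratic_char (3 * t) * (int (card (S_roots t)) - 1)))"
  using G2_tilde_formula[OF assms] G2_tilde_formula[OF assms(1), of 1] card_S_roots_1[OF assms(1)]
  by simp

end
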